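(* In every sharp theory with purification, the following three requirements are equivalent: (Permutability) every permutation of every pure maximal set of every system can be implemented by a reversible channel; (Strong Symmetry) for every two pure maximal sets of the same system there exists a reversible channel that converts the states in one set into the states in the other (i.e. for pure maximal sets $\{\varphi_i\}_{i=1}^d$, $\{\psi_i\}_{i=1}^d$ there is a reversible channel $\mathcal U$ with $\mathcal U\varphi_i=\psi_i$ for all $i$); (Reversible Controllability) for every pair of systems $A$ and $B$, every pure maximal set $\{\alpha_i\}_{i=1}^d$ of $A$ and every family $\{\mathcal U_i\}_{i=1}^d$ of (not necessarily distinct) reversible channels on $B$, there exists a reversible channel $\mathcal U$ on $AB$ such that $\mathcal U(\alpha_i\otimes\mathcal I_B)=\alpha_i\otimes\mathcal U_i$ (as transformations from $B$ to $AB$) for every $i\in\{1,\dots,d\}$.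
   Context: Framework. A causal operational probabilistic theory (OPT) has systems $A,B,\dots$ (including a trivial system $I$), with associative composites $AB$ ($AI=IA=A$; $AB$ and $BA$ related by a reversible swap), and tests. A test from $A$ to $B$ is a finite family $\{\mathcal C_i\}_{i\in X}$ of transformations from $A$ to $B$. Tests are closed under sequential composition, parallel composition $\otimes$ and coarse-graining (summing transformations over the blocks of a partition of $X$); identities $\mathcal I_A$ and swaps are one-outcome tests; systems and transformations form a strict symmetric monoidal category. Tests on $I$ are probability distributions, numbers compose by multiplication, and all probabilities in $[0,1]$ are available. A state of $A$ is a transformation $I\to A$, an effect is a transformation $A\to I$, $(a|\rho)\in[0,1]$ is their composition; tests $A\to I$ are observation-tests. States (effects) are equal iff they have the same pairing with all effects (states); transformations $\mathcal C,\mathcal C'$ from $A$ to $B$ are equal iff $(\mathcal C\otimes\mathcal I_S)\rho=(\mathcal C'\otimes\mathcal I_S)\rho$ for every system $S$ and state $\rho$ of $AS$. The spanned real vector spaces are finite-dimensional; the sets of states, effects and transformations are closed (hence compact). Every test $\{\mathcal A_i\}$ from $A$ to $B$ has the form $\mathcal A_i=(\mathcal I_B\otimes e_i)\mathcal A$ with $\mathcal A$ a deterministic transformation from $A$ to some $BX$ and $\{e_i\}$ an observation-test on $X$. A channel is a deterministic (one-outcome-test) transformation; it is reversible if it has an inverse channel. A transformation $\mathcal T$ is pure if whenever $\mathcal T=\sum_{i\in X_0}\mathcal D_i$ with $X_0\subseteq X$ and $\{\mathcal D_i\}_{i\in X}$ a test, every $\mathcal D_i$, $i\in X_0$, is a multiple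 of $\mathcal T$. Causality: every system has a unique deterministic effect $u_A$; the marginal on $A$ of a state of $AB$ is obtained by applying $u_B$. A state is normalised if $(u|\rho)=1$. Tests may be chosen conditionally on earlier outcomes and randomised, so normalised states form a convex set; every nonzero state is a multiple of a normalised one. A sharp theory with purification is a causal OPT satisfying: Purity Preservation (sequential and parallel compositions of pure transformations are pure); Pure Sharpness (for every system there is a pure effect $a$ and a state $\rho$ with $(a|\rho)=1$); Purification (every normalised state $\rho$ of $A$ is the marginal of a normalised pure state of some composite $AB$, and if two normalised pure states $\Psi,\Psi'$ of $AB$ have the same marginal on $A$ then $\Psi'=(\mathcal I_A\otimes\mathcal U)\Psi$ for a reversible channel $\mathcal U$ on $B$). Normalised states $\{\rho_i\}$ are perfectly distinguishable if there is an observation-test $\{a_i\}$ with $(a_i|\rho_j)=\delta_{ij}$. A pure maximal set is a set of perfectly distinguishable normalised pure states to which no state can be added keeping perfect distinguishability. In sharp theories with purification all pure maximal sets of a given system have the same cardinality $d$, called the dimension of the system. *)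

theory Defs
  imports "HOL-Analysis.Analysis"
begin

text \<open>
  Systems are the elements of \<^typ>\<open>'s\<close>. All transformations, for all pairs of systems, live in one
  real normed space \<^typ>\<open>'t\<close>, so that coarse-graining, multiples and spans are those of
  \<^typ>\<open>'t\<close>. This loses no generality: take for \<^typ>\<open>'t\<close> the direct sum, over all pairs of systems,
  of the spaces spanned by the transformations, and extend both compositions bilinearly. Every
  span is finite-dimensional, so closedness does not depend on the choice of the norm.

  A finite family of transformations is a list; its outcome set is the set of positions.
\<close>

record ('s, 't) op_structure =
  triv  :: 's  (\<open>\<I>\<index>\<close>)
  cmpst :: "'s \<Rightarrow> 's \<Rightarrow> 's"  (infixr \<open>\<diamondop>\<index>\<close> 75)
  idt   :: "'s \<Rightarrow> 't"
  swp   :: "'s \<Rightarrow> 's \<Rightarrow> 't"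
  sq    :: "'t \<Rightarrow> 't \<Rightarrow> 't"  (infixr \<open>\<odot>\<index>\<close> 70)  \<comment> \<open>\<open>g \<odot> f\<close> is \<open>f\<close> followed by \<open>g\<close>\<close>
  par   :: "'t \<Rightarrow> 't \<Rightarrow> 't"  (infixr \<open>\<otimes>\<index>\<close> 75)
  tests :: "'s \<Rightarrow> 's \<Rightarrow> 't list set"

definition trafos :: "('s, 't) op_structure \<Rightarrow> 's \<Rightarrow> 's \<Rightarrow> 't set" where
  "trafos T A B = (\<Union>cs \<in> tests T A B. set cs)"

abbreviation states :: "('s, 't) op_structure \<Rightarrow> 's \<Rightarrow> 't set" where
  "states T A \<equiv> trafos T \<I>\<^bsub>T\<^esub> A"

abbreviation effects :: "('s, 't) op_structure \<Rightarrow> 's \<Rightarrow> 't set" where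
  "effects T A \<equiv> trafos T A \<I>\<^bsub>T\<^esub>"

definition channel :: "('s, 't) op_structure \<Rightarrow> 's \<Rightarrow> 's \<Rightarrow> 't \<Rightarrow> bool" where
  "channel T A B C \<longleftrightarrow> [C] \<in> tests T A B"

definition reversible :: "('s, 't) op_structure \<Rightarrow> 's \<Rightarrow> 's \<Rightarrow> 't \<Rightarrow> bool" where
  "reversible T A B U \<longleftrightarrow> channel T A B U \<and>
     (\<exists>V. channel T B A V \<and> V \<odot>\<^bsub>T\<^esub> U = idt T A \<and> U \<odot>\<^bsub>T\<^esub> V = idt T B)"

definition unit_effect :: "('s, 't) op_structure \<Rightarrow> 's \<Rightarrow> 't" where
  "unit_effect T A = (THE u. channel T A \<I>\<^bsub>T\<^esub> u)"

definition num :: "('s, 't::real_normed_vector) op_structure \<Rightarrow> real \<Rightarrow> 't" where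
  "num T p = p *\<^sub>R idt T \<I>\<^bsub>T\<^esub>"

definition normalised :: "('s, 't::real_normed_vector) op_structure \<Rightarrow> 's \<Rightarrow> 't \<Rightarrow> bool" where
  "normalised T A \<rho> \<longleftrightarrow> \<rho> \<in> states T A \<and> unit_effect T A \<odot>\<^bsub>T\<^esub> \<rho> = num T 1"

definition marginal :: "('s, 't) op_structure \<Rightarrow> 's \<Rightarrow> 's \<Rightarrow> 't \<Rightarrow> 't" where
  "marginal T A B \<sigma> = (idt T A \<otimes>\<^bsub>T\<^esub> unit_effect T B) \<odot>\<^bsub>T\<^esub> \<sigma>"

definition pure :: "('s, 't::real_normed_vector) op_structure \<Rightarrow> 's \<Rightarrow> 's \<Rightarrow> 't \<Rightarrow> bool" where
  "pure T A B C \<longleftrightarrow> C \<in> trafos T A B \<and>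
     (\<forall>ds \<in> tests T A B. \<forall>X\<^sub>0 \<subseteq> {..<length ds}.
        C = (\<Sum>i\<in>X\<^sub>0. ds ! i) \<longrightarrow> (\<forall>i\<in>X\<^sub>0. \<exists>c::real. ds ! i = c *\<^sub>R C))"

text \<open>
  The separation axioms are stated on spans: the vector spaces are those of the functionals which
  states, effects and transformations induce, so a linear combination that induces the zero
  functional is the zero vector.
\<close>

locale causal_opt =
  fixes T :: "('s, 't::real_normed_vector) op_structure" (structure)
  assumes bilinear_sq: "bilinear (sq T)"
    and bilinear_par: "bilinear (par T)"
    \<comment> \<open>systems\<close>
    and cmpst_assoc: "(A \<diamondop> B) \<diamondop> C = A \<diamondop> (B \<diamondop> C)"
    and cmpst_triv_left: "\<I> \<diamondop> A = A"
    and cmpst_triv_right: "A \<diamondop> \<I> = A"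
    \<comment> \<open>tests\<close>
    and test_nonempty: "[] \<notin> tests T A B"
    and test_idt: "[idt T A] \<in> tests T A A"
    and test_swp: "[swp T A B] \<in> tests T (A \<diamondop> B) (B \<diamondop> A)"
    \<comment> \<open>the choice of the second test may depend on the outcome of the first; for constant
      \<open>dss\<close> this is sequential composition\<close>
    and test_sq: "\<lbrakk>cs \<in> tests T A B; length dss = length cs; set dss \<subseteq> tests T B C\<rbrakk>
      \<Longrightarrow> concat (map2 (\<lambda>c ds. map (\<lambda>d. d \<odot> c) ds) cs dss) \<in> tests T A C"
    and test_par: "\<lbrakk>cs \<in> tests T A B; ds \<in> tests T C D\<rbrakk>
      \<Longrightarrow> concat (map (\<lambda>c. map (\<lambda>d. c \<otimes> d) ds) cs) \<in> tests T (A \<diamondop> C) (B \<diamondop> D)"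
    and test_coarse_grain: "\<lbrakk>cs \<in> tests T A B; block ` {..<length cs} = {..<m}\<rbrakk>
      \<Longrightarrow> map (\<lambda>k. \<Sum>i | i < length cs \<and> block i = k. cs ! i) [0..<m] \<in> tests T A B"
    and tests_triv: "tests T \<I> \<I> = {map (num T) ps | ps. (\<forall>p \<in> set ps. 0 \<le> p) \<and> sum_list ps = 1}"
    and idt_triv_nonzero: "idt T \<I> \<noteq> 0"
    and test_dilation: "cs \<in> tests T A B
      \<Longrightarrow> \<exists>X C es. channel T A (B \<diamondop> X) C \<and> es \<in> tests T X \<I> \<and>
            cs = map (\<lambda>e. (idt T B \<otimes> e) \<odot> C) es"
    \<comment> \<open>strict symmetric monoidal category\<close>
    and sq_assoc: "\<lbrakk>f \<in> trafos T A B; g \<in> trafos T B C; h \<in> trafos T C D\<rbrakk>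
      \<Longrightarrow> (h \<odot> g) \<odot> f = h \<odot> (g \<odot> f)"
    and sq_idt_left: "f \<in> trafos T A B \<Longrightarrow> idt T B \<odot> f = f"
    and sq_idt_right: "f \<in> trafos T A B \<Longrightarrow> f \<odot> idt T A = f"
    and par_assoc: "\<lbrakk>f \<in> trafos T A B; g \<in> trafos T C D; h \<in> trafos T E F\<rbrakk>
      \<Longrightarrow> (f \<otimes> g) \<otimes> h = f \<otimes> (g \<otimes> h)"
    and par_triv_left: "f \<in> trafos T A B \<Longrightarrow> idt T \<I> \<otimes> f = f"
    and par_triv_right: "f \<in> trafos T A B \<Longrightarrow> f \<otimes> idt T \<I> = f"
    and par_idt: "idt T A \<otimes> idt T B = idt T (A \<diamondop> B)"
    and interchange: "\<lbrakk>f \<in> trafos T A B; g \<in> trafos T B C; f' \<in> trafos T A' B'; g' \<in> trafos T B' C'\<rbrakk>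
      \<Longrightarrow> (g \<otimes> g') \<odot> (f \<otimes> f') = (g \<odot> f) \<otimes> (g' \<odot> f')"
    and swp_swp: "swp T B A \<odot> swp T A B = idt T (A \<diamondop> B)"
    and swp_natural: "\<lbrakk>f \<in> trafos T A B; g \<in> trafos T C D\<rbrakk>
      \<Longrightarrow> swp T B D \<odot> (f \<otimes> g) = (g \<otimes> f) \<odot> swp T A C"
    and swp_hexagon: "swp T A (B \<diamondop> C) = (idt T B \<otimes> swp T A C) \<odot> (swp T A B \<otimes> idt T C)"
    \<comment> \<open>separation\<close>
    and states_eqI: "\<lbrakk>\<rho> \<in> span (states T A); \<sigma> \<in> span (states T A);
        \<And>a. a \<in> effects T A \<Longrightarrow> a \<odot> \<rho> = a \<odot> \<sigma>\<rbrakk> \<Longrightarrow> \<rho> = \<sigma>"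
    and effects_eqI: "\<lbrakk>a \<in> span (effects T A); b \<in> span (effects T A);
        \<And>\<rho>. \<rho> \<in> states T A \<Longrightarrow> a \<odot> \<rho> = b \<odot> \<rho>\<rbrakk> \<Longrightarrow> a = b"
    and trans_eqI: "\<lbrakk>f \<in> span (trafos T A B); g \<in> span (trafos T A B);
        \<And>S \<rho>. \<rho> \<in> states T (A \<diamondop> S) \<Longrightarrow> (f \<otimes> idt T S) \<odot> \<rho> = (g \<otimes> idt T S) \<odot> \<rho>\<rbrakk> \<Longrightarrow> f = g"
    \<comment> \<open>finite dimension, closedness\<close>
    and finite_dim: "\<exists>S. finite S \<and> trafos T A B \<subseteq> span S"
    and closed_trans: "closed (trafos T A B)"
    \<comment> \<open>causality\<close>
    and causality: "\<exists>!u. channel T A \<I> u"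
    and normalisable: "\<lbrakk>\<rho> \<in> states T A; \<rho> \<noteq> 0\<rbrakk> \<Longrightarrow> \<exists>p \<sigma>. normalised T A \<sigma> \<and> \<rho> = p *\<^sub>R \<sigma>"

locale sharp_theory_with_purification = causal_opt +
  assumes pure_sq: "\<lbrakk>pure T A B f; pure T B C g\<rbrakk> \<Longrightarrow> pure T A C (g \<odot> f)"
    and pure_par: "\<lbrakk>pure T A B f; pure T C D g\<rbrakk> \<Longrightarrow> pure T (A \<diamondop> C) (B \<diamondop> D) (f \<otimes> g)"
    and pure_sharpness: "\<exists>a \<rho>. pure T A \<I> a \<and> \<rho> \<in> states T A \<and> a \<odot> \<rho> = num T 1"
    and purification_exists: "normalised T A \<rho> \<Longrightarrow>
      \<exists>B \<Psi>. normalised T (A \<diamondop> B) \<Psi> \<and> pure T \<I> (A \<diamondop> B) \<Psi> \<and> marginal T A B \<Psi> = \<rho>"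
    and purification_unique:
      "\<lbrakk>normalised T (A \<diamondop> B) \<Psi>; pure T \<I> (A \<diamondop> B) \<Psi>;
        normalised T (A \<diamondop> B) \<Psi>'; pure T \<I> (A \<diamondop> B) \<Psi>';
        marginal T A B \<Psi> = marginal T A B \<Psi>'\<rbrakk>
       \<Longrightarrow> \<exists>U. reversible T B B U \<and> \<Psi>' = (idt T A \<otimes> U) \<odot> \<Psi>"

text \<open>
  Sets of states are given by an enumeration. Perfectly distinguishable states are necessarily
  distinct, so no repetitions occur.
\<close>

definition perf_dist :: "('s, 't::real_normed_vector) op_structure \<Rightarrow> 's \<Rightarrow> 't list \<Rightarrow> bool" where
  "perf_dist T A \<rho>s \<longleftrightarrow> (\<forall>\<rho> \<in> set \<rho>s. normalised T A \<rho>) \<and>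
     (\<exists>as \<in> tests T A \<I>\<^bsub>T\<^esub>. length as = length \<rho>s \<and>
        (\<forall>i < length \<rho>s. \<forall>j < length \<rho>s. as ! i \<odot>\<^bsub>T\<^esub> \<rho>s ! j = num T (if i = j then 1 else 0)))"

definition pure_maximal :: "('s, 't::real_normed_vector) op_structure \<Rightarrow> 's \<Rightarrow> 't list \<Rightarrow> bool" where
  "pure_maximal T A \<phi>s \<longleftrightarrow> perf_dist T A \<phi>s \<and> (\<forall>\<phi> \<in> set \<phi>s. pure T \<I>\<^bsub>T\<^esub> A \<phi>) \<and>
     \<not> (\<exists>\<rho>. perf_dist T A (\<phi>s @ [\<rho>]))"

definition permutability :: "('s, 't::real_normed_vector) op_structure \<Rightarrow> bool" where
  "permutability T \<longleftrightarrow> (\<forall>A \<phi>s \<pi>. pure_maximal T A \<phi>s \<and> \<pi> permutes {..<length \<phi>s} \<longrightarrow>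
     (\<exists>U. reversible T A A U \<and> (\<forall>i < length \<phi>s. U \<odot>\<^bsub>T\<^esub> \<phi>s ! i = \<phi>s ! \<pi> i)))"

definition strong_symmetry :: "('s, 't::real_normed_vector) op_structure \<Rightarrow> bool" where
  "strong_symmetry T \<longleftrightarrow> (\<forall>A \<phi>s \<psi>s. pure_maximal T A \<phi>s \<and> pure_maximal T A \<psi>s \<longrightarrow>
     (\<exists>U. reversible T A A U \<and> map (\<lambda>\<phi>. U \<odot>\<^bsub>T\<^esub> \<phi>) \<phi>s = \<psi>s))"

definition reversible_controllability :: "('s, 't::real_normed_vector) op_structure \<Rightarrow> bool" where
  "reversible_controllability T \<longleftrightarrow> (\<forall>A B \<alpha>s Us.
     pure_maximal T A \<alpha>s \<and> length Us = length \<alpha>s \<and> (\<forall>V \<in> set Us. reversible T B B V) \<longrightarrow>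
     (\<exists>U. reversible T (A \<diamondop>\<^bsub>T\<^esub> B) (A \<diamondop>\<^bsub>T\<^esub> B) U \<and>
        (\<forall>i < length \<alpha>s. U \<odot>\<^bsub>T\<^esub> (\<alpha>s ! i \<otimes>\<^bsub>T\<^esub> idt T B) = \<alpha>s ! i \<otimes>\<^bsub>T\<^esub> Us ! i)))"

end

theory Submission
  imports Defs
begin

text \<open>
  Permutability and reversible controllability each yield a reversible \<open>W\<close> with
  \<open>W (\<phi>\<^sub>i \<otimes> \<psi>\<^sub>0) = \<phi>\<^sub>0 \<otimes> \<psi>\<^sub>i\<close>. Sandwiching \<open>W\<close> between the state \<open>\<psi>\<^sub>0\<close> and a sharp effect for \<open>\<phi>\<^sub>0\<close>
  gives a pure transformation with \<open>\<phi>\<^sub>i \<mapsto> \<psi>\<^sub>i\<close>. Being deterministic on the mixture of the \<open>\<phi>\<^sub>i\<close>, it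
  does not disturb the complementary marginal of a purification of that mixture, so uniqueness of
  purification replaces it by a reversible channel; maximality then makes both cardinalities equal.

  Conversely, let \<open>\<Phi>\<close> be a faithful pure state of \<open>BC\<close>. Strong symmetry provides a reversible channel
  on \<open>ABC\<close> with \<open>\<alpha>\<^sub>i \<otimes> \<Phi> \<mapsto> \<alpha>\<^sub>i \<otimes> U\<^sub>i \<Phi>\<close>. Apply it to \<open>\<Gamma> \<otimes> \<Phi>\<close>, where \<open>\<Gamma>\<close> is a pure state of \<open>AR\<close> from
  which sharp pure effects on \<open>R\<close> steer to the \<open>\<alpha>\<^sub>i\<close>. The marginal on \<open>CR\<close> does not change, so by
  uniqueness of purification a reversible channel on \<open>AB\<close> alone has the same effect, and it is the
  desired controlled channel. Constructing \<open>\<Gamma>\<close> needs a sharp pure effect that vanishes on some state;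
  it is found by maximising over the compact set of reversible channels.
\<close>

text \<open>Permutability relates only states of one distinguishable set, whereas strong symmetry
  compares two sets that need not be jointly distinguishable. Passing to
  \<open>A \<diamondop> A\<close> removes this obstacle: both families of products that the exchange
  relates lie in a single distinguishable grid. Controllability reaches the same exchange by writing
  \<open>\<psi>\<^sub>i\<close> under the control of \<open>\<phi>\<^sub>i\<close> and then erasing
  \<open>\<phi>\<^sub>i\<close> under the control of \<open>\<psi>\<^sub>i\<close>.

  In the converse, strong symmetry fixes its channel only on the products
  \<open>\<alpha>\<^sub>i \<otimes> \<Phi>\<close>. What it leaves on \<open>C\<close> and
  \<open>R\<close> when applied to \<open>\<Gamma> \<otimes> \<Phi>\<close> is therefore unknown at
  first. The sharp effects on \<open>R\<close> settle this: each is certain on one state only, so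
  the conditional states on \<open>R\<close> are forced, and the marginal is a mixture that does not
  depend on the \<open>U\<^sub>i\<close>.

  No diagonalisation of states is assumed. A maximum over an orbit of effects takes its place, and
  compactness is there to make that maximum attained.\<close>

subsection \<open>Coordinatewise limits\<close>

text \<open>
  The two compositions are bilinear but not assumed continuous for the norm, so limits are taken
  in coordinates.
\<close>

definition coord_tends :: "(nat \<Rightarrow> 'v::real_vector) \<Rightarrow> 'v \<Rightarrow> bool" where
  "coord_tends x l \<longleftrightarrow> (\<exists>B c k. finite B \<and> (\<forall>n. x n = (\<Sum>b\<in>B. c n b *\<^sub>R b)) \<and>
     (\<forall>b\<in>B. (\<lambda>n. c n b) \<longlonglongrightarrow> (k b :: real)) \<and> l = (\<Sum>b\<in>B. k b *\<^sub>R b))"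

lemma coord_tendsE:
  assumes "coord_tends x l"
  obtains B c k where "finite B" "\<And>n. x n = (\<Sum>b\<in>B. c n b *\<^sub>R b)"
     "\<And>b. b \<in> B \<Longrightarrow> (\<lambda>n. c n b) \<longlonglongrightarrow> (k b :: real)" "l = (\<Sum>b\<in>B. k b *\<^sub>R b)"
  using assms unfolding coord_tends_def by blast

lemma coord_tends_subseq:
  assumes "coord_tends x l" "strict_mono r"
  shows "coord_tends (x \<circ> r) l"
proof -
  obtain B c k where B: "finite B" "\<And>n. x n = (\<Sum>b\<in>B. c n b *\<^sub>R b)"
     "\<And>b. b \<in> B \<Longrightarrow> (\<lambda>n. c n b) \<longlonglongrightarrow> (k b :: real)" "l = (\<Sum>b\<in>B. k b *\<^sub>R b)"
    using coord_tendsE[OF assms(1)] by blast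
  have "(\<lambda>n. c (r n) b) \<longlonglongrightarrow> k b" if "b \<in> B" for b
    using LIMSEQ_subseq_LIMSEQ[OF B(3)[OF that] assms(2)] by (simp add: o_def)
  then show ?thesis
    unfolding coord_tends_def using B by (intro exI[of _ B] exI[of _ "\<lambda>n. c (r n)"] exI[of _ k]) auto
qed

lemma coord_tends_add:
  assumes "coord_tends x l" "coord_tends y m"
  shows "coord_tends (\<lambda>n. x n + y n) (l + m)"
proof -
  obtain B c k where B: "finite B" "\<And>n. x n = (\<Sum>b\<in>B. c n b *\<^sub>R b)"
     "\<And>b. b \<in> B \<Longrightarrow> (\<lambda>n. c n b) \<longlonglongrightarrow> (k b :: real)" "l = (\<Sum>b\<in>B. k b *\<^sub>R b)"
    using coord_tendsE[OF assms(1)] by blast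
  obtain D d j where D: "finite D" "\<And>n. y n = (\<Sum>b\<in>D. d n b *\<^sub>R b)"
     "\<And>b. b \<in> D \<Longrightarrow> (\<lambda>n. d n b) \<longlonglongrightarrow> (j b :: real)" "m = (\<Sum>b\<in>D. j b *\<^sub>R b)"
    using coord_tendsE[OF assms(2)] by blast
  \<comment> \<open>Coefficients are extended by zero to the union of the two supporting
    sets.\<close>
  have ext: "(\<Sum>b\<in>B. f b *\<^sub>R b) + (\<Sum>b\<in>D. g b *\<^sub>R b) =
     (\<Sum>b\<in>B \<union> D. ((if b \<in> B then f b else 0) + (if b \<in> D then g b else 0)) *\<^sub>R b)" for f g :: "'a \<Rightarrow> real"
  proof -
    have "(\<Sum>b\<in>B. f b *\<^sub>R b) = (\<Sum>b\<in>B \<union> D. (if b \<in> B then f b else 0) *\<^sub>R b)"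
      using B(1) D(1) by (intro sum.mono_neutral_cong_left) auto
    moreover have "(\<Sum>b\<in>D. g b *\<^sub>R b) = (\<Sum>b\<in>B \<union> D. (if b \<in> D then g b else 0) *\<^sub>R b)"
      using B(1) D(1) by (intro sum.mono_neutral_cong_left) auto
    ultimately show ?thesis by (simp add: sum.distrib scaleR_left_distrib)
  qed
  show ?thesis
    unfolding coord_tends_def
  proof (intro exI[of _ "B \<union> D"] exI[of _ "\<lambda>n b. (if b \<in> B then c n b else 0) + (if b \<in> D then d n b else 0)"]
      exI[of _ "\<lambda>b. (if b \<in> B then k b else 0) + (if b \<in> D then j b else 0)"] conjI allI ballI)
    fix b assume "b \<in> B \<union> D"
    show "(\<lambda>n. (if b \<in> B then c n b else 0) + (if b \<in> D then d n b else 0)) \<longlonglongrightarrow>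
        (if b \<in> B then k b else 0) + (if b \<in> D then j b else 0)"
      using B(3) D(3) by (intro tendsto_add) auto
  qed (use B(1,2,4) D(1,2,4) ext in auto)
qed

lemma coord_tends_scale:
  assumes "t \<longlonglongrightarrow> (s :: real)"
  shows "coord_tends (\<lambda>n. t n *\<^sub>R b) (s *\<^sub>R b)"
  unfolding coord_tends_def using assms
  by (intro exI[of _ "{b}"] exI[of _ "\<lambda>n _. t n"] exI[of _ "\<lambda>_. s"]) auto

lemma coord_tends_linear:
  fixes h :: "'v::real_vector \<Rightarrow> 'w::real_normed_vector"
  assumes "coord_tends x l" "linear h"
  shows "(\<lambda>n. h (x n)) \<longlonglongrightarrow> h l"
proof -
  obtain B c k where B: "finite B" "\<And>n. x n = (\<Sum>b\<in>B. c n b *\<^sub>R b)"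
     "\<And>b. b \<in> B \<Longrightarrow> (\<lambda>n. c n b) \<longlonglongrightarrow> (k b :: real)" "l = (\<Sum>b\<in>B. k b *\<^sub>R b)"
    using coord_tendsE[OF assms(1)] by blast
  have "(\<lambda>n. \<Sum>b\<in>B. c n b *\<^sub>R h b) \<longlonglongrightarrow> (\<Sum>b\<in>B. k b *\<^sub>R h b)"
    using B(3) by (intro tendsto_sum tendsto_scaleR tendsto_const)
  then show ?thesis unfolding B(2,4) by (simp add: linear_sum[OF assms(2)] linear_scale[OF assms(2)])
qed

lemma coord_tends_bilinear:
  fixes h :: "'v::real_vector \<Rightarrow> 'u::real_vector \<Rightarrow> 'w::real_normed_vector"
  assumes "coord_tends x l" "coord_tends y m" "bilinear h"
  shows "(\<lambda>n. h (x n) (y n)) \<longlonglongrightarrow> h l m"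
proof -
  obtain B c k where B: "finite B" "\<And>n. x n = (\<Sum>b\<in>B. c n b *\<^sub>R b)"
     "\<And>b. b \<in> B \<Longrightarrow> (\<lambda>n. c n b) \<longlonglongrightarrow> (k b :: real)" "l = (\<Sum>b\<in>B. k b *\<^sub>R b)"
    using coord_tendsE[OF assms(1)] by blast
  have lin: "linear (\<lambda>v. h v w)" for w using assms(3) by (simp add: bilinear_def)
  have hx: "h (\<Sum>b\<in>B. f b *\<^sub>R b) w = (\<Sum>b\<in>B. f b *\<^sub>R h b w)" for f w
    using linear_sum[OF lin, of "\<lambda>b. f b *\<^sub>R b" B w] by (simp add: linear_scale[OF lin])
  have "(\<lambda>n. \<Sum>b\<in>B. c n b *\<^sub>R h b (y n)) \<longlonglongrightarrow> (\<Sum>b\<in>B. k b *\<^sub>R h b m)"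
    using assms(3) by (intro tendsto_sum tendsto_scaleR B(3) coord_tends_linear[OF assms(2)]) (auto simp: bilinear_def)
  then show ?thesis unfolding B(2,4) hx .
qed

text \<open>Bolzano-Weierstrass, with boundedness measured by a separating family of functionals
  instead of a norm. One functional splits off one coordinate, and what remains lies in the span of
  fewer vectors.\<close>

lemma coord_tends_extract:
  fixes x :: "nat \<Rightarrow> 'v::real_vector" and F :: "('v \<Rightarrow> real) set"
  assumes "finite B" "\<And>f. f \<in> F \<Longrightarrow> linear f"
    "\<And>v. v \<in> span B \<Longrightarrow> (\<And>f. f \<in> F \<Longrightarrow> f v = 0) \<Longrightarrow> v = 0"
    "\<And>n. x n \<in> span B" "\<And>f. f \<in> F \<Longrightarrow> \<exists>M. \<forall>n. \<bar>f (x n)\<bar> \<le> M"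
  shows "\<exists>r l. strict_mono (r :: nat \<Rightarrow> nat) \<and> coord_tends (x \<circ> r) l"
  using assms(1,3-)
proof (induction "card B" arbitrary: B x rule: less_induct)
  case less
  note fin = less.prems(1) and sep = less.prems(2) and xB = less.prems(3) and bdd = less.prems(4)
  show ?case
  proof (cases "\<forall>b\<in>B. \<forall>f\<in>F. f b = 0")
    case True
    then have "B \<subseteq> {0}" using sep span_base by blast
    then have "span B \<subseteq> span {0}" by (rule span_mono)
    then have x0: "x n = 0" for n using xB[of n] by auto
    have "coord_tends (x \<circ> id) 0"
      unfolding coord_tends_def using x0 by (intro exI[of _ "{}"]) auto
    then show ?thesis using strict_mono_id by blast
  next
    case False
    then obtain b0 f where b0: "b0 \<in> B" and f: "f \<in> F" "f b0 \<noteq> 0" by blast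
    note lf = assms(2)[OF f(1)]
    \<comment> \<open>The projection onto the kernel of \<open>f\<close> along \<open>b0\<close>. It
      kills \<open>b0\<close>, so the images of the other vectors span its range.\<close>
    define L where "L v = v - (f v / f b0) *\<^sub>R b0" for v
    have L: "linear L"
      unfolding L_def
      by (rule linearI) (simp_all add: linear_add[OF lf] linear_scale[OF lf] add_divide_distrib algebra_simps)
    define B' where "B' = L ` (B - {b0})"
    have fin': "finite B'" unfolding B'_def using fin by simp
    have "card B' \<le> card (B - {b0})" unfolding B'_def using fin by (intro card_image_le) simp
    also have "\<dots> < card B" using b0 fin by (meson card_Diff1_less)
    finally have cardlt: "card B' < card B" .
    have Lspan: "L v \<in> span B'" if "v \<in> span B" for v
    proof -
      have "L v \<in> span (L ` B)" using that linear_span_image[OF L] by blast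
      moreover have "L ` B = insert 0 B'"
      proof -
        have "L ` B = insert (L b0) (L ` (B - {b0}))" using b0 by blast
        then show ?thesis using f(2) by (simp add: B'_def L_def)
      qed
      ultimately show ?thesis by (simp add: span_insert_0)
    qed
    have "B' \<subseteq> span B"
      unfolding B'_def L_def using b0 span_base[of _ B]
      by (intro image_subsetI span_diff span_scale) auto
    then have "span B' \<subseteq> span B" by (meson span_minimal subspace_span)
    then have sep': "v = 0" if "v \<in> span B'" "\<And>f. f \<in> F \<Longrightarrow> f v = 0" for v using that sep by blast
    have bdd': "\<exists>M. \<forall>n. \<bar>g (L (x n))\<bar> \<le> M" if g: "g \<in> F" for g
    proof -
      obtain M N where M: "\<And>n. \<bar>f (x n)\<bar> \<le> M" and N: "\<And>n. \<bar>g (x n)\<bar> \<le> N" using bdd[OF f(1)] bdd[OF g] by blast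
      have "\<bar>g (L (x n))\<bar> \<le> N + M * \<bar>g b0 / f b0\<bar>" for n
      proof -
        have "g (L (x n)) = g (x n) - f (x n) * (g b0 / f b0)"
          by (simp add: L_def linear_diff[OF assms(2)[OF g]] linear_scale[OF assms(2)[OF g]])
        moreover have "\<bar>f (x n) * (g b0 / f b0)\<bar> \<le> M * \<bar>g b0 / f b0\<bar>"
          unfolding abs_mult by (intro mult_right_mono M) simp
        ultimately show ?thesis using N[of n] by linarith
      qed
      then show ?thesis by blast
    qed
    obtain r l where r: "strict_mono (r :: nat \<Rightarrow> nat)" "coord_tends ((\<lambda>n. L (x n)) \<circ> r) l"
      using less.hyps[OF cardlt fin' sep', of "\<lambda>n. L (x n)"] Lspan[OF xB] bdd' by blast
    \<comment> \<open>The coefficient of \<open>b0\<close> that \<open>L\<close> removes. It is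
      bounded because \<open>f\<close> is bounded along \<open>x\<close>, so a second subsequence
      makes it converge.\<close>
    define t where "t n = f (x (r n)) / f b0" for n
    obtain M where M: "\<And>n. \<bar>f (x n)\<bar> \<le> M" using bdd[OF f(1)] by blast
    have "bounded (range t)"
      unfolding bounded_iff t_def using M
      by (intro exI[of _ "M / \<bar>f b0\<bar>"]) (auto simp: abs_divide intro!: divide_right_mono)
    then obtain s q where s: "strict_mono (q :: nat \<Rightarrow> nat)" "(t \<circ> q) \<longlonglongrightarrow> s"
      using bounded_imp_convergent_subsequence by blast
    have "coord_tends (\<lambda>n. (((\<lambda>n. L (x n)) \<circ> r) \<circ> q) n + (t \<circ> q) n *\<^sub>R b0) (l + s *\<^sub>R b0)"
      by (rule coord_tends_add[OF coord_tends_subseq[OF r(2) s(1)] coord_tends_scale[OF s(2)]])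
    moreover have "(\<lambda>n. (((\<lambda>n. L (x n)) \<circ> r) \<circ> q) n + (t \<circ> q) n *\<^sub>R b0) = x \<circ> (r \<circ> q)"
      by (auto simp: L_def t_def)
    ultimately have "coord_tends (x \<circ> (r \<circ> q)) (l + s *\<^sub>R b0)" by simp
    then show ?thesis using strict_mono_o[OF r(1) s(1)] by blast
  qed
qed

subsection \<open>Tests, states and effects\<close>

context causal_opt
begin

lemma sq_add_left: "(f + g) \<odot> h = f \<odot> h + g \<odot> h"
  and sq_add_right: "h \<odot> (f + g) = h \<odot> f + h \<odot> g"
  and sq_diff_left: "(f - g) \<odot> h = f \<odot> h - g \<odot> h"
  and sq_diff_right: "h \<odot> (f - g) = h \<odot> f - h \<odot> g"
  and sq_scale_left: "(c *\<^sub>R f) \<odot> h = c *\<^sub>R (f \<odot> h)"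
  and sq_scale_right: "h \<odot> (c *\<^sub>R f) = c *\<^sub>R (h \<odot> f)"
  and sq_zero_left: "0 \<odot> h = 0"
  and sq_zero_right: "h \<odot> 0 = 0"
  by (rule bilinear_ladd[OF bilinear_sq] bilinear_radd[OF bilinear_sq] bilinear_lsub[OF bilinear_sq]
    bilinear_rsub[OF bilinear_sq] bilinear_lmul[OF bilinear_sq] bilinear_rmul[OF bilinear_sq]
    bilinear_lzero[OF bilinear_sq] bilinear_rzero[OF bilinear_sq])+

lemma par_add_left: "(f + g) \<otimes> h = f \<otimes> h + g \<otimes> h"
  and par_add_right: "h \<otimes> (f + g) = h \<otimes> f + h \<otimes> g"
  and par_diff_left: "(f - g) \<otimes> h = f \<otimes> h - g \<otimes> h"
  and par_diff_right: "h \<otimes> (f - g) = h \<otimes> f - h \<otimes> g"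
  and par_scale_left: "(c *\<^sub>R f) \<otimes> h = c *\<^sub>R (f \<otimes> h)"
  and par_scale_right: "h \<otimes> (c *\<^sub>R f) = c *\<^sub>R (h \<otimes> f)"
  and par_zero_left: "0 \<otimes> h = 0"
  and par_zero_right: "h \<otimes> 0 = 0"
  by (rule bilinear_ladd[OF bilinear_par] bilinear_radd[OF bilinear_par] bilinear_lsub[OF bilinear_par]
    bilinear_rsub[OF bilinear_par] bilinear_lmul[OF bilinear_par] bilinear_rmul[OF bilinear_par]
    bilinear_lzero[OF bilinear_par] bilinear_rzero[OF bilinear_par])+

lemmas bilin = sq_add_left sq_add_right sq_diff_left sq_diff_right sq_scale_left sq_scale_right
  sq_zero_left sq_zero_right par_add_left par_add_right par_diff_left par_diff_right
  par_scale_left par_scale_right par_zero_left par_zero_right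

lemma sq_sum_left: "sum f X \<odot> h = (\<Sum>x\<in>X. f x \<odot> h)"
  by (induction X rule: infinite_finite_induct) (auto simp: bilin)

lemma sq_sum_right: "h \<odot> sum f X = (\<Sum>x\<in>X. h \<odot> f x)"
  by (induction X rule: infinite_finite_induct) (auto simp: bilin)

lemma par_sum_left: "sum f X \<otimes> h = (\<Sum>x\<in>X. f x \<otimes> h)"
  by (induction X rule: infinite_finite_induct) (auto simp: bilin)

lemma par_sum_right: "h \<otimes> sum f X = (\<Sum>x\<in>X. h \<otimes> f x)"
  by (induction X rule: infinite_finite_induct) (auto simp: bilin)

lemmas bilin_sum = sq_sum_left sq_sum_right par_sum_left par_sum_right

text \<open>
  Reads off \<open>p\<close> from the scalar \<open>p *\<^sub>R idt T \<I>\<close>; off the line of scalars its value is arbitrary.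
\<close>

definition val :: "'t \<Rightarrow> real" where
  "val = (SOME v. linear v \<and> v (idt T \<I>) = 1)"

lemma val_props: "linear val" "val (idt T \<I>) = 1"
proof -
  have "independent {idt T \<I>}" using idt_triv_nonzero by simp
  from linear_independent_extend[OF this, of "\<lambda>_. 1::real"]
  have "\<exists>v. linear v \<and> v (idt T \<I>) = (1::real)" by auto
  from someI_ex[OF this] show "linear val" "val (idt T \<I>) = 1" unfolding val_def by auto
qed

lemma val_simps: "val (x + y) = val x + val y" "val (x - y) = val x - val y"
  "val (c *\<^sub>R x) = c * val x" "val 0 = 0" "val (idt T \<I>) = 1" "val (num T p) = p"
  by (simp_all add: linear_add[OF val_props(1)] linear_diff[OF val_props(1)] num_def
      linear_scale[OF val_props(1)] linear_0[OF val_props(1)] val_props(2))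

lemma val_sum: "val (sum f X) = (\<Sum>x\<in>X. val (f x))"
  using linear_sum[OF val_props(1)] .

section \<open>Transformations, channels and the deterministic effect\<close>

lemma test_trafos: "cs \<in> tests T A B \<Longrightarrow> c \<in> set cs \<Longrightarrow> c \<in> trafos T A B"
  by (auto simp: trafos_def)

lemma nth_trafos: "cs \<in> tests T A B \<Longrightarrow> i < length cs \<Longrightarrow> cs ! i \<in> trafos T A B"
  by (simp add: test_trafos)

lemma channel_trafos: "channel T A B C \<Longrightarrow> C \<in> trafos T A B"
  by (auto simp: channel_def intro: test_trafos)

lemma test_sq_const:
  assumes "cs \<in> tests T A B" "ds \<in> tests T B C"
  shows "concat (map (\<lambda>c. map (\<lambda>d. d \<odot> c) ds) cs) \<in> tests T A C"
proof -
  have "map2 (\<lambda>c ds. map (\<lambda>d. d \<odot> c) ds) cs (replicate (length cs) ds) = map (\<lambda>c. map (\<lambda>d. d \<odot> c) ds) cs"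
    by (simp add: zip_replicate2)
  then show ?thesis
    using test_sq[OF assms(1), of "replicate (length cs) ds" C] assms(2) by (simp add: set_replicate_conv_if)
qed

lemma sq_trafos: "f \<in> trafos T A B \<Longrightarrow> g \<in> trafos T B C \<Longrightarrow> g \<odot> f \<in> trafos T A C"
proof -
  assume "f \<in> trafos T A B" "g \<in> trafos T B C"
  then obtain cs ds where cs: "cs \<in> tests T A B" "f \<in> set cs" and ds: "ds \<in> tests T B C" "g \<in> set ds"
    unfolding trafos_def by blast
  show ?thesis by (rule test_trafos[OF test_sq_const[OF cs(1) ds(1)]]) (use cs(2) ds(2) in auto)
qed

lemma par_trafos: "f \<in> trafos T A B \<Longrightarrow> g \<in> trafos T C D \<Longrightarrow> f \<otimes> g \<in> trafos T (A \<diamondop> C) (B \<diamondop> D)"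
proof -
  assume "f \<in> trafos T A B" "g \<in> trafos T C D"
  then obtain cs ds where cs: "cs \<in> tests T A B" "f \<in> set cs" and ds: "ds \<in> tests T C D" "g \<in> set ds"
    unfolding trafos_def by blast
  show ?thesis by (rule test_trafos[OF test_par[OF cs(1) ds(1)]]) (use cs(2) ds(2) in auto)
qed

lemma idt_trafos: "idt T A \<in> trafos T A A"
  by (rule test_trafos[OF test_idt]) simp

lemma swp_trafos: "swp T A B \<in> trafos T (A \<diamondop> B) (B \<diamondop> A)"
  by (rule test_trafos[OF test_swp]) simp

lemma channel_sq: "channel T A B f \<Longrightarrow> channel T B C g \<Longrightarrow> channel T A C (g \<odot> f)"
  unfolding channel_def using test_sq_const[of "[f]" A B "[g]" C] by simp

lemma channel_par: "channel T A B f \<Longrightarrow> channel T C D g \<Longrightarrow> channel T (A \<diamondop> C) (B \<diamondop> D) (f \<otimes> g)"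
  unfolding channel_def using test_par[of "[f]" A B "[g]" C D] by simp

lemma channel_idt: "channel T A A (idt T A)"
  using test_idt by (simp add: channel_def)

lemma channel_swp: "channel T (A \<diamondop> B) (B \<diamondop> A) (swp T A B)"
  using test_swp by (simp add: channel_def)

lemma channel_unit: "channel T A \<I> (unit_effect T A)"
  unfolding unit_effect_def using theI'[OF causality] .

lemma unit_unique: "channel T A \<I> e \<Longrightarrow> e = unit_effect T A"
  using causality channel_unit by blast

lemma unit_trafos: "unit_effect T A \<in> effects T A"
  using channel_unit channel_trafos by blast

lemma unit_channel: "channel T A B C \<Longrightarrow> unit_effect T B \<odot> C = unit_effect T A"
  using unit_unique channel_sq channel_unit by blast

lemma unit_par: "unit_effect T A \<otimes> unit_effect T B = unit_effect T (A \<diamondop> B)"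
proof -
  have "channel T (A \<diamondop> B) (\<I> \<diamondop> \<I>) (unit_effect T A \<otimes> unit_effect T B)"
    by (intro channel_par channel_unit)
  then show ?thesis using unit_unique by (simp add: cmpst_triv_left)
qed

lemma unit_triv: "unit_effect T \<I> = idt T \<I>"
  using unit_unique channel_idt by metis

lemma trafos_triv: "x \<in> trafos T \<I> \<I> \<longleftrightarrow> (\<exists>p. 0 \<le> p \<and> p \<le> 1 \<and> x = num T p)"
proof
  assume "x \<in> trafos T \<I> \<I>"
  then obtain cs where cs: "cs \<in> tests T \<I> \<I>" "x \<in> set cs" by (auto simp: trafos_def)
  then obtain ps where ps: "cs = map (num T) ps" "\<forall>p \<in> set ps. 0 \<le> p" "sum_list ps = 1"
    by (auto simp: tests_triv)
  then obtain p where "p \<in> set ps" "x = num T p" using cs by auto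
  moreover have "p \<le> 1"
  proof -
    obtain as bs where as: "ps = as @ p # bs" using \<open>p \<in> set ps\<close> by (meson split_list)
    have "0 \<le> sum_list as" "0 \<le> sum_list bs" using ps(2) as by (auto intro!: sum_list_nonneg)
    then show ?thesis using ps(3) as by simp
  qed
  ultimately show "\<exists>p. 0 \<le> p \<and> p \<le> 1 \<and> x = num T p" using ps by auto
next
  assume "\<exists>p. 0 \<le> p \<and> p \<le> 1 \<and> x = num T p"
  then obtain p where p: "0 \<le> p" "p \<le> 1" "x = num T p" by auto
  have "map (num T) [p, 1 - p] \<in> tests T \<I> \<I>" unfolding tests_triv using p by (intro CollectI exI[of _ "[p, 1 - p]"]) auto
  then show "x \<in> trafos T \<I> \<I>" using p by (intro test_trafos) auto
qed

lemma pairing: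
  assumes "x \<in> trafos T \<I> \<I>"
  shows "x = num T (val x)" "0 \<le> val x" "val x \<le> 1"
  using assms by (auto simp: trafos_triv val_simps)

section \<open>Splitting, padding and regrouping of tests\<close>

lemma num_test: "0 \<le> p \<Longrightarrow> p \<le> 1 \<Longrightarrow> [num T p, num T (1 - p)] \<in> tests T \<I> \<I>"
proof -
  assume "0 \<le> p" "p \<le> 1"
  then have "map (num T) [p, 1 - p] \<in> tests T \<I> \<I>" unfolding tests_triv by (intro CollectI exI[of _ "[p, 1 - p]"]) auto
  then show ?thesis by simp
qed

lemma par_num: "f \<in> trafos T A B \<Longrightarrow> f \<otimes> num T p = p *\<^sub>R f"
  by (simp add: num_def bilin par_triv_right)

text \<open>The test runs beside a biased coin, whose numbers act as scalars.\<close>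

lemma test_split:
  assumes "cs \<in> tests T A B" "0 \<le> p" "p \<le> 1"
  shows "concat (map (\<lambda>c. [p *\<^sub>R c, (1 - p) *\<^sub>R c]) cs) \<in> tests T A B"
proof -
  have "concat (map (\<lambda>c. map (\<lambda>d. c \<otimes> d) [num T p, num T (1-p)]) cs) \<in> tests T (A \<diamondop> \<I>) (B \<diamondop> \<I>)"
    by (intro test_par num_test assms)
  moreover have "map (\<lambda>c. map (\<lambda>d. c \<otimes> d) [num T p, num T (1-p)]) cs = map (\<lambda>c. [p *\<^sub>R c, (1 - p) *\<^sub>R c]) cs"
    using assms by (auto simp: par_num[OF test_trafos[OF assms(1)]])
  ultimately show ?thesis by (simp only: cmpst_triv_right)
qed

lemma trafos_scale: "f \<in> trafos T A B \<Longrightarrow> 0 \<le> p \<Longrightarrow> p \<le> 1 \<Longrightarrow> p *\<^sub>R f \<in> trafos T A B"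
proof -
  assume a: "f \<in> trafos T A B" "0 \<le> p" "p \<le> 1"
  then obtain cs where cs: "cs \<in> tests T A B" "f \<in> set cs" unfolding trafos_def by blast
  show ?thesis by (rule test_trafos[OF test_split[OF cs(1) a(2,3)]]) (use cs(2) in auto)
qed

text \<open>A coin of bias one, tossed after the last outcome only, contributes an impossible
  outcome.\<close>

lemma test_append_zero:
  assumes "cs \<in> tests T A B"
  shows "cs @ [0] \<in> tests T A B"
proof -
  obtain bs c where cs: "cs = bs @ [c]" using test_nonempty assms by (cases cs rule: rev_cases) auto
  have 1: "[idt T B, 0] \<in> tests T B B" using test_split[OF test_idt[of B], of 1] by simp
  let ?dss = "replicate (length bs) [idt T B] @ [[idt T B, 0]]"
  have "concat (map2 (\<lambda>c ds. map (\<lambda>d. d \<odot> c) ds) cs ?dss) \<in> tests T A B"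
    using 1 test_idt by (intro test_sq[OF assms]) (auto simp: cs)
  moreover have "map2 (\<lambda>c ds. map (\<lambda>d. d \<odot> c) ds) cs ?dss = map (\<lambda>c. [c]) bs @ [[c, 0]]"
    using sq_idt_left[OF test_trafos[OF assms]] by (auto simp: cs zip_replicate2 bilin)
  ultimately show ?thesis by (simp add: cs)
qed

lemma test_append_zeros: "cs \<in> tests T A B \<Longrightarrow> cs @ replicate m 0 \<in> tests T A B"
proof (induction m)
  case (Suc m)
  then show ?case using test_append_zero[of "cs @ replicate m 0"] by (simp add: replicate_append_same)
qed simp

text \<open>The coarse-graining axiom wants every block inhabited. Appending \<open>m\<close> zero
  outcomes, one for each block, makes any assignment surjective without changing a sum.\<close>

lemma test_regroup:
  assumes "cs \<in> tests T A B" "\<And>i. i < length cs \<Longrightarrow> h i < m"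
  shows "map (\<lambda>k. \<Sum>i | i < length cs \<and> h i = k. cs ! i) [0..<m] \<in> tests T A B"
proof -
  let ?n = "length cs"
  let ?cs = "cs @ replicate m 0"
  let ?h = "\<lambda>i. if i < ?n then h i else i - ?n"
  have "?h ` {..<length ?cs} = {..<m}"
  proof
    show "{..<m} \<subseteq> ?h ` {..<length ?cs}"
    proof
      fix k assume "k \<in> {..<m}"
      then show "k \<in> ?h ` {..<length ?cs}" by (intro image_eqI[of _ _ "?n + k"]) auto
    qed
  qed (use assms(2) in auto)
  from test_coarse_grain[OF test_append_zeros[OF assms(1)] this]
  have "map (\<lambda>k. \<Sum>i | i < length ?cs \<and> ?h i = k. ?cs ! i) [0..<m] \<in> tests T A B" .
  moreover have "(\<Sum>i | i < length ?cs \<and> ?h i = k. ?cs ! i) = (\<Sum>i | i < length cs \<and> h i = k. cs ! i)" for k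
    by (rule sum.mono_neutral_cong_right) (auto simp: nth_append)
  ultimately show ?thesis by simp
qed

lemma test_part:
  assumes "cs \<in> tests T A B" "X \<subseteq> {..<length cs}"
  shows "[\<Sum>i\<in>X. cs ! i, \<Sum>i\<in>{..<length cs} - X. cs ! i] \<in> tests T A B"
proof -
  have "map (\<lambda>k. \<Sum>i | i < length cs \<and> (if i \<in> X then 0 else 1) = k. cs ! i) [0..<2] \<in> tests T A B"
    by (rule test_regroup[OF assms(1)]) auto
  moreover have "{i. i < length cs \<and> (if i \<in> X then 0 else 1) = (0::nat)} = X"
    "{i. i < length cs \<and> (if i \<in> X then 0 else 1) = Suc 0} = {..<length cs} - X"
    using assms(2) by (auto split: if_splits)
  ultimately show ?thesis by (simp add: numeral_2_eq_2)
qed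

lemma test_total: "cs \<in> tests T A B \<Longrightarrow> channel T A B (\<Sum>i<length cs. cs ! i)"
proof -
  assume "cs \<in> tests T A B"
  then have "map (\<lambda>k. \<Sum>i | i < length cs \<and> 0 = k. cs ! i) [0..<1] \<in> tests T A B"
    by (intro test_regroup) auto
  then show ?thesis by (simp add: channel_def lessThan_def)
qed

lemma trafos_complement:
  assumes "f \<in> trafos T A B"
  obtains g where "[f, g] \<in> tests T A B" "g \<in> trafos T A B" "channel T A B (f + g)"
proof -
  obtain cs i where cs: "cs \<in> tests T A B" "i < length cs" "f = cs ! i"
    using assms by (auto simp: trafos_def in_set_conv_nth)
  from test_part[OF cs(1), of "{i}"] cs
  have t: "[f, \<Sum>i\<in>{..<length cs} - {i}. cs ! i] \<in> tests T A B" (is "[f, ?g] \<in> _") by simp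
  show ?thesis
  proof (rule that[OF t])
    show "?g \<in> trafos T A B" using t by (rule test_trafos) simp
    show "channel T A B (f + ?g)" using test_total[OF t] by (simp add: lessThan_Suc add.commute)
  qed
qed

text \<open>By causality the two outcomes sum to the only deterministic effect, which determines the
  second one.\<close>

lemma effect_complement: "a \<in> effects T A \<Longrightarrow> [a, unit_effect T A - a] \<in> tests T A \<I>"
proof -
  assume "a \<in> effects T A"
  then obtain g where g: "[a, g] \<in> tests T A \<I>" "channel T A \<I> (a + g)" by (rule trafos_complement)
  from unit_unique[OF g(2)] have "g = unit_effect T A - a" by (simp add: algebra_simps)
  then show ?thesis using g by simp
qed

lemma effect_complement_trafos: "a \<in> effects T A \<Longrightarrow> unit_effect T A - a \<in> effects T A"
  using effect_complement test_trafos[of "[a, unit_effect T A - a]"] by simp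

section \<open>Probabilities, weights and normalised states\<close>

lemma val_bounds: "a \<in> effects T A \<Longrightarrow> \<rho> \<in> states T A \<Longrightarrow> 0 \<le> val (a \<odot> \<rho>) \<and> val (a \<odot> \<rho>) \<le> 1"
  using pairing sq_trafos by blast

lemma val_num: "a \<in> effects T A \<Longrightarrow> \<rho> \<in> states T A \<Longrightarrow> a \<odot> \<rho> = val (a \<odot> \<rho>) *\<^sub>R idt T \<I>"
  using pairing(1)[OF sq_trafos] unfolding num_def by metis

lemma val_eq_num: "a \<in> effects T A \<Longrightarrow> \<rho> \<in> states T A \<Longrightarrow> a \<odot> \<rho> = num T p \<longleftrightarrow> val (a \<odot> \<rho>) = p"
  using pairing(1)[OF sq_trafos] val_simps(6) by metis

text \<open>The probability of preparing \<open>\<rho>\<close>. Being linear on the whole space, it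
  also applies to differences of states, where it may be negative.\<close>

definition wt :: "'s \<Rightarrow> 't \<Rightarrow> real" where
  "wt A \<rho> = val (unit_effect T A \<odot> \<rho>)"

lemma wt_simps: "wt A (x + y) = wt A x + wt A y" "wt A (x - y) = wt A x - wt A y"
  "wt A (c *\<^sub>R x) = c * wt A x" "wt A 0 = 0"
  by (auto simp: wt_def bilin val_simps)

lemma wt_sum: "wt A (sum f X) = (\<Sum>x\<in>X. wt A (f x))"
  by (simp add: wt_def bilin_sum val_sum)

lemma wt_bounds: "\<rho> \<in> states T A \<Longrightarrow> 0 \<le> wt A \<rho> \<and> wt A \<rho> \<le> 1"
  unfolding wt_def using val_bounds unit_trafos by blast

lemma normalised_iff: "normalised T A \<rho> \<longleftrightarrow> \<rho> \<in> states T A \<and> wt A \<rho> = 1"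
  unfolding normalised_def wt_def using val_eq_num unit_trafos by blast

lemma effect_le_wt:
  assumes "a \<in> effects T A" "\<rho> \<in> states T A"
  shows "val (a \<odot> \<rho>) \<le> wt A \<rho>"
proof -
  have "0 \<le> val ((unit_effect T A - a) \<odot> \<rho>)"
    using val_bounds effect_complement_trafos assms by blast
  then show ?thesis by (simp add: bilin val_simps wt_def)
qed

lemma state_normalise:
  assumes "\<rho> \<in> states T A" "\<rho> \<noteq> 0"
  obtains \<sigma> where "normalised T A \<sigma>" "\<rho> = wt A \<rho> *\<^sub>R \<sigma>" "0 < wt A \<rho>"
proof -
  obtain p \<sigma> where \<sigma>: "normalised T A \<sigma>" "\<rho> = p *\<^sub>R \<sigma>" using normalisable assms by blast
  then have "wt A \<rho> = p" by (simp add: wt_simps normalised_iff)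
  moreover have "p \<noteq> 0" using \<sigma> assms by auto
  ultimately show ?thesis using that[of \<sigma>] \<sigma> wt_bounds[OF assms(1)] by force
qed

lemma state_zero: "\<rho> \<in> states T A \<Longrightarrow> wt A \<rho> = 0 \<Longrightarrow> \<rho> = 0"
  using state_normalise by (metis less_irrefl)

lemma channel_wt: "channel T A B C \<Longrightarrow> \<rho> \<in> states T A \<Longrightarrow> wt B (C \<odot> \<rho>) = wt A \<rho>"
  unfolding wt_def using sq_assoc[OF _ channel_trafos unit_trafos] unit_channel by metis

lemma channel_normalised: "channel T A B C \<Longrightarrow> normalised T A \<rho> \<Longrightarrow> normalised T B (C \<odot> \<rho>)"
  unfolding normalised_iff using channel_wt sq_trafos channel_trafos by metis

text \<open>Next to any ancilla the output has weight zero, and a state of weight zero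
  vanishes.\<close>

lemma unit_zero:
  assumes "f \<in> trafos T A B" "unit_effect T B \<odot> f = 0"
  shows "f = 0"
proof (rule trans_eqI)
  show "f \<in> span (trafos T A B)" using assms by (simp add: span_base)
  show "0 \<in> span (trafos T A B)" by (rule span_zero)
  fix S \<rho> assume \<rho>: "\<rho> \<in> states T (A \<diamondop> S)"
  have m: "f \<otimes> idt T S \<in> trafos T (A \<diamondop> S) (B \<diamondop> S)" by (intro par_trafos assms idt_trafos)
  have "unit_effect T (B \<diamondop> S) \<odot> ((f \<otimes> idt T S) \<odot> \<rho>) = (unit_effect T (B \<diamondop> S) \<odot> (f \<otimes> idt T S)) \<odot> \<rho>"
    by (rule sq_assoc[symmetric, OF \<rho> m unit_trafos])
  also have "unit_effect T (B \<diamondop> S) \<odot> (f \<otimes> idt T S) = (unit_effect T B \<odot> f) \<otimes> (unit_effect T S \<odot> idt T S)"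
    unfolding unit_par[symmetric] by (rule interchange[OF assms(1) unit_trafos idt_trafos unit_trafos])
  finally have "wt (B \<diamondop> S) ((f \<otimes> idt T S) \<odot> \<rho>) = 0" by (simp add: assms bilin wt_def val_simps)
  then have "(f \<otimes> idt T S) \<odot> \<rho> = 0" using state_zero sq_trafos[OF \<rho> m] by blast
  then show "(f \<otimes> idt T S) \<odot> \<rho> = (0 \<otimes> idt T S) \<odot> \<rho>" by (simp add: bilin)
qed

text \<open>A complement of \<open>C\<close> in a test is discarded to the zero effect, hence is
  zero by \<open>unit_zero\<close>. Determinism thereby becomes an equation, which survives
  limits.\<close>

lemma channel_iff: "channel T A B C \<longleftrightarrow> C \<in> trafos T A B \<and> unit_effect T B \<odot> C = unit_effect T A"
proof
  assume r: "C \<in> trafos T A B \<and> unit_effect T B \<odot> C = unit_effect T A"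
  then obtain g where g: "g \<in> trafos T A B" "channel T A B (C + g)" using trafos_complement by blast
  have "unit_effect T B \<odot> g = 0" using unit_channel[OF g(2)] r by (simp add: bilin)
  then show "channel T A B C" using unit_zero[OF g(1)] g by simp
qed (auto simp: channel_trafos unit_channel)

lemma normalised_channel: "normalised T A \<rho> \<longleftrightarrow> channel T \<I> A \<rho>"
  unfolding channel_iff unit_triv normalised_def by (simp add: num_def)

lemma normalised_states: "normalised T A \<rho> \<Longrightarrow> \<rho> \<in> states T A"
  by (simp add: normalised_def)

text \<open>Randomised preparation: a number is drawn and the state that it selects is prepared.
  This is where the conditional form of \<open>test_sq\<close> matters.\<close>

lemma weighted_test:
  assumes "length ps = length \<sigma>s" "\<And>p. p \<in> set ps \<Longrightarrow> 0 \<le> p" "sum_list ps = 1"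
    "\<And>\<sigma>. \<sigma> \<in> set \<sigma>s \<Longrightarrow> normalised T A \<sigma>"
  shows "map2 (\<lambda>p \<sigma>. p *\<^sub>R \<sigma>) ps \<sigma>s \<in> tests T \<I> A"
proof -
  have "concat (map2 (\<lambda>c ds. map (\<lambda>d. d \<odot> c) ds) (map (num T) ps) (map (\<lambda>\<sigma>. [\<sigma>]) \<sigma>s)) \<in> tests T \<I> A"
    using assms by (intro test_sq[of _ _ \<I>]) (auto simp: tests_triv normalised_channel channel_def)
  moreover have "concat (map2 (\<lambda>c ds. map (\<lambda>d. d \<odot> c) ds) (map (num T) ps) (map (\<lambda>\<sigma>. [\<sigma>]) \<sigma>s)) =
     map2 (\<lambda>p \<sigma>. p *\<^sub>R \<sigma>) ps \<sigma>s"
    using assms(1,4)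
    by (induction ps \<sigma>s rule: list_induct2) (auto simp: num_def bilin sq_idt_right[OF normalised_states[of A]])
  ultimately show ?thesis by simp
qed

lemma convex2:
  assumes "normalised T A \<rho>" "normalised T A \<sigma>" "0 \<le> p" "p \<le> 1"
  shows "[p *\<^sub>R \<rho>, (1 - p) *\<^sub>R \<sigma>] \<in> tests T \<I> A" "normalised T A (p *\<^sub>R \<rho> + (1 - p) *\<^sub>R \<sigma>)"
proof -
  show 1: "[p *\<^sub>R \<rho>, (1 - p) *\<^sub>R \<sigma>] \<in> tests T \<I> A"
    using weighted_test[of "[p, 1 - p]" "[\<rho>, \<sigma>]" A] assms by fastforce
  show "normalised T A (p *\<^sub>R \<rho> + (1 - p) *\<^sub>R \<sigma>)"
    using test_total[OF 1] by (simp add: normalised_channel lessThan_Suc add.commute)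
qed

lemma convex_normalised:
  assumes "finite X" "\<And>x. x \<in> X \<Longrightarrow> 0 \<le> p x" "sum p X = 1" "\<And>x. x \<in> X \<Longrightarrow> normalised T A (\<sigma> x)"
  shows "normalised T A (\<Sum>x\<in>X. p x *\<^sub>R \<sigma> x)"
proof -
  obtain xs where xs: "set xs = X" "distinct xs" using finite_distinct_list[OF assms(1)] by blast
  have "map2 (\<lambda>p \<sigma>. p *\<^sub>R \<sigma>) (map p xs) (map \<sigma> xs) \<in> tests T \<I> A"
    using assms xs by (intro weighted_test) (auto simp: sum_list_distinct_conv_sum_set)
  moreover have "map2 (\<lambda>p \<sigma>. p *\<^sub>R \<sigma>) (map p xs) (map \<sigma> xs) = map (\<lambda>x. p x *\<^sub>R \<sigma> x) xs"
    by (induction xs) auto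
  ultimately have "channel T \<I> A (\<Sum>i<length xs. map (\<lambda>x. p x *\<^sub>R \<sigma> x) xs ! i)"
    using test_total[of "map (\<lambda>x. p x *\<^sub>R \<sigma> x) xs"] by simp
  also have "(\<Sum>i<length xs. map (\<lambda>x. p x *\<^sub>R \<sigma> x) xs ! i) = sum_list (map (\<lambda>x. p x *\<^sub>R \<sigma> x) xs)"
    by (simp add: sum_list_sum_nth atLeast0LessThan)
  also have "\<dots> = (\<Sum>x\<in>X. p x *\<^sub>R \<sigma> x)" using xs by (simp add: sum_list_distinct_conv_sum_set)
  finally show ?thesis by (simp add: normalised_channel)
qed

text \<open>With trivial systems the hexagon makes the swap idempotent; being invertible, it is the
  identity.\<close>

lemma swp_triv: "swp T A \<I> = idt T A"
proof -
  have m: "swp T A \<I> \<in> trafos T A A" "swp T \<I> A \<in> trafos T A A"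
    using swp_trafos[of A \<I>] swp_trafos[of \<I> A] by (simp_all add: cmpst_triv_left cmpst_triv_right)
  have "swp T A \<I> = swp T A \<I> \<odot> swp T A \<I>"
    using swp_hexagon[of A \<I> \<I>] m by (simp add: cmpst_triv_left par_triv_left par_triv_right)
  then have "swp T \<I> A \<odot> swp T A \<I> = swp T \<I> A \<odot> (swp T A \<I> \<odot> swp T A \<I>)" by simp
  also have "\<dots> = (swp T \<I> A \<odot> swp T A \<I>) \<odot> swp T A \<I>" by (rule sq_assoc[symmetric, OF m(1) m(1) m(2)])
  finally show ?thesis using m by (simp add: swp_swp cmpst_triv_right sq_idt_left)
qed

end

subsection \<open>Faces and pure states\<close>

context causal_opt
begin

lemma par_act:
  assumes "x \<in> trafos T X (A \<diamondop> A')" "g \<in> trafos T A B" "g' \<in> trafos T A' B'"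
    "f \<in> trafos T B C" "f' \<in> trafos T B' C'"
  shows "(f \<otimes> f') \<odot> ((g \<otimes> g') \<odot> x) = ((f \<odot> g) \<otimes> (f' \<odot> g')) \<odot> x"
  using sq_assoc[OF assms(1) par_trafos[OF assms(2,3)] par_trafos[OF assms(4,5)]]
    interchange[OF assms(2,4,3,5)] by simp

lemma par_act_comm:
  assumes "x \<in> trafos T X (A \<diamondop> A')" "f \<in> trafos T A B" "g \<in> trafos T A' B'"
  shows "(f \<otimes> idt T B') \<odot> ((idt T A \<otimes> g) \<odot> x) = (f \<otimes> g) \<odot> x"
    "(idt T B \<otimes> g) \<odot> ((f \<otimes> idt T A') \<odot> x) = (f \<otimes> g) \<odot> x"
  using par_act[OF assms(1) idt_trafos assms(3) assms(2) idt_trafos]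
    par_act[OF assms(1,2) idt_trafos idt_trafos assms(3)] assms(2,3)
  by (simp_all add: sq_idt_left sq_idt_right)

text \<open>States have weight at most one; dropping that bound leaves a set closed under sums and
  nonnegative multiples.\<close>

definition cone :: "'s \<Rightarrow> 't set" where
  "cone A = {t *\<^sub>R \<sigma> | t \<sigma>. 0 \<le> t \<and> normalised T A \<sigma>}"

lemma coneI: "0 \<le> t \<Longrightarrow> normalised T A \<sigma> \<Longrightarrow> t *\<^sub>R \<sigma> \<in> cone A"
  by (auto simp: cone_def)

lemma cone_scale: "x \<in> cone A \<Longrightarrow> 0 \<le> t \<Longrightarrow> t *\<^sub>R x \<in> cone A"
  unfolding cone_def using zero_le_mult_iff by fastforce

lemma cone_add:
  assumes "x \<in> cone A" "y \<in> cone A"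
  shows "x + y \<in> cone A"
proof -
  obtain s \<sigma> t \<tau> where x: "x = s *\<^sub>R \<sigma>" "0 \<le> s" "normalised T A \<sigma>"
    and y: "y = t *\<^sub>R \<tau>" "0 \<le> t" "normalised T A \<tau>" using assms by (auto simp: cone_def)
  show ?thesis
  proof (cases "s + t = 0")
    case True
    then have "s = 0" "t = 0" using x y by auto
    then show ?thesis using x y assms by simp
  next
    case False
    then have st: "0 < s + t" using x y by simp
    let ?p = "s / (s + t)"
    have "normalised T A (?p *\<^sub>R \<sigma> + (1 - ?p) *\<^sub>R \<tau>)"
      using st x y by (intro convex2) auto
    moreover have "x + y = (s + t) *\<^sub>R (?p *\<^sub>R \<sigma> + (1 - ?p) *\<^sub>R \<tau>)"
      using st by (simp add: x y scaleR_right_distrib right_diff_distrib)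
    ultimately show ?thesis using st by (auto intro!: coneI)
  qed
qed

lemma cone_sum:
  assumes "normalised T A \<rho>" "\<And>x. x \<in> X \<Longrightarrow> f x \<in> cone A"
  shows "sum f X \<in> cone A"
proof -
  have 0: "0 \<in> cone A" using coneI[OF _ assms(1), of 0] by simp
  show ?thesis using assms(2) by (induction X rule: infinite_finite_induct) (auto simp: 0 cone_add)
qed

lemma state_cone: "normalised T A \<sigma> \<Longrightarrow> \<rho> \<in> states T A \<Longrightarrow> \<rho> \<in> cone A"
proof (cases "\<rho> = 0")
  case True
  assume "normalised T A \<sigma>"
  then show ?thesis using coneI[of 0 A \<sigma>] True by simp
next
  case False
  assume "\<rho> \<in> states T A"
  from state_normalise[OF this False] show ?thesis using coneI by (metis less_eq_real_def)
qed

lemma normalised_cone: "normalised T A \<sigma> \<Longrightarrow> \<sigma> \<in> cone A"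
  using coneI[of 1] by simp

lemma cone_normalised: "x \<in> cone A \<Longrightarrow> wt A x = 1 \<Longrightarrow> normalised T A x"
  by (auto simp: cone_def wt_simps normalised_iff)

text \<open>For normalised \<open>\<rho>\<close> these are the states that occur with positive
  probability in a convex decomposition of \<open>\<rho>\<close>, that is, the face generated by
  \<open>\<rho>\<close> in the convex set of normalised states.\<close>

definition face :: "'s \<Rightarrow> 't \<Rightarrow> 't set" where
  "face A \<rho> = {\<sigma>. normalised T A \<sigma> \<and> (\<exists>p>0. \<rho> - p *\<^sub>R \<sigma> \<in> cone A)}"

lemma face_normalised: "\<sigma> \<in> face A \<rho> \<Longrightarrow> normalised T A \<sigma>"
  by (simp add: face_def)

lemma face_refl: "normalised T A \<rho> \<Longrightarrow> \<rho> \<in> face A \<rho>"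
  unfolding face_def using coneI[of 0 A \<rho>] by (auto intro!: exI[of _ 1])

lemma face_decompose:
  assumes "normalised T A \<rho>" "\<sigma> \<in> face A \<rho>"
  obtains p \<tau> where "0 < p" "p \<le> 1" "normalised T A \<tau>" "\<rho> = p *\<^sub>R \<sigma> + (1 - p) *\<^sub>R \<tau>"
proof -
  obtain p t \<tau> where p: "0 < p" "\<rho> - p *\<^sub>R \<sigma> = t *\<^sub>R \<tau>" "0 \<le> t" "normalised T A \<tau>" "normalised T A \<sigma>"
    using assms by (auto simp: face_def cone_def)
  have "wt A (\<rho> - p *\<^sub>R \<sigma>) = wt A (t *\<^sub>R \<tau>)" using p by simp
  then have "t = 1 - p" using p(4,5) assms(1) unfolding wt_simps normalised_iff by simp
  moreover have "\<rho> = p *\<^sub>R \<sigma> + t *\<^sub>R \<tau>" using p(2) by (simp add: algebra_simps)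
  ultimately show ?thesis using that[of p \<tau>] p(1,3,4) by simp
qed

lemma faceI: "0 < p \<Longrightarrow> p \<le> 1 \<Longrightarrow> normalised T A \<sigma> \<Longrightarrow> normalised T A \<tau> \<Longrightarrow> \<sigma> \<in> face A (p *\<^sub>R \<sigma> + (1 - p) *\<^sub>R \<tau>)"
  by (auto simp: face_def intro!: exI[of _ p] coneI)

lemma face_trans:
  assumes "\<sigma> \<in> face A \<rho>" "\<tau> \<in> face A \<sigma>"
  shows "\<tau> \<in> face A \<rho>"
proof -
  obtain p q where p: "0 < p" "\<rho> - p *\<^sub>R \<sigma> \<in> cone A" and q: "0 < q" "\<sigma> - q *\<^sub>R \<tau> \<in> cone A" "normalised T A \<tau>"
    using assms by (auto simp: face_def)
  have "(\<rho> - p *\<^sub>R \<sigma>) + p *\<^sub>R (\<sigma> - q *\<^sub>R \<tau>) \<in> cone A"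
    using p q by (intro cone_add cone_scale) auto
  then have "\<rho> - (p * q) *\<^sub>R \<tau> \<in> cone A" by (simp add: algebra_simps)
  then show ?thesis using p q by (auto simp: face_def intro!: exI[of _ "p * q"])
qed

text \<open>Each vector of the face is dominated by a multiple of \<open>\<rho>\<close>, and
  finitely many such bounds combine. So \<open>\<rho>\<close> is an order unit of the span of its
  face, in the manner of an interior point.\<close>

lemma span_face_order_unit:
  assumes "normalised T A \<rho>" "x \<in> span (face A \<rho>)"
  shows "\<exists>e>0. \<rho> - e *\<^sub>R x \<in> cone A"
  using assms(2)
proof (induction rule: span_induct_alt)
  case base
  then show ?case using normalised_cone[OF assms(1)] by (auto intro!: exI[of _ 1])
next
  case (step c v y)
  then obtain e p where e: "0 < e" "\<rho> - e *\<^sub>R y \<in> cone A" and p: "0 < p" "\<rho> - p *\<^sub>R v \<in> cone A"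
    and v: "normalised T A v" by (auto simp: face_def)
  show ?case
  proof (cases "c \<le> 0")
    case True
    have "(\<rho> - e *\<^sub>R y) + (e * - c) *\<^sub>R v \<in> cone A"
      using True e v by (intro cone_add coneI) (auto intro: mult_nonneg_nonpos)
    also have "(\<rho> - e *\<^sub>R y) + (e * - c) *\<^sub>R v = \<rho> - e *\<^sub>R (c *\<^sub>R v + y)"
      by (simp add: algebra_simps)
    finally show ?thesis using e by blast
  next
    case False
    \<comment> \<open>Chosen so that the weights \<open>d / e\<close> and \<open>d * c / p\<close>
      sum to one and exactly one copy of \<open>\<rho>\<close> remains.\<close>
    define d where "d = 1 / (1 / e + c / p)"
    have pos: "0 < 1 / e + c / p" using False e p by (intro add_pos_pos) auto
    then have d: "0 < d" "d * (1 / e + c / p) = 1" by (auto simp: d_def)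
    have "(d / e) *\<^sub>R (\<rho> - e *\<^sub>R y) + (d * c / p) *\<^sub>R (\<rho> - p *\<^sub>R v) \<in> cone A"
      using False e p d by (intro cone_add cone_scale) auto
    also have "(d / e) *\<^sub>R (\<rho> - e *\<^sub>R y) + (d * c / p) *\<^sub>R (\<rho> - p *\<^sub>R v)
       = (d * (1 / e + c / p)) *\<^sub>R \<rho> - d *\<^sub>R (c *\<^sub>R v + y)"
      using e p by (simp add: algebra_simps)
    finally show ?thesis using d by auto
  qed
qed

section \<open>Criteria for purity\<close>

lemma pureI3:
  assumes "C \<in> trafos T A B" "\<And>D E F. [D, E, F] \<in> tests T A B \<Longrightarrow> C = D + E \<Longrightarrow> \<exists>c. D = c *\<^sub>R C"
  shows "pure T A B C"
  unfolding pure_def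
proof (intro conjI ballI allI impI)
  fix ds X i assume ds: "ds \<in> tests T A B" and X: "X \<subseteq> {..<length ds}" "C = (\<Sum>i\<in>X. ds ! i)" "i \<in> X"
  \<comment> \<open>Three classes are enough: the outcome in question, the rest of
    \<open>X\<^sub>0\<close>, and everything outside.\<close>
  let ?h = "\<lambda>k. if k = i then 0 else if k \<in> X then 1 else (2::nat)"
  have "map (\<lambda>k. \<Sum>j | j < length ds \<and> ?h j = k. ds ! j) [0..<3] \<in> tests T A B"
    by (rule test_regroup[OF ds]) auto
  moreover have "{j. j < length ds \<and> ?h j = 0} = {i}" "{j. j < length ds \<and> ?h j = Suc 0} = X - {i}"
    using X by (auto split: if_splits)
  ultimately have "[ds ! i, \<Sum>j\<in>X - {i}. ds ! j, \<Sum>j | j < length ds \<and> ?h j = 2. ds ! j] \<in> tests T A B"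
    by (simp add: numeral_3_eq_3 numeral_2_eq_2)
  moreover have "finite X" using X finite_subset by blast
  then have "C = ds ! i + (\<Sum>j\<in>X - {i}. ds ! j)" using X by (simp add: sum.remove)
  ultimately show "\<exists>c. ds ! i = c *\<^sub>R C" by (rule assms(2))
qed (rule assms(1))

lemma pureD3:
  assumes "pure T A B C" "[D, E, F] \<in> tests T A B" "C = D + E"
  shows "\<exists>c. D = c *\<^sub>R C"
proof -
  have "C = (\<Sum>i\<in>{0,1}. [D, E, F] ! i)" using assms(3) by simp
  moreover have "{0, 1} \<subseteq> {..<length [D, E, F]}" by auto
  ultimately have "\<forall>i\<in>{0,1}. \<exists>c. [D, E, F] ! i = c *\<^sub>R C"
    using assms(1,2) unfolding pure_def by blast
  then show ?thesis by simp
qed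

lemma pure_trafos: "pure T A B C \<Longrightarrow> C \<in> trafos T A B"
  by (simp add: pure_def)

text \<open>A coin of bias \<open>p\<close> turns a decomposition of \<open>C\<close> into one of
  \<open>p *\<^sub>R C\<close>, to which purity applies.\<close>

lemma pure_scaleD:
  assumes "pure T A B (p *\<^sub>R C)" "C \<in> trafos T A B" "0 < p" "p \<le> 1"
  shows "pure T A B C"
proof (rule pureI3[OF assms(2)])
  fix D E F assume t: "[D, E, F] \<in> tests T A B" and C: "C = D + E"
  have "[p *\<^sub>R D, (1 - p) *\<^sub>R D, p *\<^sub>R E, (1 - p) *\<^sub>R E, p *\<^sub>R F, (1 - p) *\<^sub>R F] \<in> tests T A B" (is "?l \<in> _")
    using test_split[OF t, of p] assms by simp
  \<comment> \<open>In the split list \<open>p *\<^sub>R D\<close> and \<open>p *\<^sub>R E\<close>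
    sit at positions 0 and 2; all other outcomes are merged.\<close>
  let ?h = "\<lambda>i::nat. if i = 0 then 0 else if i = 2 then 1 else (2::nat)"
  have "map (\<lambda>k. \<Sum>i | i < length ?l \<and> ?h i = k. ?l ! i) [0..<3] \<in> tests T A B"
    by (rule test_regroup) (use \<open>?l \<in> _\<close> in auto)
  moreover have "{i. i < length ?l \<and> ?h i = 0} = {0}" "{i. i < length ?l \<and> ?h i = Suc 0} = {2}"
    by (auto split: if_splits)
  then have "(\<Sum>i | i < length ?l \<and> ?h i = 0. ?l ! i) = p *\<^sub>R D"
    "(\<Sum>i | i < length ?l \<and> ?h i = Suc 0. ?l ! i) = p *\<^sub>R E" by (simp_all only:) simp_all
  ultimately have "\<exists>G. [p *\<^sub>R D, p *\<^sub>R E, G] \<in> tests T A B"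
    by (auto simp: numeral_3_eq_3 simp del: length_Cons)
  then obtain c where "p *\<^sub>R D = c *\<^sub>R (p *\<^sub>R C)" using pureD3[OF assms(1)] C by (metis scaleR_right_distrib)
  then have "p *\<^sub>R D = p *\<^sub>R (c *\<^sub>R C)" by (simp only: scaleR_left_commute)
  then have "D = c *\<^sub>R C" using assms(3) by (simp only: scaleR_cancel_left) auto
  then show "\<exists>c. D = c *\<^sub>R C" by blast
qed

text \<open>Outcomes of a preparation test normalise to members of the face, and members of the face
  reappear as outcomes of a randomised preparation. Purity against tests thus becomes
  extremality.\<close>

lemma pure_state_iff:
  assumes "normalised T A \<rho>"
  shows "pure T \<I> A \<rho> \<longleftrightarrow> face A \<rho> = {\<rho>}"
proof
  assume p: "pure T \<I> A \<rho>"
  have "\<sigma> = \<rho>" if \<sigma>: "\<sigma> \<in> face A \<rho>" for \<sigma>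
  proof -
    obtain p \<tau> where \<tau>: "0 < p" "p \<le> 1" "normalised T A \<tau>" "\<rho> = p *\<^sub>R \<sigma> + (1 - p) *\<^sub>R \<tau>"
      using face_decompose[OF assms \<sigma>] .
    have "[p *\<^sub>R \<sigma>, (1 - p) *\<^sub>R \<tau>] @ [0] \<in> tests T \<I> A"
      using \<tau> face_normalised[OF \<sigma>] by (intro test_append_zero convex2) auto
    then obtain c where c: "p *\<^sub>R \<sigma> = c *\<^sub>R \<rho>" using pureD3[OF p] \<tau>(4) by fastforce
    then have "p = c"
      using arg_cong[OF c, of "wt A"] face_normalised[OF \<sigma>] assms unfolding wt_simps normalised_iff by simp
    then show ?thesis using c \<tau> by simp
  qed
  then show "face A \<rho> = {\<rho>}" using face_refl[OF assms] by blast
next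
  assume f: "face A \<rho> = {\<rho>}"
  show "pure T \<I> A \<rho>"
  proof (rule pureI3[OF normalised_states[OF assms]])
    fix D E F assume t: "[D, E, F] \<in> tests T \<I> A" and \<rho>: "\<rho> = D + E"
    have D: "D \<in> states T A" and E: "E \<in> states T A" using test_trafos[OF t] by auto
    show "\<exists>c. D = c *\<^sub>R \<rho>"
    proof (cases "D = 0")
      case True
      then show ?thesis by (auto intro: exI[of _ 0])
    next
      case False
      then obtain \<sigma> where \<sigma>: "normalised T A \<sigma>" "D = wt A D *\<^sub>R \<sigma>" "0 < wt A D"
        using state_normalise[OF D] by blast
      have "\<rho> - wt A D *\<^sub>R \<sigma> = E" using \<rho> \<sigma>(2) by (metis add_diff_cancel_left')
      then have "\<sigma> \<in> face A \<rho>" using \<sigma> state_cone[OF assms E] by (auto simp: face_def)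
      then show ?thesis using f \<sigma> by auto
    qed
  qed
qed

lemma effect_separates:
  assumes "normalised T A \<rho>" "normalised T A \<sigma>" "\<rho> \<noteq> \<sigma>"
  obtains a where "a \<in> effects T A" "val (a \<odot> \<rho>) \<noteq> val (a \<odot> \<sigma>)"
proof (rule ccontr)
  note sep = that
  assume n: "\<not> thesis"
  have "a \<odot> \<rho> = a \<odot> \<sigma>" if a: "a \<in> effects T A" for a
  proof -
    have "val (a \<odot> \<rho>) = val (a \<odot> \<sigma>)" using n sep a by blast
    then show ?thesis
      using val_num[OF a normalised_states[OF assms(1)]] val_num[OF a normalised_states[OF assms(2)]] by simp
  qed
  then have "\<rho> = \<sigma>" by (intro states_eqI[of \<rho> A]) (auto simp: assms normalised_states span_base)
  then show False using assms by simp
qed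

text \<open>Starting at \<open>\<rho>\<close>, move straight away from \<open>\<sigma>\<close> up to
  the last state \<open>\<tau>\<close> on the line. If \<open>\<sigma>\<close> were in the span of
  the face of \<open>\<tau>\<close>, the order-unit property would allow a further step.\<close>

lemma face_shrink:
  assumes \<rho>: "normalised T A \<rho>" and \<sigma>: "\<sigma> \<in> face A \<rho>" and ne: "\<sigma> \<noteq> \<rho>"
  obtains \<tau> where "\<tau> \<in> face A \<rho>" "\<sigma> \<notin> span (face A \<tau>)"
proof -
  note \<sigma>n = face_normalised[OF \<sigma>]
  let ?l = "\<lambda>t. \<rho> + t *\<^sub>R (\<rho> - \<sigma>)"
  define M where "M = {t. 0 \<le> t \<and> ?l t \<in> states T A}"
  have "0 \<in> M" using \<rho> by (simp add: M_def normalised_states)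
  \<comment> \<open>Along the line the probability of \<open>a\<close> is affine and not constant,
    yet stays between 0 and 1; this bounds the parameter.\<close>
  obtain a where a: "a \<in> effects T A" "val (a \<odot> \<rho>) \<noteq> val (a \<odot> \<sigma>)"
    using effect_separates[OF \<rho> \<sigma>n] ne by metis
  let ?d = "val (a \<odot> \<rho>) - val (a \<odot> \<sigma>)"
  have bd: "t \<le> 1 / \<bar>?d\<bar>" if t: "t \<in> M" for t
  proof -
    have "0 \<le> val (a \<odot> ?l t) \<and> val (a \<odot> ?l t) \<le> 1" using t a val_bounds by (simp add: M_def)
    moreover have "val (a \<odot> ?l t) = val (a \<odot> \<rho>) + t * ?d" by (simp add: bilin val_simps algebra_simps)
    moreover have "0 \<le> val (a \<odot> \<rho>) \<and> val (a \<odot> \<rho>) \<le> 1" using a val_bounds \<rho> normalised_states by blast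
    ultimately have "\<bar>t * ?d\<bar> \<le> 1" by linarith
    then have "t * \<bar>?d\<bar> \<le> 1" using t by (simp only: M_def mem_Collect_eq abs_mult abs_of_nonneg)
    moreover have "0 < \<bar>?d\<bar>" using a(2) by simp
    ultimately show ?thesis by (simp only: pos_le_divide_eq)
  qed
  have "closed M"
  proof -
    have "M = {0..} \<inter> ?l -` states T A" by (auto simp: M_def)
    moreover have "closed (?l -` states T A)"
      by (intro closed_vimage closed_trans continuous_intros)
    ultimately show ?thesis by auto
  qed
  have bdd: "bdd_above M" using bd by (intro bdd_aboveI) auto
  define t where "t = Sup M"
  have t: "t \<in> M" unfolding t_def using closed_contains_Sup[OF _ bdd \<open>closed M\<close>] \<open>0 \<in> M\<close> by blast
  have tmax: "s \<le> t" if "s \<in> M" for s unfolding t_def using cSup_upper[OF that bdd] .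
  have nl: "normalised T A (?l s)" if "s \<in> M" for s
    using that \<rho> \<sigma>n by (simp add: M_def normalised_iff wt_simps)
  let ?\<tau> = "?l t"
  have t0: "0 \<le> t" using t by (simp add: M_def)
  have "\<rho> = (1 / (1 + t)) *\<^sub>R ?\<tau> + (1 - 1 / (1 + t)) *\<^sub>R \<sigma>"
  proof -
    have "(1 + t) *\<^sub>R \<rho> = ?\<tau> + t *\<^sub>R \<sigma>" by (simp add: algebra_simps)
    then have "(1 / (1 + t)) *\<^sub>R ((1 + t) *\<^sub>R \<rho>) = (1 / (1 + t)) *\<^sub>R (?\<tau> + t *\<^sub>R \<sigma>)" by simp
    moreover have "1 - 1 / (1 + t) = (1 / (1 + t)) * t" using t0 by (simp add: field_simps)
    ultimately show ?thesis using t0 by (simp add: scaleR_right_distrib)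
  qed
  then have "?\<tau> \<in> face A \<rho>" using faceI[of "1 / (1 + t)" A ?\<tau> \<sigma>] nl[OF t] \<sigma>n t0 by simp
  moreover have "\<sigma> \<notin> span (face A ?\<tau>)"
  proof
    assume "\<sigma> \<in> span (face A ?\<tau>)"
    then obtain e where e: "0 < e" "?\<tau> - e *\<^sub>R \<sigma> \<in> cone A" using span_face_order_unit[OF nl[OF t]] by blast
    \<comment> \<open>Capped at 1/2 so that \<open>\<tau> - d *\<^sub>R \<sigma>\<close> keeps the
      positive weight \<open>1 - d\<close> and can be normalised.\<close>
    define d where "d = min e (1 / 2)"
    have d: "0 < d" "d < 1" "d \<le> e" using e by (auto simp: d_def)
    have "(?\<tau> - e *\<^sub>R \<sigma>) + (e - d) *\<^sub>R \<sigma> \<in> cone A" using e d \<sigma>n by (intro cone_add coneI) auto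
    then have "?\<tau> - d *\<^sub>R \<sigma> \<in> cone A" by (simp add: algebra_simps)
    then have "(1 / (1 - d)) *\<^sub>R (?\<tau> - d *\<^sub>R \<sigma>) \<in> cone A" using d by (intro cone_scale) auto
    moreover have "wt A ((1 / (1 - d)) *\<^sub>R (?\<tau> - d *\<^sub>R \<sigma>)) = 1"
      using nl[OF t] \<sigma>n d by (simp add: normalised_iff wt_simps)
    ultimately have n: "normalised T A ((1 / (1 - d)) *\<^sub>R (?\<tau> - d *\<^sub>R \<sigma>))" by (rule cone_normalised)
    \<comment> \<open>The position on the line of the normalised
      \<open>\<tau> - d *\<^sub>R \<sigma>\<close>; it lies beyond \<open>t\<close>.\<close>
    let ?s = "t + d / (1 - d) * (1 + t)"
    have "(1 - d) *\<^sub>R ?l ?s = ?\<tau> - d *\<^sub>R \<sigma>"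
    proof -
      have "(1 - d) * ?s = (1 - d) * t + ((1 - d) * (d / (1 - d))) * (1 + t)"
        by (simp only: distrib_left mult.assoc)
      moreover have "(1 - d) * (d / (1 - d)) = d" using d by simp
      ultimately have "(1 - d) * ?s = (1 - d) * t + d * (1 + t)" by simp
      moreover have "(1 - d) * t + d * (1 + t) = t + d" by (simp add: algebra_simps)
      ultimately have "(1 - d) * ?s = t + d" by (rule trans)
      from this have "(1 - d) *\<^sub>R ?l ?s = (1 - d) *\<^sub>R \<rho> + (t + d) *\<^sub>R (\<rho> - \<sigma>)"
        by (simp only: scaleR_right_distrib scaleR_scaleR)
      then show ?thesis by (simp add: algebra_simps)
    qed
    then have "(1 / (1 - d)) *\<^sub>R (?\<tau> - d *\<^sub>R \<sigma>) = (1 / (1 - d)) *\<^sub>R (1 - d) *\<^sub>R ?l ?s" by simp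
    then have "(1 / (1 - d)) *\<^sub>R (?\<tau> - d *\<^sub>R \<sigma>) = ?l ?s" using d by simp
    then have "?s \<in> M" using n d t0 by (auto simp: M_def normalised_states)
    then have "?s \<le> t" by (rule tmax)
    moreover have "0 < d / (1 - d) * (1 + t)" using d t0 by (intro mult_pos_pos) auto
    ultimately show False by simp
  qed
  ultimately show ?thesis by (rule that)
qed

section \<open>Pure components and interior states\<close>

lemma independent_states_bound:
  obtains N where "\<And>B. independent B \<Longrightarrow> B \<subseteq> states T A \<Longrightarrow> finite B \<and> card B \<le> N"
proof -
  obtain S where "finite S" "states T A \<subseteq> span S" using finite_dim by blast
  then show ?thesis using that[of "card S"] independent_span_bound[of S] by (meson subset_trans)
qed

text \<open>A state in the given face whose own face has the fewest independent elements is pure.\<close>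

lemma pure_component:
  assumes "normalised T A \<rho>"
  obtains \<alpha> where "\<alpha> \<in> face A \<rho>" "pure T \<I> A \<alpha>"
proof -
  obtain N where N: "\<And>B. independent B \<Longrightarrow> B \<subseteq> states T A \<Longrightarrow> finite B \<and> card B \<le> N"
    using independent_states_bound[of A] by blast
  \<comment> \<open>The maximum of \<open>C \<sigma>\<close> is the dimension of the span of the
    face of \<open>\<sigma>\<close>.\<close>
  define C where "C \<sigma> = {card B | B. independent B \<and> B \<subseteq> face A \<sigma>}" for \<sigma>
  have fs: "face A \<sigma> \<subseteq> states T A" for \<sigma> using face_normalised normalised_states by blast
  have "C \<sigma> \<subseteq> {..N}" for \<sigma>
    unfolding C_def using N fs by fastforce
  then have fin: "finite (C \<sigma>)" for \<sigma> using finite_subset by blast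
  have ne: "C \<sigma> \<noteq> {}" for \<sigma> unfolding C_def using independent_empty by blast
  obtain \<alpha> where \<alpha>: "\<alpha> \<in> face A \<rho>" and min: "\<And>\<tau>. \<tau> \<in> face A \<rho> \<Longrightarrow> Max (C \<alpha>) \<le> Max (C \<tau>)"
    using ex_has_least_nat[of "\<lambda>\<sigma>. \<sigma> \<in> face A \<rho>" \<rho> "\<lambda>\<sigma>. Max (C \<sigma>)"] face_refl[OF assms] by blast
  have "pure T \<I> A \<alpha>"
  proof (rule ccontr)
    assume "\<not> pure T \<I> A \<alpha>"
    then obtain \<sigma> where \<sigma>: "\<sigma> \<in> face A \<alpha>" "\<sigma> \<noteq> \<alpha>"
      using pure_state_iff[OF face_normalised[OF \<alpha>]] face_refl[OF face_normalised[OF \<alpha>]] by blast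
    obtain \<tau> where \<tau>: "\<tau> \<in> face A \<alpha>" "\<sigma> \<notin> span (face A \<tau>)"
      using face_shrink[OF face_normalised[OF \<alpha>] \<sigma>] .
    obtain B where B: "independent B" "B \<subseteq> face A \<tau>" "card B = Max (C \<tau>)"
      using Max_in[OF fin ne, of \<tau>] by (auto simp: C_def)
    \<comment> \<open>Being outside the span of the face of \<open>\<tau>\<close>, the state
      \<open>\<sigma>\<close> enlarges a largest independent set of that face, although
      \<open>\<alpha>\<close> was chosen with the smallest maximum.\<close>
    have "\<sigma> \<notin> span B" using \<tau> span_mono[OF B(2)] by blast
    then have "independent (insert \<sigma> B)" "\<sigma> \<notin> B" using B span_base by (auto simp: independent_insert)
    moreover have "insert \<sigma> B \<subseteq> face A \<alpha>" using \<sigma> B \<tau> face_trans by blast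
    ultimately have "card (insert \<sigma> B) \<in> C \<alpha>" unfolding C_def by blast
    then have "card (insert \<sigma> B) \<le> Max (C \<alpha>)" using fin by simp
    moreover have "card (insert \<sigma> B) = Suc (card B)"
      using N[OF B(1)] B(2) fs \<open>\<sigma> \<notin> B\<close> by (meson card_insert_disjoint subset_trans)
    moreover have "Max (C \<alpha>) \<le> Max (C \<tau>)" using min face_trans \<alpha> \<tau> by blast
    ultimately show False using B(3) by simp
  qed
  with \<alpha> show ?thesis by (rule that)
qed

lemma uniform_mixture:
  assumes "finite F" "F \<noteq> {}" "\<And>x. x \<in> F \<Longrightarrow> normalised T A x"
  defines "\<omega> \<equiv> \<Sum>x\<in>F. (1 / card F) *\<^sub>R x"
  shows "normalised T A \<omega>" "\<And>x. x \<in> F \<Longrightarrow> x \<in> face A \<omega>"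
proof -
  have n: "0 < card F" using assms by (simp add: card_gt_0_iff)
  show \<omega>: "normalised T A \<omega>" unfolding \<omega>_def using assms(1,3) n by (intro convex_normalised) auto
  fix x assume x: "x \<in> F"
  have "\<omega> - (1 / card F) *\<^sub>R x = (\<Sum>b\<in>F - {x}. (1 / card F) *\<^sub>R b)"
    unfolding \<omega>_def using assms(1) x by (simp add: sum.remove)
  also have "\<dots> \<in> cone A" using assms(3) by (intro cone_sum[OF \<omega>] coneI) auto
  finally show "x \<in> face A \<omega>" using n x assms(3) by (auto simp: face_def intro!: exI[of _ "1 / card F"])
qed

text \<open>Mix uniformly a basis made of normalised states. The face of the mixture spans all
  normalised states, and the order-unit property then puts each of them into the face.\<close>

lemma internal_state:
  assumes "normalised T A \<rho>"
  obtains \<nu> where "normalised T A \<nu>" "\<And>\<sigma>. normalised T A \<sigma> \<Longrightarrow> \<sigma> \<in> face A \<nu>"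
proof -
  obtain N where N: "\<And>B. independent B \<Longrightarrow> B \<subseteq> states T A \<Longrightarrow> finite B \<and> card B \<le> N"
    using independent_states_bound[of A] by blast
  obtain B where B: "B \<subseteq> Collect (normalised T A)" "independent B" "Collect (normalised T A) \<subseteq> span B"
    using maximal_independent_subset by metis
  have fin: "finite B" using N[OF B(2)] B(1) normalised_states by blast
  have "\<rho> \<noteq> 0" using assms by (auto simp: normalised_iff wt_simps)
  then have "B \<noteq> {}" using B(3) assms by auto
  define \<nu> where "\<nu> = (\<Sum>b\<in>B. (1 / card B) *\<^sub>R b)"
  have \<nu>: "normalised T A \<nu>" "\<And>b. b \<in> B \<Longrightarrow> b \<in> face A \<nu>"
    unfolding \<nu>_def using uniform_mixture[OF fin \<open>B \<noteq> {}\<close>] B(1) by auto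
  have "span B \<subseteq> span (face A \<nu>)" using \<nu>(2) by (intro span_mono) auto
  then have "\<sigma> \<in> face A \<nu>" if "normalised T A \<sigma>" for \<sigma>
    using span_face_order_unit[OF \<nu>(1)] B(3) that by (auto simp: face_def)
  with \<nu>(1) show ?thesis by (rule that)
qed

end

subsection \<open>Perfectly distinguishable states\<close>

text \<open>Pairs of outcomes are numbered row by row; this is the index arithmetic behind product
  tests.\<close>

lemma concat_product:
  "length (concat (map (\<lambda>c. map (h c) ds) cs)) = length cs * length ds"
  "i < length cs \<Longrightarrow> j < length ds \<Longrightarrow>
     concat (map (\<lambda>c. map (h c) ds) cs) ! (i * length ds + j) = h (cs ! i) (ds ! j)"
proof (induction cs arbitrary: i)
  case (Cons c cs)
  { case 1 then show ?case using Cons(1) by simp }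
  { case 2 then show ?case using Cons(2) by (cases i) (auto simp: nth_append algebra_simps) }
qed simp_all

context causal_opt
begin

text \<open>The probabilities of a test sum to one, so certainty of outcome \<open>g i\<close> on
  the \<open>i\<close>-th state already excludes all other outcomes there. Surplus outcomes are
  merged away.\<close>

lemma perf_distI:
  assumes "cs \<in> tests T A \<I>" "\<rho>s \<noteq> []" "\<And>\<rho>. \<rho> \<in> set \<rho>s \<Longrightarrow> normalised T A \<rho>"
    "inj_on g {..<length \<rho>s}" "\<And>i. i < length \<rho>s \<Longrightarrow> g i < length cs"
    "\<And>i. i < length \<rho>s \<Longrightarrow> val (cs ! g i \<odot> \<rho>s ! i) = 1"
  shows "perf_dist T A \<rho>s"
proof -
  let ?n = "length \<rho>s"
  have st: "\<rho>s ! j \<in> states T A" if "j < ?n" for j using that assms(3) normalised_states by simp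
  have z: "val (cs ! k \<odot> \<rho>s ! j) = 0" if "j < ?n" "k < length cs" "k \<noteq> g j" for j k
  proof -
    have "(\<Sum>k<length cs. cs ! k) = unit_effect T A" using unit_unique[OF test_total[OF assms(1)]] .
    then have "(\<Sum>k<length cs. val (cs ! k \<odot> \<rho>s ! j)) = wt A (\<rho>s ! j)"
      by (simp add: wt_def val_sum[symmetric] bilin_sum[symmetric])
    also have "\<dots> = 1" using that assms(3) by (simp add: normalised_iff)
    finally have "(\<Sum>k\<in>{..<length cs} - {g j}. val (cs ! k \<odot> \<rho>s ! j)) = 0"
      using assms(5,6) that by (simp add: sum.remove[of _ "g j"])
    then have "\<forall>k\<in>{..<length cs} - {g j}. val (cs ! k \<odot> \<rho>s ! j) = 0"
      using val_bounds[OF nth_trafos[OF assms(1)] st[OF that(1)]] by (subst (asm) sum_nonneg_eq_0_iff) auto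
    then show ?thesis using that by auto
  qed
  \<comment> \<open>Outcomes outside the range of \<open>g\<close> go to position 0, which exists
    because the list is nonempty. They never occur on the given states.\<close>
  define h where "h k = (if k \<in> g ` {..<?n} then the_inv_into {..<?n} g k else 0)" for k
  have h: "h (g i) = i" if "i < ?n" for i using that by (simp add: h_def the_inv_into_f_f[OF assms(4)])
  have hlt: "h k < ?n" for k
    using the_inv_into_into[OF assms(4), of k "{..<?n}"] assms(2) by (auto simp: h_def)
  define as where "as = map (\<lambda>k. \<Sum>i | i < length cs \<and> h i = k. cs ! i) [0..<?n]"
  have "as \<in> tests T A \<I>" unfolding as_def using hlt by (intro test_regroup[OF assms(1)]) auto
  moreover have "length as = ?n" by (simp add: as_def)
  moreover have "as ! i \<odot> \<rho>s ! j = num T (if i = j then 1 else 0)" if ij: "i < ?n" "j < ?n" for i j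
  proof -
    have "val (as ! i \<odot> \<rho>s ! j) = (\<Sum>k | k < length cs \<and> h k = i. val (cs ! k \<odot> \<rho>s ! j))"
      using ij by (simp add: as_def val_sum[symmetric] bilin_sum[symmetric])
    also have "\<dots> = (\<Sum>k | k < length cs \<and> h k = i. if k = g j then 1 else 0)"
      using z ij assms(6) by (intro sum.cong) auto
    also have "\<dots> = (if i = j then 1 else 0)"
      using h[OF ij(2)] assms(5)[OF ij(2)] by (auto simp: sum.delta')
    finally show ?thesis
      using val_eq_num[OF nth_trafos[OF \<open>as \<in> tests T A \<I>\<close>] st] ij \<open>length as = ?n\<close> by simp
  qed
  ultimately show ?thesis unfolding perf_dist_def using assms(3) by blast
qed

lemma perf_distE:
  assumes "perf_dist T A \<rho>s"
  obtains as where "as \<in> tests T A \<I>" "length as = length \<rho>s"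
    "\<And>i j. i < length \<rho>s \<Longrightarrow> j < length \<rho>s \<Longrightarrow> val (as ! i \<odot> \<rho>s ! j) = (if i = j then 1 else 0)"
  using assms unfolding perf_dist_def by (metis val_simps(6))

lemma perf_dist_normalised: "perf_dist T A \<rho>s \<Longrightarrow> \<rho> \<in> set \<rho>s \<Longrightarrow> normalised T A \<rho>"
  by (simp add: perf_dist_def)

lemma perf_dist_nonempty: "perf_dist T A \<rho>s \<Longrightarrow> \<rho>s \<noteq> []"
  using test_nonempty by (auto simp: perf_dist_def)

lemma perf_dist_select:
  assumes "perf_dist T A \<rho>s" "inj_on g {..<n}" "\<And>i. i < n \<Longrightarrow> g i < length \<rho>s" "0 < n"
  shows "perf_dist T A (map (\<lambda>i. \<rho>s ! g i) [0..<n])"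
proof -
  obtain as where as: "as \<in> tests T A \<I>" "length as = length \<rho>s"
    "\<And>i j. i < length \<rho>s \<Longrightarrow> j < length \<rho>s \<Longrightarrow> val (as ! i \<odot> \<rho>s ! j) = (if i = j then 1 else 0)"
    using perf_distE[OF assms(1)] by blast
  show ?thesis
    using assms as by (intro perf_distI[OF as(1), of _ g]) (auto simp: perf_dist_normalised)
qed

text \<open>The distinguishing test provides dual functionals. Independence is what bounds the
  number of distinguishable states by a dimension.\<close>

lemma perf_dist_independent:
  assumes "perf_dist T A \<rho>s"
  shows "distinct \<rho>s" "independent (set \<rho>s)"
proof -
  obtain as where as: "as \<in> tests T A \<I>" "length as = length \<rho>s"
    "\<And>i j. i < length \<rho>s \<Longrightarrow> j < length \<rho>s \<Longrightarrow> val (as ! i \<odot> \<rho>s ! j) = (if i = j then 1 else 0)"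
    using perf_distE[OF assms] by blast
  show d: "distinct \<rho>s" unfolding distinct_conv_nth using as(3) by (metis zero_neq_one)
  show "independent (set \<rho>s)"
  proof (rule independent_if_scalars_zero)
    fix f x assume s: "(\<Sum>x\<in>set \<rho>s. f x *\<^sub>R x) = 0" and "x \<in> set \<rho>s"
    then obtain i where i: "i < length \<rho>s" "x = \<rho>s ! i" by (auto simp: in_set_conv_nth)
    have "0 = val (as ! i \<odot> (\<Sum>x\<in>set \<rho>s. f x *\<^sub>R x))" by (simp add: s bilin val_simps)
    also have "\<dots> = (\<Sum>x\<in>set \<rho>s. f x * val (as ! i \<odot> x))" by (simp add: bilin_sum bilin val_sum val_simps)
    also have "\<dots> = (\<Sum>y\<in>set \<rho>s. if y = x then f y else 0)"
    proof (rule sum.cong[OF refl])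
      fix y assume "y \<in> set \<rho>s"
      then obtain j where "j < length \<rho>s" "y = \<rho>s ! j" by (auto simp: in_set_conv_nth)
      then show "f y * val (as ! i \<odot> y) = (if y = x then f y else 0)"
        using as(3) i d by (simp add: nth_eq_iff_index_eq)
    qed
    also have "\<dots> = f x" using \<open>x \<in> set \<rho>s\<close> by simp
    finally show "f x = 0" by simp
  qed simp
qed

text \<open>A state that extends the list can be replaced by a pure component of it, because an
  effect certain on a mixture is certain on every component of positive weight. The dimension bound
  stops the process.\<close>

lemma perf_dist_extend:
  assumes "perf_dist T A \<rho>s" "\<forall>\<rho>\<in>set \<rho>s. pure T \<I> A \<rho>"
  obtains \<sigma>s where "pure_maximal T A (\<rho>s @ \<sigma>s)"
proof -
  obtain N where N: "\<And>B. independent B \<Longrightarrow> B \<subseteq> states T A \<Longrightarrow> finite B \<and> card B \<le> N"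
    using independent_states_bound[of A] by blast
  have len: "length \<sigma>s \<le> N" if "perf_dist T A \<sigma>s" for \<sigma>s
  proof -
    have "set \<sigma>s \<subseteq> states T A" using perf_dist_normalised[OF that] normalised_states by blast
    then show ?thesis using N perf_dist_independent[OF that] distinct_card by metis
  qed
  have "\<exists>\<sigma>s. pure_maximal T A (\<rho>s @ \<sigma>s)"
    using assms
  proof (induction "N - length \<rho>s" arbitrary: \<rho>s rule: less_induct)
    case less
    show ?case
    proof (cases "pure_maximal T A \<rho>s")
      case True
      then show ?thesis by (intro exI[of _ "[]"]) simp
    next
      case False
      then obtain \<rho> where \<rho>: "perf_dist T A (\<rho>s @ [\<rho>])" using less.prems by (auto simp: pure_maximal_def)
      then have \<rho>n: "normalised T A \<rho>" using perf_dist_normalised by fastforce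
      obtain \<alpha> where \<alpha>: "\<alpha> \<in> face A \<rho>" "pure T \<I> A \<alpha>" using pure_component[OF \<rho>n] .
      obtain p \<tau> where p: "0 < p" "p \<le> 1" "normalised T A \<tau>" "\<rho> = p *\<^sub>R \<alpha> + (1 - p) *\<^sub>R \<tau>"
        using face_decompose[OF \<rho>n \<alpha>(1)] .
      note \<alpha>n = face_normalised[OF \<alpha>(1)]
      let ?n = "length \<rho>s"
      obtain as where as: "as \<in> tests T A \<I>" "length as = Suc ?n"
        "\<And>i j. i \<le> ?n \<Longrightarrow> j \<le> ?n \<Longrightarrow> val (as ! i \<odot> (\<rho>s @ [\<rho>]) ! j) = (if i = j then 1 else 0)"
        using perf_distE[OF \<rho>] by (metis length_append_singleton less_Suc_eq_le)
      have e: "as ! ?n \<in> effects T A" using nth_trafos[OF as(1)] as(2) by simp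
      have "p * val (as ! ?n \<odot> \<alpha>) + (1 - p) * val (as ! ?n \<odot> \<tau>) = 1"
        using as(3)[of ?n ?n] by (simp add: p(4) bilin val_simps)
      moreover have "val (as ! ?n \<odot> \<alpha>) \<le> 1" "val (as ! ?n \<odot> \<tau>) \<le> 1"
        using val_bounds[OF e] \<alpha>n p(3) normalised_states by blast+
      moreover have "(1 - p) * val (as ! ?n \<odot> \<tau>) \<le> 1 - p" using calculation p by (simp add: mult_left_le)
      ultimately have "p \<le> p * val (as ! ?n \<odot> \<alpha>)" by simp
      then have 1: "val (as ! ?n \<odot> \<alpha>) = 1" using p(1) \<open>val (as ! ?n \<odot> \<alpha>) \<le> 1\<close> by simp
      have pd: "perf_dist T A (\<rho>s @ [\<alpha>])"
      proof (rule perf_distI[OF as(1), of _ id])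
        fix i assume i: "i < length (\<rho>s @ [\<alpha>])"
        show "val (as ! id i \<odot> (\<rho>s @ [\<alpha>]) ! i) = 1"
          using i 1 as(3)[of i i] by (cases "i = ?n") (auto simp: nth_append)
      qed (use less.prems \<alpha>n as perf_dist_normalised in auto)
      \<comment> \<open>The bound \<open>len\<close> is applied to the longer list, so the truncated
        difference really drops.\<close>
      have "N - length (\<rho>s @ [\<alpha>]) < N - length \<rho>s" using len[OF pd] by simp
      from less.hyps[OF this pd] less.prems \<alpha> obtain \<sigma>s where "pure_maximal T A ((\<rho>s @ [\<alpha>]) @ \<sigma>s)" by auto
      then show ?thesis by (metis append.assoc)
    qed
  qed
  then show ?thesis using that by blast
qed

end

subsection \<open>Reversible channels and product states\<close>

context causal_opt
begin

lemma reversible_channel: "reversible T A B U \<Longrightarrow> channel T A B U"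
  by (simp add: reversible_def)

lemma reversible_trafos: "reversible T A B U \<Longrightarrow> U \<in> trafos T A B"
  by (simp add: reversible_def channel_trafos)

lemma reversible_inverse:
  assumes "reversible T A B U"
  obtains V where "reversible T B A V" "V \<odot> U = idt T A" "U \<odot> V = idt T B"
  using assms unfolding reversible_def by blast

lemma reversible_idt: "reversible T A A (idt T A)"
  unfolding reversible_def using channel_idt sq_idt_left[OF idt_trafos] by blast

lemma reversible_swp: "reversible T (A \<diamondop> B) (B \<diamondop> A) (swp T A B)"
  unfolding reversible_def using channel_swp swp_swp by blast

lemma reversible_sq:
  assumes "reversible T A B U" "reversible T B C V"
  shows "reversible T A C (V \<odot> U)"
proof -
  obtain U' where U': "reversible T B A U'" "U' \<odot> U = idt T A" "U \<odot> U' = idt T B"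
    using reversible_inverse[OF assms(1)] .
  obtain V' where V': "reversible T C B V'" "V' \<odot> V = idt T B" "V \<odot> V' = idt T C"
    using reversible_inverse[OF assms(2)] .
  note m = reversible_trafos[OF assms(1)] reversible_trafos[OF assms(2)]
    reversible_trafos[OF U'(1)] reversible_trafos[OF V'(1)]
  have "(U' \<odot> V') \<odot> (V \<odot> U) = U' \<odot> ((V' \<odot> V) \<odot> U)"
    using sq_assoc[OF sq_trafos[OF m(1,2)] m(4,3)] sq_assoc[OF m(1,2,4)] by simp
  moreover have "(V \<odot> U) \<odot> (U' \<odot> V') = V \<odot> ((U \<odot> U') \<odot> V')"
    using sq_assoc[OF sq_trafos[OF m(4,3)] m(1,2)] sq_assoc[OF m(4,3,1)] by simp
  ultimately show ?thesis unfolding reversible_def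
    using assms U' V' m channel_sq by (metis reversible_channel sq_idt_left)
qed

lemma reversible_par:
  assumes "reversible T A B U" "reversible T C D V"
  shows "reversible T (A \<diamondop> C) (B \<diamondop> D) (U \<otimes> V)"
proof -
  obtain U' where U': "reversible T B A U'" "U' \<odot> U = idt T A" "U \<odot> U' = idt T B"
    using reversible_inverse[OF assms(1)] .
  obtain V' where V': "reversible T D C V'" "V' \<odot> V = idt T C" "V \<odot> V' = idt T D"
    using reversible_inverse[OF assms(2)] .
  note m = reversible_trafos[OF assms(1)] reversible_trafos[OF assms(2)]
    reversible_trafos[OF U'(1)] reversible_trafos[OF V'(1)]
  show ?thesis unfolding reversible_def
    using interchange[OF m(1,3,2,4)] interchange[OF m(3,1,4,2)] U' V' assms
    by (metis channel_par par_idt reversible_channel)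
qed

lemma sq_inverse_cancel:
  assumes "reversible T A B U" "V \<odot> U = idt T A" "V \<in> trafos T B A" "x \<in> trafos T X A"
  shows "V \<odot> (U \<odot> x) = x"
  using sq_assoc[OF assms(4) reversible_trafos[OF assms(1)] assms(3)] assms(2,4) by (simp add: sq_idt_left)

text \<open>Decompositions are pulled back along the inverse. Purity Preservation cannot serve yet:
  purity of reversible channels is derived later through steering, whose proof uses this
  fact.\<close>

lemma pure_reversible_sq:
  assumes "pure T A B f" "reversible T B C U"
  shows "pure T A C (U \<odot> f)"
proof -
  obtain V where V: "reversible T C B V" "V \<odot> U = idt T B" "U \<odot> V = idt T C"
    using reversible_inverse[OF assms(2)] .
  note m = pure_trafos[OF assms(1)] reversible_trafos[OF assms(2)] reversible_trafos[OF V(1)]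
  show ?thesis
  proof (rule pureI3[OF sq_trafos[OF m(1,2)]])
    fix D E F assume t: "[D, E, F] \<in> tests T A C" and s: "U \<odot> f = D + E"
    have "[V \<odot> D, V \<odot> E, V \<odot> F] \<in> tests T A B"
      using test_sq_const[OF t, of "[V]" B] V(1) by (simp add: reversible_def channel_def)
    moreover have "f = V \<odot> D + V \<odot> E"
      using sq_inverse_cancel[OF assms(2) V(2) m(3,1)] by (simp add: s bilin)
    ultimately obtain c where c: "V \<odot> D = c *\<^sub>R f" using pureD3[OF assms(1)] by blast
    have "D = U \<odot> (V \<odot> D)" using sq_inverse_cancel[OF V(1,3) m(2) test_trafos[OF t]] by simp
    then show "\<exists>c. D = c *\<^sub>R (U \<odot> f)" by (auto simp: c bilin)
  qed
qed

section \<open>Product states, product effects and marginals\<close>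

lemma normalised_par:
  assumes "normalised T A \<rho>" "normalised T B \<sigma>"
  shows "normalised T (A \<diamondop> B) (\<rho> \<otimes> \<sigma>)"
  using channel_par[of \<I> A \<rho> \<I> B \<sigma>] assms by (simp add: normalised_channel cmpst_triv_left)

lemma states_par:
  assumes "\<rho> \<in> states T A" "\<sigma> \<in> states T B"
  shows "\<rho> \<otimes> \<sigma> \<in> states T (A \<diamondop> B)"
  using par_trafos[OF assms] by (simp add: cmpst_triv_left)

lemma effects_par:
  assumes "a \<in> effects T A" "b \<in> effects T B"
  shows "a \<otimes> b \<in> effects T (A \<diamondop> B)"
  using par_trafos[OF assms] by (simp add: cmpst_triv_left)

lemma effect_left_trafos: "a \<in> effects T A \<Longrightarrow> a \<otimes> idt T B \<in> trafos T (A \<diamondop> B) B"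
  using par_trafos[OF _ idt_trafos, of a A \<I> B] by (simp add: cmpst_triv_left)

lemma effect_right_trafos: "a \<in> effects T B \<Longrightarrow> idt T A \<otimes> a \<in> trafos T (A \<diamondop> B) A"
  using par_trafos[OF idt_trafos, of a B \<I> A] by (simp add: cmpst_triv_right)

lemma state_right_trafos: "\<rho> \<in> states T B \<Longrightarrow> idt T A \<otimes> \<rho> \<in> trafos T A (A \<diamondop> B)"
  using par_trafos[OF idt_trafos, of \<rho> \<I> B A] by (simp add: cmpst_triv_right)

lemma state_left_trafos: "\<rho> \<in> states T B \<Longrightarrow> \<rho> \<otimes> idt T A \<in> trafos T A (B \<diamondop> A)"
  using par_trafos[OF _ idt_trafos, of \<rho> \<I> B A] by (simp add: cmpst_triv_left)

lemma append_state:
  assumes "f \<in> trafos T X A" "\<zeta> \<in> states T Z"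
  shows "(idt T A \<otimes> \<zeta>) \<odot> f = f \<otimes> \<zeta>"
  using interchange[OF assms(1) idt_trafos idt_trafos assms(2)] assms
  by (simp add: par_triv_right sq_idt_left sq_idt_right)

lemma prepend_state:
  assumes "f \<in> trafos T X A" "\<zeta> \<in> states T Z"
  shows "(\<zeta> \<otimes> idt T A) \<odot> f = \<zeta> \<otimes> f"
  using interchange[OF idt_trafos assms(2) assms(1) idt_trafos] assms
  by (simp add: par_triv_left sq_idt_left sq_idt_right)

lemma pairing_par:
  assumes "a \<in> effects T A" "b \<in> effects T B" "\<rho> \<in> states T A" "\<sigma> \<in> states T B"
  shows "val ((a \<otimes> b) \<odot> (\<rho> \<otimes> \<sigma>)) = val (a \<odot> \<rho>) * val (b \<odot> \<sigma>)"
proof -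
  have "(a \<otimes> b) \<odot> (\<rho> \<otimes> \<sigma>) = (a \<odot> \<rho>) \<otimes> (b \<odot> \<sigma>)"
    by (rule interchange[OF assms(3,1,4,2)])
  also have "\<dots> = (val (a \<odot> \<rho>) *\<^sub>R idt T \<I>) \<otimes> (val (b \<odot> \<sigma>) *\<^sub>R idt T \<I>)"
    using val_num assms by metis
  also have "\<dots> = (val (a \<odot> \<rho>) * val (b \<odot> \<sigma>)) *\<^sub>R idt T \<I>"
    by (simp add: bilin par_triv_left[OF idt_trafos])
  finally show ?thesis by (simp add: val_simps)
qed

lemma effect_left_product:
  assumes "a \<in> effects T A" "\<rho> \<in> states T A" "f \<in> trafos T B C" "\<sigma> \<in> trafos T X B"
  shows "(a \<otimes> f) \<odot> (\<rho> \<otimes> \<sigma>) = val (a \<odot> \<rho>) *\<^sub>R (f \<odot> \<sigma>)"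
proof -
  have "(a \<otimes> f) \<odot> (\<rho> \<otimes> \<sigma>) = (a \<odot> \<rho>) \<otimes> (f \<odot> \<sigma>)" by (rule interchange[OF assms(2,1,4,3)])
  then show ?thesis using val_num[OF assms(1,2)] sq_trafos[OF assms(4,3)]
    by (metis bilinear_lmul[OF bilinear_par] par_triv_left)
qed

lemma effect_right_product:
  assumes "a \<in> effects T A" "\<rho> \<in> states T A" "f \<in> trafos T B C" "\<sigma> \<in> trafos T X B"
  shows "(f \<otimes> a) \<odot> (\<sigma> \<otimes> \<rho>) = val (a \<odot> \<rho>) *\<^sub>R (f \<odot> \<sigma>)"
proof -
  have "(f \<otimes> a) \<odot> (\<sigma> \<otimes> \<rho>) = (f \<odot> \<sigma>) \<otimes> (a \<odot> \<rho>)" by (rule interchange[OF assms(4,3,2,1)])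
  then show ?thesis using val_num[OF assms(1,2)] sq_trafos[OF assms(4,3)]
    by (metis bilinear_rmul[OF bilinear_par] par_triv_right)
qed

lemma unit_normalised: "normalised T A \<rho> \<Longrightarrow> val (unit_effect T A \<odot> \<rho>) = 1"
  by (simp add: normalised_iff wt_def)

lemma swp_effect:
  assumes "f \<in> trafos T A B" "a \<in> effects T C"
  shows "(a \<otimes> f) \<odot> swp T A C = f \<otimes> a" "(f \<otimes> a) \<odot> swp T C A = a \<otimes> f"
proof -
  have "swp T \<I> B = idt T B"
  proof -
    have "swp T \<I> B \<in> trafos T B B" using swp_trafos[of \<I> B] by (simp add: cmpst_triv_left cmpst_triv_right)
    then show ?thesis using swp_swp[of B \<I>] by (simp add: swp_triv cmpst_triv_left sq_idt_left)
  qed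
  moreover have "f \<otimes> a \<in> trafos T (A \<diamondop> C) B" "a \<otimes> f \<in> trafos T (C \<diamondop> A) B"
    using par_trafos[OF assms] par_trafos[OF assms(2,1)] by (simp_all add: cmpst_triv_left cmpst_triv_right)
  ultimately show "(a \<otimes> f) \<odot> swp T A C = f \<otimes> a" "(f \<otimes> a) \<odot> swp T C A = a \<otimes> f"
    using swp_natural[OF assms] swp_natural[OF assms(2,1)] by (simp_all add: swp_triv sq_idt_left)
qed

lemma swp_product:
  assumes "\<rho> \<in> states T A" "\<sigma> \<in> states T B"
  shows "swp T A B \<odot> (\<rho> \<otimes> \<sigma>) = \<sigma> \<otimes> \<rho>"
  using swp_natural[OF assms] states_par[OF assms(2,1)] by (simp add: swp_triv sq_idt_right)

lemma marginal_normalised: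
  assumes "normalised T (A \<diamondop> B) \<sigma>"
  shows "normalised T A (marginal T A B \<sigma>)"
proof -
  have "channel T (A \<diamondop> B) A (idt T A \<otimes> unit_effect T B)"
    using channel_par[OF channel_idt[of A] channel_unit[of B]] by (simp add: cmpst_triv_right)
  then show ?thesis unfolding marginal_def using assms by (rule channel_normalised)
qed

lemma marginal_product:
  assumes "\<rho> \<in> states T A" "normalised T B \<sigma>"
  shows "marginal T A B (\<rho> \<otimes> \<sigma>) = \<rho>"
  unfolding marginal_def
  using effect_right_product[OF unit_trafos normalised_states[OF assms(2)] idt_trafos assms(1)] assms
  by (simp add: unit_normalised sq_idt_left)

text \<open>Both sides apply \<open>a\<close> to \<open>A\<close> and discard \<open>B\<close>.
  Together with \<open>state_zero\<close>, an effect of probability zero on the marginal annihilates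
  the joint state.\<close>

lemma wt_marginal:
  assumes "\<sigma> \<in> states T (A \<diamondop> B)" "a \<in> effects T A"
  shows "val (a \<odot> marginal T A B \<sigma>) = wt B ((a \<otimes> idt T B) \<odot> \<sigma>)"
proof -
  have "a \<odot> marginal T A B \<sigma> = (a \<otimes> idt T \<I>) \<odot> ((idt T A \<otimes> unit_effect T B) \<odot> \<sigma>)"
    by (simp add: marginal_def par_triv_right[OF assms(2)])
  also have "\<dots> = (idt T \<I> \<otimes> unit_effect T B) \<odot> ((a \<otimes> idt T B) \<odot> \<sigma>)"
    using par_act_comm[OF assms(1,2) unit_trafos] by simp
  finally show ?thesis by (simp add: wt_def par_triv_left[OF unit_trafos])
qed

lemma product_test_nth:
  assumes "as \<in> tests T A \<I>" "bs \<in> tests T B \<I>"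
  obtains cs where "cs \<in> tests T (A \<diamondop> B) \<I>" "length cs = length as * length bs"
    "\<And>i j. i < length as \<Longrightarrow> j < length bs \<Longrightarrow> cs ! (i * length bs + j) = as ! i \<otimes> bs ! j"
  using test_par[OF assms] concat_product[where h="\<lambda>c d. c \<otimes> d" and ds=bs and cs=as] that
  by (simp add: cmpst_triv_left)

text \<open>Distinct pairs have distinct flat indices by division with remainder. A list of pairs is
  allowed instead of the whole grid because the exchange for permutability uses only part of one row
  and one column.\<close>

lemma perf_dist_product:
  assumes "perf_dist T A \<rho>s" "perf_dist T B \<sigma>s" "distinct ps" "ps \<noteq> []"
    "\<And>i j. (i, j) \<in> set ps \<Longrightarrow> i < length \<rho>s \<and> j < length \<sigma>s"
  shows "perf_dist T (A \<diamondop> B) (map (\<lambda>(i, j). \<rho>s ! i \<otimes> \<sigma>s ! j) ps)"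
proof -
  obtain as where as: "as \<in> tests T A \<I>" "length as = length \<rho>s"
    "\<And>i j. i < length \<rho>s \<Longrightarrow> j < length \<rho>s \<Longrightarrow> val (as ! i \<odot> \<rho>s ! j) = (if i = j then 1 else 0)"
    using perf_distE[OF assms(1)] by blast
  obtain bs where bs: "bs \<in> tests T B \<I>" "length bs = length \<sigma>s"
    "\<And>i j. i < length \<sigma>s \<Longrightarrow> j < length \<sigma>s \<Longrightarrow> val (bs ! i \<odot> \<sigma>s ! j) = (if i = j then 1 else 0)"
    using perf_distE[OF assms(2)] by blast
  obtain cs where cs: "cs \<in> tests T (A \<diamondop> B) \<I>" "length cs = length as * length bs"
    "\<And>i j. i < length as \<Longrightarrow> j < length bs \<Longrightarrow> cs ! (i * length bs + j) = as ! i \<otimes> bs ! j"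
    using product_test_nth[OF as(1) bs(1)] by blast
  have lt: "fst (ps ! k) < length \<rho>s" "snd (ps ! k) < length \<sigma>s" if "k < length ps" for k
    using assms(5)[of "fst (ps ! k)" "snd (ps ! k)"] that by auto
  define g where "g k = fst (ps ! k) * length bs + snd (ps ! k)" for k
  have n\<rho>: "normalised T A (\<rho>s ! i)" if "i < length \<rho>s" for i using that perf_dist_normalised[OF assms(1)] by simp
  have n\<sigma>: "normalised T B (\<sigma>s ! i)" if "i < length \<sigma>s" for i using that perf_dist_normalised[OF assms(2)] by simp
  let ?L = "map (\<lambda>(i, j). \<rho>s ! i \<otimes> \<sigma>s ! j) ps"
  show ?thesis
  proof (rule perf_distI[OF cs(1), of _ g])
    show "?L \<noteq> []" using assms(4) by simp
    show "normalised T (A \<diamondop> B) \<rho>" if "\<rho> \<in> set ?L" for \<rho>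
      using that assms(5) n\<rho> n\<sigma> by (auto intro!: normalised_par)
    show "inj_on g {..<length ?L}"
    proof (rule inj_onI)
      fix k l assume kl: "k \<in> {..<length ?L}" "l \<in> {..<length ?L}" "g k = g l"
      then have s: "snd (ps ! k) < length bs" "snd (ps ! l) < length bs" "length bs \<noteq> 0" using lt bs(2) by auto
      have "g k div length bs = fst (ps ! k)" "g l div length bs = fst (ps ! l)"
        "g k mod length bs = snd (ps ! k)" "g l mod length bs = snd (ps ! l)" using s by (auto simp: g_def div_mult_self3)
      then have "ps ! k = ps ! l" using kl(3) by (simp add: prod_eq_iff)
      then show "k = l" using kl assms(3) by (simp add: nth_eq_iff_index_eq)
    qed
    fix k assume "k < length ?L"
    then have k: "k < length ps" by simp
    let ?i = "fst (ps ! k)" and ?j = "snd (ps ! k)"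
    have ij: "?i < length as" "?j < length bs" using lt[OF k] as(2) bs(2) by auto
    have "g k < (?i + 1) * length bs" using ij by (simp add: g_def)
    also have "\<dots> \<le> length cs" unfolding cs(2) using ij by (intro mult_right_mono) auto
    finally show "g k < length cs" .
    have "cs ! g k = as ! ?i \<otimes> bs ! ?j" unfolding g_def by (rule cs(3)[OF ij])
    moreover have "?L ! k = \<rho>s ! ?i \<otimes> \<sigma>s ! ?j" using k by (simp add: case_prod_beta)
    ultimately show "val (cs ! g k \<odot> ?L ! k) = 1"
      using pairing_par[OF nth_trafos[OF as(1)] nth_trafos[OF bs(1)] normalised_states normalised_states, of ?i ?j "\<rho>s ! ?i" "\<sigma>s ! ?j"]
        ij n\<rho>[of ?i] n\<sigma>[of ?j] lt[OF k] as(3)[of ?i ?i] bs(3)[of ?j ?j] by simp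
  qed
qed

text \<open>Only the first factor is read out and the second is discarded, so the states of
  \<open>B\<close> may coincide.\<close>

lemma perf_dist_tag:
  assumes "perf_dist T A \<rho>s" "length \<sigma>s = length \<rho>s" "\<And>\<sigma>. \<sigma> \<in> set \<sigma>s \<Longrightarrow> normalised T B \<sigma>"
  shows "perf_dist T (A \<diamondop> B) (map2 (\<lambda>\<rho> \<sigma>. \<rho> \<otimes> \<sigma>) \<rho>s \<sigma>s)"
proof -
  obtain as where as: "as \<in> tests T A \<I>" "length as = length \<rho>s"
    "\<And>i j. i < length \<rho>s \<Longrightarrow> j < length \<rho>s \<Longrightarrow> val (as ! i \<odot> \<rho>s ! j) = (if i = j then 1 else 0)"
    using perf_distE[OF assms(1)] by blast
  have u: "[unit_effect T B] \<in> tests T B \<I>" using channel_unit by (simp add: channel_def)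
  obtain cs where cs: "cs \<in> tests T (A \<diamondop> B) \<I>" "length cs = length as"
    "\<And>i. i < length as \<Longrightarrow> cs ! i = as ! i \<otimes> unit_effect T B"
    using product_test_nth[OF as(1) u] by (metis One_nat_def add.right_neutral length_Cons lessI list.size(3) mult.right_neutral nth_Cons_0)
  have n\<rho>: "normalised T A (\<rho>s ! i)" if "i < length \<rho>s" for i using that perf_dist_normalised[OF assms(1)] by simp
  have n\<sigma>: "normalised T B (\<sigma>s ! i)" if "i < length \<rho>s" for i using that assms(2,3) by simp
  show ?thesis
  proof (rule perf_distI[OF cs(1), of _ id])
    show "map2 (\<lambda>\<rho> \<sigma>. \<rho> \<otimes> \<sigma>) \<rho>s \<sigma>s \<noteq> []" using perf_dist_nonempty[OF assms(1)] assms(2) by auto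
    show "normalised T (A \<diamondop> B) \<rho>" if "\<rho> \<in> set (map2 (\<lambda>\<rho> \<sigma>. \<rho> \<otimes> \<sigma>) \<rho>s \<sigma>s)" for \<rho>
      using that perf_dist_normalised[OF assms(1)] assms(3)
      by (auto intro!: normalised_par dest: set_zip_leftD set_zip_rightD)
    fix i assume "i < length (map2 (\<lambda>\<rho> \<sigma>. \<rho> \<otimes> \<sigma>) \<rho>s \<sigma>s)"
    then have i: "i < length \<rho>s" by simp
    show "id i < length cs" using i cs as by simp
    show "val (cs ! id i \<odot> map2 (\<lambda>\<rho> \<sigma>. \<rho> \<otimes> \<sigma>) \<rho>s \<sigma>s ! i) = 1"
      using pairing_par[OF nth_trafos[OF as(1)] unit_trafos normalised_states normalised_states, of i "\<rho>s ! i" B "\<sigma>s ! i"]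
        i cs as n\<rho> n\<sigma> assms(2) unit_normalised by simp
  qed simp
qed

lemma perf_dist_reversible:
  assumes "perf_dist T A \<rho>s" "reversible T A B V"
  shows "perf_dist T B (map (\<lambda>\<rho>. V \<odot> \<rho>) \<rho>s)"
proof -
  obtain U where U: "reversible T B A U" "U \<odot> V = idt T A" "V \<odot> U = idt T B" using reversible_inverse[OF assms(2)] .
  obtain as where as: "as \<in> tests T A \<I>" "length as = length \<rho>s"
    "\<And>i j. i < length \<rho>s \<Longrightarrow> j < length \<rho>s \<Longrightarrow> val (as ! i \<odot> \<rho>s ! j) = (if i = j then 1 else 0)"
    using perf_distE[OF assms(1)] by blast
  have n\<rho>: "normalised T A \<rho>" if "\<rho> \<in> set \<rho>s" for \<rho> using that perf_dist_normalised[OF assms(1)] by simp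
  have t: "concat (map (\<lambda>c. map (\<lambda>d. d \<odot> c) as) [U]) \<in> tests T B \<I>"
    using U(1) by (intro test_sq_const[OF _ as(1)]) (simp add: reversible_def channel_def)
  then have t': "map (\<lambda>d. d \<odot> U) as \<in> tests T B \<I>" by simp
  show ?thesis
  proof (rule perf_distI[OF t', of _ id])
    fix i assume "i < length (map (\<lambda>\<rho>. V \<odot> \<rho>) \<rho>s)"
    then have i: "i < length \<rho>s" by simp
    have \<rho>i: "\<rho>s ! i \<in> states T A" using n\<rho> i normalised_states by simp
    have ai: "as ! i \<in> effects T A" using nth_trafos[OF as(1)] as(2) i by simp
    have "(as ! i \<odot> U) \<odot> (V \<odot> \<rho>s ! i) = as ! i \<odot> (U \<odot> (V \<odot> \<rho>s ! i))"
      by (rule sq_assoc[OF sq_trafos[OF \<rho>i reversible_trafos[OF assms(2)]] reversible_trafos[OF U(1)] ai])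
    also have "U \<odot> (V \<odot> \<rho>s ! i) = \<rho>s ! i"
      by (rule sq_inverse_cancel[OF assms(2) U(2) reversible_trafos[OF U(1)] \<rho>i])
    finally show "val (map (\<lambda>d. d \<odot> U) as ! id i \<odot> map (\<lambda>\<rho>. V \<odot> \<rho>) \<rho>s ! i) = 1"
      using as i by simp
  qed (use perf_dist_nonempty[OF assms(1)] channel_normalised[OF reversible_channel[OF assms(2)]] n\<rho> as in auto)
qed

lemma marginal_triv: "\<rho> \<in> states T A \<Longrightarrow> marginal T A \<I> \<rho> = \<rho>"
  by (simp add: marginal_def unit_triv par_idt cmpst_triv_right sq_idt_left)

lemma marginal_swp:
  assumes "\<sigma> \<in> states T (A \<diamondop> B)"
  shows "marginal T B A (swp T A B \<odot> \<sigma>) = (unit_effect T A \<otimes> idt T B) \<odot> \<sigma>"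
  unfolding marginal_def
  using sq_assoc[OF assms swp_trafos effect_right_trafos[OF unit_trafos]] swp_effect(2)[OF idt_trafos unit_trafos]
  by metis

end

subsection \<open>Steering\<close>

context sharp_theory_with_purification
begin

lemma normalised_exists: obtains \<rho> where "normalised T A \<rho>"
proof -
  obtain a \<rho> where a: "\<rho> \<in> states T A" "a \<odot> \<rho> = num T 1" using pure_sharpness by blast
  then have "\<rho> \<noteq> 0" using idt_triv_nonzero by (auto simp: num_def bilin)
  then show ?thesis using normalisable[OF a(1)] that by blast
qed

lemma pure_normalised_exists: obtains \<alpha> where "normalised T A \<alpha>" "pure T \<I> A \<alpha>"
proof -
  obtain \<rho> where \<rho>: "normalised T A \<rho>" by (rule normalised_exists)
  show ?thesis using pure_component[OF \<rho>] face_normalised that by metis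
qed

lemma pure_states_par: "pure T \<I> A \<alpha> \<Longrightarrow> pure T \<I> B \<beta> \<Longrightarrow> pure T \<I> (A \<diamondop> B) (\<alpha> \<otimes> \<beta>)"
  using pure_par[of \<I> A \<alpha> \<I> B \<beta>] by (simp add: cmpst_triv_left)

text \<open>
  Dilate the given test, purify the dilation and compare it with \<open>\<Psi>\<close>, both padded with pure
  ancillas to make the purifying systems equal.
\<close>

lemma steering:
  assumes \<Psi>: "normalised T (A \<diamondop> B) \<Psi>" "pure T \<I> (A \<diamondop> B) \<Psi>"
    and cs: "cs \<in> tests T \<I> (A \<diamondop> S)" "i < length cs"
    and mg: "marginal T A S (\<Sum>k<length cs. cs ! k) = marginal T A B \<Psi>"
  obtains D where "D \<in> trafos T B S" "(idt T A \<otimes> D) \<odot> \<Psi> = cs ! i"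
proof -
  obtain X C es where C: "channel T \<I> ((A \<diamondop> S) \<diamondop> X) C" and es: "es \<in> tests T X \<I>"
    and cs_eq: "cs = map (\<lambda>e. (idt T (A \<diamondop> S) \<otimes> e) \<odot> C) es"
    using test_dilation[OF cs(1)] by blast
  obtain Y \<Sigma> where \<Sigma>: "normalised T (((A \<diamondop> S) \<diamondop> X) \<diamondop> Y) \<Sigma>" "pure T \<I> (((A \<diamondop> S) \<diamondop> X) \<diamondop> Y) \<Sigma>"
    "marginal T ((A \<diamondop> S) \<diamondop> X) Y \<Sigma> = C"
    using purification_exists C unfolding normalised_channel by metis
  \<comment> \<open>Everything in the purified dilation except \<open>A\<close>.\<close>
  define Z where "Z = S \<diamondop> (X \<diamondop> Y)"
  have Z: "((A \<diamondop> S) \<diamondop> X) \<diamondop> Y = A \<diamondop> Z" by (simp add: Z_def cmpst_assoc)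
  note \<Sigma>n = \<Sigma>(1)[unfolded Z] and \<Sigma>p = \<Sigma>(2)[unfolded Z]
  note \<Sigma>s = normalised_states[OF \<Sigma>n]
  obtain \<beta> where \<beta>: "normalised T B \<beta>" "pure T \<I> B \<beta>" by (rule pure_normalised_exists)
  obtain \<zeta> where \<zeta>: "normalised T Z \<zeta>" "pure T \<I> Z \<zeta>" by (rule pure_normalised_exists)
  note \<Psi>s = normalised_states[OF \<Psi>(1)] and \<beta>s = normalised_states[OF \<beta>(1)] and \<zeta>s = normalised_states[OF \<zeta>(1)]
  let ?u = "unit_effect T"
  define \<Theta>1 where "\<Theta>1 = \<Psi> \<otimes> \<zeta>"
  \<comment> \<open>Both padded states live on \<open>A \<diamondop> (B \<diamondop> Z)\<close>; the
    swap moves the ancilla \<open>\<beta>\<close> to the place of \<open>B\<close>.\<close>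
  define \<Theta>2 where "\<Theta>2 = (idt T A \<otimes> swp T Z B) \<odot> (\<Sigma> \<otimes> \<beta>)"
  have \<Theta>1: "normalised T (A \<diamondop> (B \<diamondop> Z)) \<Theta>1" "pure T \<I> (A \<diamondop> (B \<diamondop> Z)) \<Theta>1"
    using normalised_par[OF \<Psi>(1) \<zeta>(1)] pure_states_par[OF \<Psi>(2) \<zeta>(2)] by (simp_all add: \<Theta>1_def cmpst_assoc)
  have \<Sigma>\<beta>: "normalised T (A \<diamondop> (Z \<diamondop> B)) (\<Sigma> \<otimes> \<beta>)" "pure T \<I> (A \<diamondop> (Z \<diamondop> B)) (\<Sigma> \<otimes> \<beta>)"
    using normalised_par[OF \<Sigma>n \<beta>(1)] pure_states_par[OF \<Sigma>p \<beta>(2)] by (simp_all add: cmpst_assoc)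
  note \<Sigma>\<beta>s = normalised_states[OF \<Sigma>\<beta>(1)]
  have rs: "reversible T (A \<diamondop> (Z \<diamondop> B)) (A \<diamondop> (B \<diamondop> Z)) (idt T A \<otimes> swp T Z B)"
    by (intro reversible_par reversible_idt reversible_swp)
  have \<Theta>2: "normalised T (A \<diamondop> (B \<diamondop> Z)) \<Theta>2" "pure T \<I> (A \<diamondop> (B \<diamondop> Z)) \<Theta>2"
    unfolding \<Theta>2_def using channel_normalised[OF reversible_channel[OF rs] \<Sigma>\<beta>(1)] pure_reversible_sq[OF \<Sigma>\<beta>(2) rs] by auto
  have act: "(idt T A \<otimes> (?u B \<otimes> f)) \<odot> \<Theta>2 = (idt T A \<otimes> f) \<odot> \<Sigma>" if f: "f \<in> trafos T Z W" for f W
  proof -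
    have uf: "?u B \<otimes> f \<in> trafos T (B \<diamondop> Z) W" using par_trafos[OF unit_trafos f] by (simp add: cmpst_triv_left)
    have "(idt T A \<otimes> (?u B \<otimes> f)) \<odot> \<Theta>2 = (idt T A \<otimes> (f \<otimes> ?u B)) \<odot> (\<Sigma> \<otimes> \<beta>)"
      unfolding \<Theta>2_def
      using par_act[OF \<Sigma>\<beta>s idt_trafos swp_trafos idt_trafos uf] swp_effect(1)[OF f unit_trafos]
      by (simp add: sq_idt_left[OF idt_trafos])
    also have "\<dots> = ((idt T A \<otimes> f) \<otimes> ?u B) \<odot> (\<Sigma> \<otimes> \<beta>)"
      using par_assoc[OF idt_trafos f unit_trafos] by simp
    also have "\<dots> = (idt T A \<otimes> f) \<odot> \<Sigma>"
      using effect_right_product[OF unit_trafos \<beta>s par_trafos[OF idt_trafos f] \<Sigma>s] unit_normalised[OF \<beta>(1)] by simp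
    finally show ?thesis .
  qed
  have act2: "(idt T A \<otimes> (f \<otimes> (e \<otimes> ?u Y))) \<odot> \<Sigma> = (idt T A \<otimes> (f \<otimes> e)) \<odot> C"
    if f: "f \<in> trafos T S W" and e: "e \<in> effects T X" for f e W
  proof -
    have g: "idt T A \<otimes> (f \<otimes> e) \<in> trafos T ((A \<diamondop> S) \<diamondop> X) (A \<diamondop> W)"
      using par_trafos[OF idt_trafos[of A] par_trafos[OF f e]] by (simp add: cmpst_assoc cmpst_triv_right)
    have "(idt T A \<otimes> (f \<otimes> (e \<otimes> ?u Y))) = (idt T A \<otimes> (f \<otimes> e)) \<otimes> ?u Y"
      using par_assoc[OF idt_trafos par_trafos[OF f e] unit_trafos] par_assoc[OF f e unit_trafos] by simp
    then have "(idt T A \<otimes> (f \<otimes> (e \<otimes> ?u Y))) \<odot> \<Sigma> = (idt T A \<otimes> (f \<otimes> e) \<otimes> idt T \<I>) \<odot> ((idt T ((A \<diamondop> S) \<diamondop> X) \<otimes> ?u Y) \<odot> \<Sigma>)"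
      using par_act_comm(1)[OF normalised_states[OF \<Sigma>(1)] g unit_trafos] par_assoc[OF idt_trafos par_trafos[OF f e] idt_trafos]
        par_triv_right[OF g] par_triv_right[OF par_trafos[OF f e]] by simp
    then show ?thesis using \<Sigma>(3) par_triv_right[OF par_trafos[OF f e]] by (simp add: marginal_def)
  qed
  have total: "(\<Sum>k<length es. es ! k) = ?u X" using unit_unique[OF test_total[OF es]] .
  have assoc4: "idt T (A \<diamondop> S) \<otimes> e = idt T A \<otimes> (idt T S \<otimes> e)" if "e \<in> effects T X" for e
    using par_assoc[OF idt_trafos idt_trafos that] by (simp add: par_idt)
  have "marginal T A (B \<diamondop> Z) \<Theta>2 = (idt T A \<otimes> ?u Z) \<odot> \<Sigma>"
    using act[OF unit_trafos] by (simp add: marginal_def unit_par)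
  also have "\<dots> = (idt T A \<otimes> (?u S \<otimes> ?u X)) \<odot> C"
    using act2[OF unit_trafos unit_trafos] by (simp add: Z_def unit_par)
  also have "\<dots> = (idt T A \<otimes> ?u S) \<odot> ((idt T (A \<diamondop> S) \<otimes> ?u X) \<odot> C)"
  proof -
    have r: "idt T A \<otimes> ?u S \<in> trafos T (A \<diamondop> S) A" by (rule effect_right_trafos[OF unit_trafos])
    have "(idt T A \<otimes> ?u S) \<odot> ((idt T (A \<diamondop> S) \<otimes> ?u X) \<odot> C) = ((idt T A \<otimes> ?u S) \<otimes> ?u X) \<odot> C"
      using par_act_comm(1)[OF channel_trafos[OF C] r unit_trafos] by (simp add: par_triv_right[OF r])
    then show ?thesis using par_assoc[OF idt_trafos unit_trafos unit_trafos] by simp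
  qed
  also have "(idt T (A \<diamondop> S) \<otimes> ?u X) \<odot> C = (\<Sum>k<length cs. cs ! k)"
    unfolding cs_eq total[symmetric] by (simp add: bilin_sum)
  finally have m2: "marginal T A (B \<diamondop> Z) \<Theta>2 = marginal T A B \<Psi>" using mg by (simp add: marginal_def)
  have m1: "marginal T A (B \<diamondop> Z) \<Theta>1 = marginal T A B \<Psi>"
  proof -
    have "marginal T A (B \<diamondop> Z) \<Theta>1 = ((idt T A \<otimes> ?u B) \<otimes> ?u Z) \<odot> (\<Psi> \<otimes> \<zeta>)"
      unfolding marginal_def \<Theta>1_def unit_par[symmetric] using par_assoc[OF idt_trafos unit_trafos unit_trafos] by simp
    then show ?thesis
      using effect_right_product[OF unit_trafos \<zeta>s effect_right_trafos[OF unit_trafos] \<Psi>s] unit_normalised[OF \<zeta>(1)]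
      by (simp add: marginal_def)
  qed
  obtain U where U: "reversible T (B \<diamondop> Z) (B \<diamondop> Z) U" "\<Theta>2 = (idt T A \<otimes> U) \<odot> \<Theta>1"
    using purification_unique[OF \<Theta>1 \<Theta>2] m1 m2 by auto
  let ?e = "es ! i"
  have e: "?e \<in> effects T X" using nth_trafos[OF es] cs by (simp add: cs_eq)
  \<comment> \<open>Keep \<open>S\<close>, apply the effect of outcome \<open>i\<close> to
    \<open>X\<close>, discard the purifying system \<open>Y\<close>.\<close>
  let ?f = "idt T S \<otimes> (?e \<otimes> ?u Y)"
  have f: "?f \<in> trafos T Z S"
    using effect_right_trafos[OF effects_par[OF e unit_trafos]] by (simp add: Z_def)
  \<comment> \<open>Attach the ancilla \<open>\<zeta>\<close>, apply the channel that uniqueness of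
    purification supplies, discard \<open>B\<close> and read outcome \<open>i\<close>.\<close>
  define D where "D = (?u B \<otimes> ?f) \<odot> (U \<odot> (idt T B \<otimes> \<zeta>))"
  have m\<zeta>: "idt T B \<otimes> \<zeta> \<in> trafos T B (B \<diamondop> Z)" by (rule state_right_trafos[OF \<zeta>s])
  have mU: "U \<odot> (idt T B \<otimes> \<zeta>) \<in> trafos T B (B \<diamondop> Z)" by (rule sq_trafos[OF m\<zeta> reversible_trafos[OF U(1)]])
  have mf: "?u B \<otimes> ?f \<in> trafos T (B \<diamondop> Z) S" using par_trafos[OF unit_trafos f] by (simp add: cmpst_triv_left)
  have "D \<in> trafos T B S" unfolding D_def by (rule sq_trafos[OF mU mf])
  moreover have "(idt T A \<otimes> D) \<odot> \<Psi> = cs ! i"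
  proof -
    have "(idt T A \<otimes> (idt T B \<otimes> \<zeta>)) \<odot> \<Psi> = \<Theta>1"
      using append_state[OF \<Psi>s \<zeta>s] par_assoc[OF idt_trafos idt_trafos \<zeta>s] by (simp add: \<Theta>1_def par_idt)
    moreover have "(idt T A \<otimes> (U \<odot> (idt T B \<otimes> \<zeta>))) \<odot> \<Psi> = (idt T A \<otimes> U) \<odot> ((idt T A \<otimes> (idt T B \<otimes> \<zeta>)) \<odot> \<Psi>)"
      using par_act[OF \<Psi>s idt_trafos m\<zeta> idt_trafos reversible_trafos[OF U(1)]] by (simp add: sq_idt_left[OF idt_trafos])
    moreover have "(idt T A \<otimes> D) \<odot> \<Psi> = (idt T A \<otimes> (?u B \<otimes> ?f)) \<odot> ((idt T A \<otimes> (U \<odot> (idt T B \<otimes> \<zeta>))) \<odot> \<Psi>)"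
      unfolding D_def using par_act[OF \<Psi>s idt_trafos mU idt_trafos mf] by (simp add: sq_idt_left[OF idt_trafos])
    ultimately have "(idt T A \<otimes> D) \<odot> \<Psi> = (idt T A \<otimes> (?u B \<otimes> ?f)) \<odot> \<Theta>2" using U(2) by simp
    also have "\<dots> = (idt T A \<otimes> ?f) \<odot> \<Sigma>" by (rule act[OF f])
    also have "\<dots> = (idt T A \<otimes> (idt T S \<otimes> ?e)) \<odot> C" by (rule act2[OF idt_trafos e])
    also have "\<dots> = cs ! i" using cs(2) assoc4[OF e] by (simp add: cs_eq)
    finally show ?thesis .
  qed
  ultimately show ?thesis by (rule that)
qed

lemma steering_face:
  assumes \<Psi>: "normalised T (A \<diamondop> B) \<Psi>" "pure T \<I> (A \<diamondop> B) \<Psi>"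
    and \<sigma>: "normalised T (A \<diamondop> S) \<sigma>" "marginal T A S \<sigma> \<in> face A (marginal T A B \<Psi>)"
  obtains D p where "D \<in> trafos T B S" "0 < p" "(idt T A \<otimes> D) \<odot> \<Psi> = p *\<^sub>R \<sigma>"
proof -
  obtain p \<tau> where p: "0 < p" "p \<le> 1" "normalised T A \<tau>"
    "marginal T A B \<Psi> = p *\<^sub>R marginal T A S \<sigma> + (1 - p) *\<^sub>R \<tau>"
    using face_decompose[OF marginal_normalised[OF \<Psi>(1)] \<sigma>(2)] .
  obtain s where s: "normalised T S s" by (rule normalised_exists)
  \<comment> \<open>The second outcome only fills up the marginal to that of \<open>\<Psi>\<close>;
    its part on \<open>S\<close> is arbitrary.\<close>
  let ?cs = "[p *\<^sub>R \<sigma>, (1 - p) *\<^sub>R (\<tau> \<otimes> s)]"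
  have "?cs \<in> tests T \<I> (A \<diamondop> S)" using p \<sigma> normalised_par[OF p(3) s] by (intro convex2) auto
  moreover have "marginal T A S (\<Sum>k<length ?cs. ?cs ! k) = marginal T A B \<Psi>"
    using marginal_product[OF normalised_states[OF p(3)] s]
    using p(4) by (simp add: lessThan_Suc marginal_def bilin)
  ultimately obtain D where "D \<in> trafos T B S" "(idt T A \<otimes> D) \<odot> \<Psi> = ?cs ! 0"
    using steering[OF \<Psi>, of ?cs S 0] by auto
  then show ?thesis using that p by auto
qed

text \<open>Purify an interior state. Every normalised state of \<open>A \<diamondop> S\<close> is
  steered from \<open>\<Phi>\<close> up to a factor, and steering commutes with transformations of
  \<open>A\<close>, so agreement on \<open>\<Phi>\<close> spreads to all states.\<close>

lemma faithful_state:
  obtains B \<Phi> where "normalised T (A \<diamondop> B) \<Phi>" "pure T \<I> (A \<diamondop> B) \<Phi>"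
    "\<And>C f g. f \<in> trafos T A C \<Longrightarrow> g \<in> trafos T A C \<Longrightarrow>
       (f \<otimes> idt T B) \<odot> \<Phi> = (g \<otimes> idt T B) \<odot> \<Phi> \<Longrightarrow> f = g"
proof -
  obtain \<rho> where "normalised T A \<rho>" by (rule normalised_exists)
  then obtain \<nu> where \<nu>: "normalised T A \<nu>" "\<And>\<sigma>. normalised T A \<sigma> \<Longrightarrow> \<sigma> \<in> face A \<nu>"
    using internal_state by metis
  obtain B \<Phi> where \<Phi>: "normalised T (A \<diamondop> B) \<Phi>" "pure T \<I> (A \<diamondop> B) \<Phi>" "marginal T A B \<Phi> = \<nu>"
    using purification_exists[OF \<nu>(1)] by blast
  note \<Phi>s = normalised_states[OF \<Phi>(1)]
  show ?thesis
  proof (rule that[OF \<Phi>(1,2)])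
    fix C f g assume f: "f \<in> trafos T A C" and g: "g \<in> trafos T A C"
      and eq: "(f \<otimes> idt T B) \<odot> \<Phi> = (g \<otimes> idt T B) \<odot> \<Phi>"
    show "f = g"
    proof (rule trans_eqI)
      show "f \<in> span (trafos T A C)" "g \<in> span (trafos T A C)" using f g by (auto intro: span_base)
      fix S \<rho> assume \<rho>: "\<rho> \<in> states T (A \<diamondop> S)"
      show "(f \<otimes> idt T S) \<odot> \<rho> = (g \<otimes> idt T S) \<odot> \<rho>"
      proof (cases "\<rho> = 0")
        case False
        then obtain \<sigma> where \<sigma>: "normalised T (A \<diamondop> S) \<sigma>" "\<rho> = wt (A \<diamondop> S) \<rho> *\<^sub>R \<sigma>"
          using state_normalise[OF \<rho>] by blast
        obtain D p where D: "D \<in> trafos T B S" "0 < p" "(idt T A \<otimes> D) \<odot> \<Phi> = p *\<^sub>R \<sigma>"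
          using steering_face[OF \<Phi>(1,2) \<sigma>(1)] \<nu>(2) marginal_normalised[OF \<sigma>(1)] \<Phi>(3) by metis
        have "(h \<otimes> idt T S) \<odot> (p *\<^sub>R \<sigma>) = (idt T C \<otimes> D) \<odot> ((h \<otimes> idt T B) \<odot> \<Phi>)"
          if "h \<in> trafos T A C" for h
          using par_act_comm[OF \<Phi>s that D(1)] D(3) by simp
        then have "p *\<^sub>R ((f \<otimes> idt T S) \<odot> \<sigma>) = p *\<^sub>R ((g \<otimes> idt T S) \<odot> \<sigma>)"
          using f g eq by (simp add: bilin)
        then have "(f \<otimes> idt T S) \<odot> \<sigma> = (g \<otimes> idt T S) \<odot> \<sigma>" using D(2) by simp
        then show ?thesis using \<sigma>(2) by (metis sq_scale_right)
      qed (simp add: bilin)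
    qed
  qed
qed

text \<open>On the pure state \<open>\<Phi>\<close> each term of a decomposition acts as a scalar,
  and faithfulness lifts this to the term itself.\<close>

lemma pure_idt: "pure T A A (idt T A)"
proof -
  obtain B \<Phi> where \<Phi>: "normalised T (A \<diamondop> B) \<Phi>" "pure T \<I> (A \<diamondop> B) \<Phi>"
    and ff: "\<And>C f g. f \<in> trafos T A C \<Longrightarrow> g \<in> trafos T A C \<Longrightarrow>
       (f \<otimes> idt T B) \<odot> \<Phi> = (g \<otimes> idt T B) \<odot> \<Phi> \<Longrightarrow> f = g"
    using faithful_state[of A] by blast
  note \<Phi>s = normalised_states[OF \<Phi>(1)]
  show ?thesis
  proof (rule pureI3[OF idt_trafos])
    fix D E F assume t: "[D, E, F] \<in> tests T A A" and s: "idt T A = D + E"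
    have "[D \<otimes> idt T B, E \<otimes> idt T B, F \<otimes> idt T B] \<in> tests T (A \<diamondop> B) (A \<diamondop> B)"
      using test_par[OF t test_idt[of B]] by simp
    from test_sq_const[OF \<Phi>(1)[unfolded normalised_channel channel_def] this]
    have t': "[(D \<otimes> idt T B) \<odot> \<Phi>, (E \<otimes> idt T B) \<odot> \<Phi>, (F \<otimes> idt T B) \<odot> \<Phi>] \<in> tests T \<I> (A \<diamondop> B)" by simp
    have id\<Phi>: "(idt T A \<otimes> idt T B) \<odot> \<Phi> = \<Phi>" using sq_idt_left[OF \<Phi>s] by (simp add: par_idt)
    have "\<Phi> = (D \<otimes> idt T B) \<odot> \<Phi> + (E \<otimes> idt T B) \<odot> \<Phi>"
      using id\<Phi> by (simp add: s bilin)
    then obtain c where c: "(D \<otimes> idt T B) \<odot> \<Phi> = c *\<^sub>R \<Phi>" using pureD3[OF \<Phi>(2) t'] by blast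
    have "(D \<otimes> idt T B) \<odot> \<Phi> \<in> states T (A \<diamondop> B)" using test_trafos[OF t'] by simp
    \<comment> \<open>Faithfulness compares transformations only, so
      \<open>c *\<^sub>R idt T A\<close> has to be shown to be one.\<close>
    then have "0 \<le> c" "c \<le> 1" using wt_bounds[of "c *\<^sub>R \<Phi>" "A \<diamondop> B"] \<Phi>(1) by (auto simp: c wt_simps normalised_iff)
    then have cm: "c *\<^sub>R idt T A \<in> trafos T A A" by (rule trafos_scale[OF idt_trafos])
    have Dm: "D \<in> trafos T A A" using test_trafos[OF t] by simp
    have "(D \<otimes> idt T B) \<odot> \<Phi> = ((c *\<^sub>R idt T A) \<otimes> idt T B) \<odot> \<Phi>" by (simp add: c id\<Phi> bilin)
    then have "D = c *\<^sub>R idt T A" by (rule ff[OF Dm cm])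
    then show "\<exists>c. D = c *\<^sub>R idt T A" ..
  qed
qed

lemma pure_reversible: "reversible T A B U \<Longrightarrow> pure T A B U"
  using pure_reversible_sq[OF pure_idt] sq_idt_right[OF reversible_trafos] by metis

lemma reversible_preserves_pure:
  "reversible T A B U \<Longrightarrow> pure T \<I> A \<alpha> \<Longrightarrow> pure T \<I> B (U \<odot> \<alpha>)"
  using pure_reversible pure_sq by blast

text \<open>The product of the pure marginal with any pure state of \<open>B\<close> purifies the
  same marginal, so a reversible channel on \<open>B\<close> alone carries it to
  \<open>\<Psi>\<close>.\<close>

lemma pure_state_product:
  assumes "normalised T (A \<diamondop> B) \<Psi>" "pure T \<I> (A \<diamondop> B) \<Psi>" "pure T \<I> A (marginal T A B \<Psi>)"
  obtains \<beta> where "normalised T B \<beta>" "pure T \<I> B \<beta>" "\<Psi> = marginal T A B \<Psi> \<otimes> \<beta>"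
proof -
  let ?\<alpha> = "marginal T A B \<Psi>"
  have \<alpha>: "normalised T A ?\<alpha>" by (rule marginal_normalised[OF assms(1)])
  note \<alpha>s = normalised_states[OF \<alpha>]
  obtain \<beta> where \<beta>: "normalised T B \<beta>" "pure T \<I> B \<beta>" by (rule pure_normalised_exists)
  obtain U where U: "reversible T B B U" "\<Psi> = (idt T A \<otimes> U) \<odot> (?\<alpha> \<otimes> \<beta>)"
    using purification_unique[OF normalised_par[OF \<alpha> \<beta>(1)] pure_states_par[OF assms(3) \<beta>(2)] assms(1,2)]
      marginal_product[OF \<alpha>s \<beta>(1)] by auto
  have "\<Psi> = ?\<alpha> \<otimes> (U \<odot> \<beta>)"
    using U(2) interchange[OF \<alpha>s idt_trafos normalised_states[OF \<beta>(1)] reversible_trafos[OF U(1)]]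
    by (simp add: sq_idt_left[OF \<alpha>s])
  then show ?thesis
    using that[of "U \<odot> \<beta>"] channel_normalised[OF reversible_channel[OF U(1)] \<beta>(1)]
      reversible_preserves_pure[OF U(1) \<beta>(2)] by simp
qed

text \<open>Reduced to the pure case by purifying \<open>\<sigma>\<close> and discarding the
  purifying system afterwards.\<close>

lemma state_product:
  assumes "normalised T (A \<diamondop> B) \<sigma>" "pure T \<I> A (marginal T A B \<sigma>)"
  obtains \<kappa> where "normalised T B \<kappa>" "\<sigma> = marginal T A B \<sigma> \<otimes> \<kappa>"
proof -
  obtain C \<Sigma> where \<Sigma>: "normalised T ((A \<diamondop> B) \<diamondop> C) \<Sigma>" "pure T \<I> ((A \<diamondop> B) \<diamondop> C) \<Sigma>"
    "marginal T (A \<diamondop> B) C \<Sigma> = \<sigma>" using purification_exists[OF assms(1)] by blast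
  note \<Sigma>' = \<Sigma>(1,2)[unfolded cmpst_assoc]
  let ?u = "unit_effect T"
  note r = effect_right_trafos[OF unit_trafos, of A B]
  have "(idt T A \<otimes> ?u B) \<odot> ((idt T (A \<diamondop> B) \<otimes> ?u C) \<odot> \<Sigma>) = ((idt T A \<otimes> ?u B) \<otimes> ?u C) \<odot> \<Sigma>"
    using par_act_comm(1)[OF normalised_states[OF \<Sigma>(1)] r unit_trafos] by (simp add: par_triv_right[OF r])
  then have m: "marginal T A (B \<diamondop> C) \<Sigma> = marginal T A B \<sigma>"
    using \<Sigma>(3) par_assoc[OF idt_trafos unit_trafos unit_trafos] by (simp add: marginal_def unit_par)
  then obtain \<beta> where \<beta>: "normalised T (B \<diamondop> C) \<beta>" "\<Sigma> = marginal T A B \<sigma> \<otimes> \<beta>"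
    using pure_state_product[OF \<Sigma>'] assms(2) by metis
  note \<alpha>s = normalised_states[OF marginal_normalised[OF assms(1)]]
  have "\<sigma> = (idt T A \<otimes> (idt T B \<otimes> ?u C)) \<odot> (marginal T A B \<sigma> \<otimes> \<beta>)"
    using \<Sigma>(3) \<beta>(2) par_assoc[OF idt_trafos idt_trafos unit_trafos] by (simp add: marginal_def par_idt)
  also have "\<dots> = (idt T A \<odot> marginal T A B \<sigma>) \<otimes> ((idt T B \<otimes> ?u C) \<odot> \<beta>)"
    by (rule interchange[OF \<alpha>s idt_trafos normalised_states[OF \<beta>(1)] effect_right_trafos[OF unit_trafos]])
  also have "\<dots> = marginal T A B \<sigma> \<otimes> marginal T B C \<beta>"
    by (simp only: sq_idt_left[OF \<alpha>s] marginal_def[of T B C \<beta>])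
  finally show ?thesis using that marginal_normalised[OF \<beta>(1)] by blast
qed

end

subsection \<open>Sharp effects\<close>

context sharp_theory_with_purification
begin

lemma sharp_normalised:
  assumes "a \<in> effects T A" "\<rho> \<in> states T A" "val (a \<odot> \<rho>) = 1"
  shows "normalised T A \<rho>"
  using effect_le_wt[OF assms(1,2)] wt_bounds[OF assms(2)] assms by (simp add: normalised_iff)

text \<open>Purify \<open>\<rho>\<close>. As \<open>a\<close> is certain, applying it to
  \<open>A\<close> leaves the same state on \<open>B\<close> as discarding \<open>A\<close>. That
  state is pure by Purity Preservation, so the purification factorises.\<close>

lemma sharp_pure:
  assumes a: "pure T A \<I> a" and \<rho>: "\<rho> \<in> states T A" and 1: "val (a \<odot> \<rho>) = 1"
  shows "pure T \<I> A \<rho>"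
proof -
  note as = pure_trafos[OF a]
  have \<rho>n: "normalised T A \<rho>" by (rule sharp_normalised[OF as \<rho> 1])
  obtain B \<Psi> where \<Psi>: "normalised T (A \<diamondop> B) \<Psi>" "pure T \<I> (A \<diamondop> B) \<Psi>" "marginal T A B \<Psi> = \<rho>"
    using purification_exists[OF \<rho>n] by blast
  note \<Psi>s = normalised_states[OF \<Psi>(1)]
  let ?u = "unit_effect T"
  have pa: "pure T (A \<diamondop> B) B (a \<otimes> idt T B)" using pure_par[OF a pure_idt[of B]] by (simp add: cmpst_triv_left)
  define \<beta> where "\<beta> = (a \<otimes> idt T B) \<odot> \<Psi>"
  have \<beta>p: "pure T \<I> B \<beta>" unfolding \<beta>_def by (rule pure_sq[OF \<Psi>(2) pa])
  have "((?u A - a) \<otimes> idt T B) \<odot> \<Psi> = 0"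
  proof (rule state_zero)
    show "((?u A - a) \<otimes> idt T B) \<odot> \<Psi> \<in> states T B"
      by (rule sq_trafos[OF \<Psi>s effect_left_trafos[OF effect_complement_trafos[OF as]]])
    show "wt B (((?u A - a) \<otimes> idt T B) \<odot> \<Psi>) = 0"
      using wt_marginal[OF \<Psi>s effect_complement_trafos[OF as]] \<Psi>(3) 1 unit_normalised[OF \<rho>n]
      by (simp add: bilin val_simps)
  qed
  then have u\<beta>: "(?u A \<otimes> idt T B) \<odot> \<Psi> = \<beta>" by (simp add: \<beta>_def bilin)
  let ?\<Psi> = "swp T A B \<odot> \<Psi>"
  have sw: "normalised T (B \<diamondop> A) ?\<Psi>" "pure T \<I> (B \<diamondop> A) ?\<Psi>"
    using channel_normalised[OF channel_swp \<Psi>(1)] reversible_preserves_pure[OF reversible_swp \<Psi>(2)] by auto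
  have swm: "(f \<otimes> e) \<odot> ?\<Psi> = (e \<otimes> f) \<odot> \<Psi>" if "f \<in> trafos T B C" "e \<in> effects T A" for f e C
  proof -
    have "f \<otimes> e \<in> trafos T (B \<diamondop> A) C" using par_trafos[OF that] by (simp add: cmpst_triv_right)
    then show ?thesis using sq_assoc[OF \<Psi>s swp_trafos] swp_effect(2)[OF that] by metis
  qed
  have swm': "(e \<otimes> f) \<odot> ?\<Psi> = (f \<otimes> e) \<odot> \<Psi>" if "f \<in> trafos T A C" "e \<in> effects T B" for f e C
  proof -
    have "e \<otimes> f \<in> trafos T (B \<diamondop> A) C" using par_trafos[OF that(2,1)] by (simp add: cmpst_triv_left)
    then show ?thesis using sq_assoc[OF \<Psi>s swp_trafos] swp_effect(1)[OF that] by metis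
  qed
  have "marginal T B A ?\<Psi> = \<beta>" using swm[OF idt_trafos unit_trafos] u\<beta> by (simp add: marginal_def)
  then obtain \<alpha> where \<alpha>: "normalised T A \<alpha>" "pure T \<I> A \<alpha>" "?\<Psi> = \<beta> \<otimes> \<alpha>"
    using pure_state_product[OF sw] \<beta>p by metis
  have \<beta>n: "normalised T B \<beta>" using marginal_normalised[OF sw(1)] \<open>marginal T B A ?\<Psi> = \<beta>\<close> by simp
  have "\<rho> = (idt T A \<otimes> ?u B) \<odot> \<Psi>" using \<Psi>(3) by (simp add: marginal_def)
  also have "\<dots> = (?u B \<otimes> idt T A) \<odot> (\<beta> \<otimes> \<alpha>)" using swm'[OF idt_trafos unit_trafos] \<alpha>(3) by simp
  also have "\<dots> = \<alpha>"
    using effect_left_product[OF unit_trafos normalised_states[OF \<beta>n] idt_trafos normalised_states[OF \<alpha>(1)]]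
      unit_normalised[OF \<beta>n] sq_idt_left[OF normalised_states[OF \<alpha>(1)]] by simp
  finally show ?thesis using \<alpha>(2) by simp
qed

text \<open>The mixture of two states on which \<open>a\<close> is certain is pure as well, hence
  extremal.\<close>

lemma sharp_unique:
  assumes a: "pure T A \<I> a" and \<rho>: "\<rho> \<in> states T A" "val (a \<odot> \<rho>) = 1" and \<sigma>: "\<sigma> \<in> states T A" "val (a \<odot> \<sigma>) = 1"
  shows "\<rho> = \<sigma>"
proof -
  have n: "normalised T A \<rho>" "normalised T A \<sigma>"
    using sharp_normalised[OF pure_trafos[OF a]] \<rho> \<sigma> by auto
  let ?m = "(1/2) *\<^sub>R \<rho> + (1 - 1/2) *\<^sub>R \<sigma>"
  \<comment> \<open>The same mixture in the other order, since \<open>faceI\<close> exhibits only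
    the first component.\<close>
  let ?m' = "(1/2) *\<^sub>R \<sigma> + (1 - 1/2) *\<^sub>R \<rho>"
  have m: "normalised T A ?m" by (intro convex2 n) auto
  have "val (a \<odot> ?m) = 1" by (simp add: bilin val_simps \<rho> \<sigma>)
  then have "pure T \<I> A ?m" using sharp_pure[OF a normalised_states[OF m]] by blast
  then have f: "face A ?m = {?m}" using pure_state_iff[OF m] by blast
  have "\<rho> \<in> face A ?m" by (rule faceI[OF _ _ n]) auto
  then have \<rho>m: "\<rho> = ?m" unfolding f by (rule singletonD)
  have sm: "?m' = ?m" by (simp add: add.commute)
  have "\<sigma> \<in> face A ?m'" by (rule faceI[OF _ _ n(2,1)]) auto
  then have "\<sigma> = ?m" unfolding sm f by (rule singletonD)
  with \<rho>m show ?thesis by (rule trans[OF _ sym])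
qed

text \<open>Normalised pure states of \<open>A\<close> all purify the trivial system, which has a
  single normalised state.\<close>

lemma pure_states_transitive:
  assumes "normalised T A \<alpha>" "pure T \<I> A \<alpha>" "normalised T A \<beta>" "pure T \<I> A \<beta>"
  obtains U where "reversible T A A U" "\<beta> = U \<odot> \<alpha>"
proof -
  have m: "marginal T \<I> A \<gamma> = num T 1" if "normalised T A \<gamma>" for \<gamma>
    using that by (simp add: marginal_def par_triv_left[OF unit_trafos] normalised_def)
  obtain U where U: "reversible T A A U" "\<beta> = (idt T \<I> \<otimes> U) \<odot> \<alpha>"
    using purification_unique[of \<I> A \<alpha> \<beta>] assms m by (auto simp: cmpst_triv_left)
  then show ?thesis using that by (simp add: par_triv_left[OF reversible_trafos[OF U(1)]])
qed

text \<open>Transitivity on pure states carries one sharp effect to all of them. Keeping that effect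
  fixed makes the candidates an orbit, over which a maximum can be taken later.\<close>

lemma sharp_orbit:
  obtains a where "pure T A \<I> a"
    "\<And>\<alpha>. normalised T A \<alpha> \<Longrightarrow> pure T \<I> A \<alpha> \<Longrightarrow> \<exists>U. reversible T A A U \<and> val ((a \<odot> U) \<odot> \<alpha>) = 1"
proof -
  obtain a \<rho> where a: "pure T A \<I> a" "\<rho> \<in> states T A" "a \<odot> \<rho> = num T 1" using pure_sharpness by blast
  have 1: "val (a \<odot> \<rho>) = 1" by (simp add: a(3) val_simps)
  note \<rho>p = sharp_pure[OF a(1,2) 1] and \<rho>n = sharp_normalised[OF pure_trafos[OF a(1)] a(2) 1]
  show ?thesis
  proof (rule that[OF a(1)])
    fix \<alpha> assume \<alpha>: "normalised T A \<alpha>" "pure T \<I> A \<alpha>"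
    obtain U where U: "reversible T A A U" "\<rho> = U \<odot> \<alpha>" using pure_states_transitive[OF \<alpha> \<rho>n \<rho>p] .
    then have "(a \<odot> U) \<odot> \<alpha> = a \<odot> \<rho>"
      using sq_assoc[OF normalised_states[OF \<alpha>(1)] reversible_trafos[OF U(1)] pure_trafos[OF a(1)]] by simp
    then show "\<exists>U. reversible T A A U \<and> val ((a \<odot> U) \<odot> \<alpha>) = 1" using U 1 by metis
  qed
qed

lemma sharp_effect:
  assumes "normalised T A \<alpha>" "pure T \<I> A \<alpha>"
  obtains a where "pure T A \<I> a" "val (a \<odot> \<alpha>) = 1"
proof -
  obtain a where a: "pure T A \<I> a"
    "\<And>\<alpha>. normalised T A \<alpha> \<Longrightarrow> pure T \<I> A \<alpha> \<Longrightarrow> \<exists>U. reversible T A A U \<and> val ((a \<odot> U) \<odot> \<alpha>) = 1"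
    using sharp_orbit[of A] by blast
  obtain U where U: "reversible T A A U" "val ((a \<odot> U) \<odot> \<alpha>) = 1" using a(2)[OF assms] by blast
  show ?thesis by (rule that[OF pure_sq[OF pure_reversible[OF U(1)] a(1)] U(2)])
qed

end

subsection \<open>Conversion of pure maximal sets\<close>

context sharp_theory_with_purification
begin

lemma purification_unique_left:
  assumes "normalised T (A \<diamondop> B) \<Psi>" "pure T \<I> (A \<diamondop> B) \<Psi>" "normalised T (A \<diamondop> B) \<Psi>'" "pure T \<I> (A \<diamondop> B) \<Psi>'"
    "(unit_effect T A \<otimes> idt T B) \<odot> \<Psi> = (unit_effect T A \<otimes> idt T B) \<odot> \<Psi>'"
  obtains U where "reversible T A A U" "\<Psi>' = (U \<otimes> idt T B) \<odot> \<Psi>"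
proof -
  note s = normalised_states[OF assms(1)] normalised_states[OF assms(3)]
  let ?S = "swp T A B"
  have sw: "normalised T (B \<diamondop> A) (?S \<odot> \<Psi>)" "pure T \<I> (B \<diamondop> A) (?S \<odot> \<Psi>)"
     "normalised T (B \<diamondop> A) (?S \<odot> \<Psi>')" "pure T \<I> (B \<diamondop> A) (?S \<odot> \<Psi>')"
    using channel_normalised[OF channel_swp] reversible_preserves_pure[OF reversible_swp] assms by auto
  obtain U where U: "reversible T A A U" "?S \<odot> \<Psi>' = (idt T B \<otimes> U) \<odot> (?S \<odot> \<Psi>)"
    using purification_unique[OF sw] marginal_swp[OF s(1)] marginal_swp[OF s(2)] assms(5) by auto
  have unswap: "swp T B A \<odot> (?S \<odot> x) = x" if "x \<in> states T (A \<diamondop> B)" for x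
    by (rule sq_inverse_cancel[OF reversible_swp swp_swp swp_trafos that])
  note m = sq_trafos[OF s(1) swp_trafos]
  note mU = reversible_trafos[OF U(1)]
  have "\<Psi>' = swp T B A \<odot> ((idt T B \<otimes> U) \<odot> (?S \<odot> \<Psi>))" using unswap[OF s(2)] U(2) by simp
  also have "\<dots> = (swp T B A \<odot> (idt T B \<otimes> U)) \<odot> (?S \<odot> \<Psi>)"
    by (rule sq_assoc[symmetric, OF m par_trafos[OF idt_trafos mU] swp_trafos])
  also have "swp T B A \<odot> (idt T B \<otimes> U) = (U \<otimes> idt T B) \<odot> swp T B A" by (rule swp_natural[OF idt_trafos mU])
  also have "((U \<otimes> idt T B) \<odot> swp T B A) \<odot> (?S \<odot> \<Psi>) = (U \<otimes> idt T B) \<odot> (swp T B A \<odot> (?S \<odot> \<Psi>))"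
    by (rule sq_assoc[OF m swp_trafos par_trafos[OF mU idt_trafos]])
  finally show ?thesis using that U(1) unswap[OF s(1)] by simp
qed

text \<open>The channel agrees with \<open>Q\<close> on a purification of the mixture of
  \<open>F\<close>. Steering hands the agreement on to states in the face of the mixture; elsewhere
  the two may differ.\<close>

lemma deterministic_pure_reversible:
  assumes Q: "pure T A A Q" and F: "finite F" "F \<noteq> {}" "\<And>x. x \<in> F \<Longrightarrow> normalised T A x"
    "\<And>x. x \<in> F \<Longrightarrow> wt A (Q \<odot> x) = 1"
  obtains U where "reversible T A A U" "\<And>x. x \<in> F \<Longrightarrow> U \<odot> x = Q \<odot> x"
proof -
  define \<omega> where "\<omega> = (\<Sum>x\<in>F. (1 / card F) *\<^sub>R x)"
  have \<omega>: "normalised T A \<omega>" "\<And>x. x \<in> F \<Longrightarrow> x \<in> face A \<omega>"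
    unfolding \<omega>_def using uniform_mixture[OF F(1-3)] by auto
  obtain R \<Gamma> where \<Gamma>: "normalised T (A \<diamondop> R) \<Gamma>" "pure T \<I> (A \<diamondop> R) \<Gamma>" "marginal T A R \<Gamma> = \<omega>"
    using purification_exists[OF \<omega>(1)] by blast
  note \<Gamma>s = normalised_states[OF \<Gamma>(1)] and Qm = pure_trafos[OF Q]
  let ?u = "unit_effect T"
  define \<Gamma>' where "\<Gamma>' = (Q \<otimes> idt T R) \<odot> \<Gamma>"
  have QR: "pure T (A \<diamondop> R) (A \<diamondop> R) (Q \<otimes> idt T R)" by (rule pure_par[OF Q pure_idt])
  have \<Gamma>'p: "pure T \<I> (A \<diamondop> R) \<Gamma>'" unfolding \<Gamma>'_def by (rule pure_sq[OF \<Gamma>(2) QR])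
  note uQ = sq_trafos[OF Qm unit_trafos]
  have "(\<Sum>x\<in>F. (1 / card F) * wt A (Q \<odot> x)) = (\<Sum>x\<in>F. 1 / card F)" using F(4) by simp
  then have w: "wt A (Q \<odot> \<omega>) = 1" using F(1,2) by (simp add: \<omega>_def bilin_sum bilin wt_sum wt_simps)
  have uQ1: "val ((?u A \<odot> Q) \<odot> \<omega>) = 1"
    using w sq_assoc[OF normalised_states[OF \<omega>(1)] Qm unit_trafos] by (simp add: wt_def)
  \<comment> \<open>The effect \<open>unit_effect T A \<odot> Q\<close> is certain on the mixture,
    so its complement leaves nothing on \<open>R\<close>.\<close>
  have z: "((?u A - ?u A \<odot> Q) \<otimes> idt T R) \<odot> \<Gamma> = 0"
  proof (rule state_zero)
    note c = effect_complement_trafos[OF uQ]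
    show "((?u A - ?u A \<odot> Q) \<otimes> idt T R) \<odot> \<Gamma> \<in> states T R" by (rule sq_trafos[OF \<Gamma>s effect_left_trafos[OF c]])
    show "wt R (((?u A - ?u A \<odot> Q) \<otimes> idt T R) \<odot> \<Gamma>) = 0"
      using wt_marginal[OF \<Gamma>s c] \<Gamma>(3) uQ1 unit_normalised[OF \<omega>(1)] by (simp add: bilin val_simps)
  qed
  have u\<Gamma>': "(?u A \<otimes> idt T R) \<odot> \<Gamma>' = ((?u A \<odot> Q) \<otimes> idt T R) \<odot> \<Gamma>"
    unfolding \<Gamma>'_def using par_act[OF \<Gamma>s Qm idt_trafos unit_trafos idt_trafos] by (simp add: sq_idt_left[OF idt_trafos])
  then have mg: "(?u A \<otimes> idt T R) \<odot> \<Gamma> = (?u A \<otimes> idt T R) \<odot> \<Gamma>'" using z by (simp add: bilin)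
  have "wt (A \<diamondop> R) x = wt R ((?u A \<otimes> idt T R) \<odot> x)" if "x \<in> states T (A \<diamondop> R)" for x
    using par_act_comm(2)[OF that unit_trafos unit_trafos] by (simp add: wt_def unit_par par_triv_left[OF unit_trafos])
  then have "wt (A \<diamondop> R) \<Gamma>' = wt (A \<diamondop> R) \<Gamma>" using mg \<Gamma>s pure_trafos[OF \<Gamma>'p] by simp
  then have \<Gamma>'n: "normalised T (A \<diamondop> R) \<Gamma>'" using \<Gamma>(1) pure_trafos[OF \<Gamma>'p] by (simp add: normalised_iff)
  obtain U where U: "reversible T A A U" "\<Gamma>' = (U \<otimes> idt T R) \<odot> \<Gamma>"
    using purification_unique_left[OF \<Gamma>(1,2) \<Gamma>'n \<Gamma>'p mg] .
  show ?thesis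
  proof (rule that[OF U(1)])
    fix x assume x: "x \<in> F"
    have xs: "x \<in> states T A" using F(3)[OF x] normalised_states by blast
    obtain D p where D: "D \<in> effects T R" "0 < p" "(idt T A \<otimes> D) \<odot> \<Gamma> = p *\<^sub>R x"
      using steering_face[OF \<Gamma>(1,2), of \<I> x] F(3)[OF x] \<omega>(2)[OF x] marginal_triv[OF xs] \<Gamma>(3)
      by (metis cmpst_triv_right)
    have "(idt T A \<otimes> D) \<odot> ((f \<otimes> idt T R) \<odot> \<Gamma>) = p *\<^sub>R (f \<odot> x)" if f: "f \<in> trafos T A A" for f
    proof -
      have "(idt T A \<otimes> D) \<odot> ((f \<otimes> idt T R) \<odot> \<Gamma>) = (f \<otimes> idt T \<I>) \<odot> ((idt T A \<otimes> D) \<odot> \<Gamma>)"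
        using par_act_comm[OF \<Gamma>s f D(1)] by simp
      then show ?thesis by (simp add: par_triv_right[OF f] D(3) bilin)
    qed
    then have "p *\<^sub>R (U \<odot> x) = p *\<^sub>R (Q \<odot> x)"
      using U(2) Qm reversible_trafos[OF U(1)] by (metis \<Gamma>'_def)
    then show "U \<odot> x = Q \<odot> x" using D(2) by simp
  qed
qed

section \<open>Exchanges, permutations and strong symmetry\<close>

lemma pure_maximalD:
  assumes "pure_maximal T A \<phi>s"
  shows "perf_dist T A \<phi>s" "\<phi>s \<noteq> []"
    "\<And>i. i < length \<phi>s \<Longrightarrow> normalised T A (\<phi>s ! i)" "\<And>i. i < length \<phi>s \<Longrightarrow> pure T \<I> A (\<phi>s ! i)"
    "\<And>i. i < length \<phi>s \<Longrightarrow> \<phi>s ! i \<in> states T A" "\<And>\<rho>. \<not> perf_dist T A (\<phi>s @ [\<rho>])"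
  using assms perf_dist_nonempty perf_dist_normalised[of A \<phi>s] normalised_states
  by (auto simp: pure_maximal_def)

text \<open>
  Feeding \<open>\<psi>\<^sub>0\<close> into the exchange and postselecting on \<open>\<phi>\<^sub>0\<close> gives a pure transformation that acts
  deterministically on the \<open>\<phi>\<^sub>i\<close>.
\<close>

lemma conversion_from_exchange:
  assumes \<phi>: "pure_maximal T A \<phi>s" and \<psi>: "pure_maximal T A \<psi>s" and le: "length \<phi>s \<le> length \<psi>s"
    and W: "reversible T (A \<diamondop> A) (A \<diamondop> A) W"
      "\<And>i. i < length \<phi>s \<Longrightarrow> W \<odot> (\<phi>s ! i \<otimes> \<psi>s ! 0) = \<phi>s ! 0 \<otimes> \<psi>s ! i"
  obtains U where "reversible T A A U" "map (\<lambda>\<phi>. U \<odot> \<phi>) \<phi>s = \<psi>s"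
proof -
  note \<phi>D = pure_maximalD[OF \<phi>] and \<psi>D = pure_maximalD[OF \<psi>]
  have d: "0 < length \<phi>s" "0 < length \<psi>s" using \<phi>D(2) \<psi>D(2) by auto
  obtain a where a: "pure T A \<I> a" "val (a \<odot> \<phi>s ! 0) = 1" using sharp_effect \<phi>D(3,4) d by metis
  note as = pure_trafos[OF a(1)]
  define P where "P = idt T A \<otimes> \<psi>s ! 0"
  have P: "pure T A (A \<diamondop> A) P"
    unfolding P_def using pure_par[OF pure_idt[of A] \<psi>D(4)[OF d(2)]] by (simp add: cmpst_triv_right)
  have aI: "pure T (A \<diamondop> A) A (a \<otimes> idt T A)" using pure_par[OF a(1) pure_idt[of A]] by (simp add: cmpst_triv_left)
  define Q where "Q = (a \<otimes> idt T A) \<odot> (W \<odot> P)"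
  have WP: "pure T A (A \<diamondop> A) (W \<odot> P)" by (rule pure_sq[OF P pure_reversible[OF W(1)]])
  have Q: "pure T A A Q" unfolding Q_def by (rule pure_sq[OF WP aI])
  have Q\<phi>: "Q \<odot> \<phi>s ! i = \<psi>s ! i" if i: "i < length \<phi>s" for i
  proof -
    note s = \<phi>D(5)[OF i]
    have i': "i < length \<psi>s" using i le by simp
    have "Q \<odot> \<phi>s ! i = (a \<otimes> idt T A) \<odot> (W \<odot> (P \<odot> \<phi>s ! i))"
      unfolding Q_def using sq_assoc[OF s pure_trafos[OF WP] pure_trafos[OF aI]]
        sq_assoc[OF s pure_trafos[OF P] reversible_trafos[OF W(1)]] by simp
    also have "P \<odot> \<phi>s ! i = \<phi>s ! i \<otimes> \<psi>s ! 0" unfolding P_def by (rule append_state[OF s \<psi>D(5)[OF d(2)]])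
    also have "W \<odot> \<dots> = \<phi>s ! 0 \<otimes> \<psi>s ! i" by (rule W(2)[OF i])
    also have "(a \<otimes> idt T A) \<odot> \<dots> = \<psi>s ! i"
      using effect_left_product[OF as \<phi>D(5)[OF d(1)] idt_trafos \<psi>D(5)[OF i']] a(2) sq_idt_left[OF \<psi>D(5)[OF i']] by simp
    finally show ?thesis .
  qed
  obtain U where U: "reversible T A A U" "\<And>x. x \<in> set \<phi>s \<Longrightarrow> U \<odot> x = Q \<odot> x"
  proof (rule deterministic_pure_reversible[OF Q])
    show "wt A (Q \<odot> x) = 1" if x: "x \<in> set \<phi>s" for x
    proof -
      obtain i where "i < length \<phi>s" "x = \<phi>s ! i" using x by (auto simp: in_set_conv_nth)
      then show ?thesis using Q\<phi> \<psi>D(3)[of i] le by (simp add: normalised_iff)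
    qed
  qed (use \<phi>D(2) perf_dist_normalised[OF \<phi>D(1)] in auto)
  have U\<phi>: "U \<odot> \<phi>s ! i = \<psi>s ! i" if "i < length \<phi>s" for i using that U(2) Q\<phi> by simp
  \<comment> \<open>Otherwise the inverse of \<open>U\<close> turns one further element of
    \<open>\<psi>s\<close> into a state that extends \<open>\<phi>s\<close>.\<close>
  have "length \<phi>s = length \<psi>s"
  proof (rule ccontr)
    assume "length \<phi>s \<noteq> length \<psi>s"
    then have lt: "length \<phi>s < length \<psi>s" using le by simp
    let ?n = "length \<phi>s"
    obtain V where V: "reversible T A A V" "V \<odot> U = idt T A" using reversible_inverse[OF U(1)] by blast
    have "perf_dist T A (map (\<lambda>i. \<psi>s ! i) [0..<Suc ?n])" using lt by (intro perf_dist_select[OF \<psi>D(1)]) auto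
    from perf_dist_reversible[OF this V(1)]
    have "perf_dist T A (map (\<lambda>\<rho>. V \<odot> \<rho>) (map (\<lambda>i. \<psi>s ! i) [0..<Suc ?n]))" .
    moreover have "map (\<lambda>\<rho>. V \<odot> \<rho>) (map (\<lambda>i. \<psi>s ! i) [0..<Suc ?n]) = \<phi>s @ [V \<odot> \<psi>s ! ?n]"
    proof (rule nth_equalityI)
      fix i assume "i < length (map (\<lambda>\<rho>. V \<odot> \<rho>) (map (\<lambda>i. \<psi>s ! i) [0..<Suc ?n]))"
      then have i: "i < Suc ?n" by simp
      show "map (\<lambda>\<rho>. V \<odot> \<rho>) (map (\<lambda>i. \<psi>s ! i) [0..<Suc ?n]) ! i = (\<phi>s @ [V \<odot> \<psi>s ! ?n]) ! i"
      proof (cases "i < ?n")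
        case True
        have "V \<odot> (U \<odot> \<phi>s ! i) = \<phi>s ! i"
          by (rule sq_inverse_cancel[OF U(1) V(2) reversible_trafos[OF V(1)] \<phi>D(5)[OF True]])
        then show ?thesis using True U\<phi>[OF True] by (simp add: nth_append del: upt_Suc)
      next
        case False
        then have "i = ?n" using i by simp
        then show ?thesis by (simp add: nth_append del: upt_Suc)
      qed
    qed simp
    ultimately show False using \<phi>D(6) by metis
  qed
  then have "map (\<lambda>\<phi>. U \<odot> \<phi>) \<phi>s = \<psi>s" using U\<phi> by (intro nth_equalityI) auto
  with U(1) show ?thesis by (rule that)
qed

text \<open>Equality of the two cardinalities is a result and not known beforehand. So the shorter
  list is converted into the longer one, and the channel is inverted if the other direction is asked
  for.\<close>

lemma strong_symmetryI:
  assumes "\<And>A \<phi>s \<psi>s. pure_maximal T A \<phi>s \<Longrightarrow> pure_maximal T A \<psi>s \<Longrightarrow> length \<phi>s \<le> length \<psi>s \<Longrightarrow>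
    \<exists>W. reversible T (A \<diamondop> A) (A \<diamondop> A) W \<and> (\<forall>i < length \<phi>s. W \<odot> (\<phi>s ! i \<otimes> \<psi>s ! 0) = \<phi>s ! 0 \<otimes> \<psi>s ! i)"
  shows "strong_symmetry T"
  unfolding strong_symmetry_def
proof (intro allI impI)
  fix A \<phi>s \<psi>s assume m: "pure_maximal T A \<phi>s \<and> pure_maximal T A \<psi>s"
  have conv: "\<exists>U. reversible T A A U \<and> map (\<lambda>\<phi>. U \<odot> \<phi>) \<alpha>s = \<beta>s"
    if ab: "pure_maximal T A \<alpha>s" "pure_maximal T A \<beta>s" "length \<alpha>s \<le> length \<beta>s" for \<alpha>s \<beta>s
  proof -
    obtain W where "reversible T (A \<diamondop> A) (A \<diamondop> A) W" "\<And>i. i < length \<alpha>s \<Longrightarrow> W \<odot> (\<alpha>s ! i \<otimes> \<beta>s ! 0) = \<alpha>s ! 0 \<otimes> \<beta>s ! i"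
      using assms[OF ab] by blast
    from conversion_from_exchange[OF ab this] show ?thesis by blast
  qed
  show "\<exists>U. reversible T A A U \<and> map (\<lambda>\<phi>. U \<odot> \<phi>) \<phi>s = \<psi>s"
  proof (cases "length \<phi>s \<le> length \<psi>s")
    case True
    then show ?thesis using conv m by blast
  next
    case False
    then obtain U where U: "reversible T A A U" "map (\<lambda>\<phi>. U \<odot> \<phi>) \<psi>s = \<phi>s" using conv[of \<psi>s \<phi>s] m by auto
    obtain V where V: "reversible T A A V" "V \<odot> U = idt T A" using reversible_inverse[OF U(1)] by blast
    have "V \<odot> (U \<odot> \<psi>) = \<psi>" if "\<psi> \<in> set \<psi>s" for \<psi>
      using that m perf_dist_normalised normalised_states pure_maximalD(1)
      by (intro sq_inverse_cancel[OF U(1) V(2) reversible_trafos[OF V(1)]]) blast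
    then have "map (\<lambda>\<phi>. V \<odot> \<phi>) \<phi>s = \<psi>s" unfolding U(2)[symmetric] by (simp add: map_idI)
    then show ?thesis using V(1) by blast
  qed
qed

lemma permutability_imp_strong_symmetry:
  assumes "permutability T"
  shows "strong_symmetry T"
proof (rule strong_symmetryI)
  fix A \<phi>s \<psi>s assume \<phi>: "pure_maximal T A \<phi>s" and \<psi>: "pure_maximal T A \<psi>s" and le: "length \<phi>s \<le> length \<psi>s"
  note \<phi>D = pure_maximalD[OF \<phi>] and \<psi>D = pure_maximalD[OF \<psi>]
  let ?d = "length \<phi>s"
  have d: "0 < ?d" using \<phi>D(2) by simp
  \<comment> \<open>The column \<open>(i, 0)\<close> followed by the row \<open>(0, i)\<close>. The
    corner belongs to both and is listed once, whence the length \<open>2 * ?d - 1\<close>.\<close>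
  define ps where "ps = map (\<lambda>i. (i, 0::nat)) [0..<?d] @ map (\<lambda>i. (0::nat, Suc i)) [0..<?d - 1]"
  define L where "L = map (\<lambda>(i, j). \<phi>s ! i \<otimes> \<psi>s ! j) ps"
  have lenL: "length L = 2 * ?d - 1" using d by (simp add: L_def ps_def)
  have bound: "i < length \<phi>s \<and> j < length \<psi>s" if "(i, j) \<in> set ps" for i j
    using that d le by (auto simp: ps_def)
  have dp: "distinct ps" by (auto simp: ps_def distinct_map inj_on_def)
  have "ps \<noteq> []" using d by (simp add: ps_def)
  then have pd: "perf_dist T (A \<diamondop> A) L"
    unfolding L_def by (rule perf_dist_product[OF \<phi>D(1) \<psi>D(1) dp _ bound])
  have pure: "\<forall>\<rho>\<in>set L. pure T \<I> (A \<diamondop> A) \<rho>"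
    unfolding L_def using bound \<phi>D(4) \<psi>D(4) by (auto intro!: pure_states_par)
  obtain N where N: "pure_maximal T (A \<diamondop> A) (L @ N)" using perf_dist_extend[OF pd pure] .
  \<comment> \<open>An involution exchanging position \<open>k\<close>, which holds
    \<open>(k, 0)\<close>, with position \<open>k + (?d - 1)\<close>, which holds
    \<open>(0, k)\<close>. The corner and the added states \<open>N\<close> stay fixed.\<close>
  define \<pi> where "\<pi> k = (if 0 < k \<and> k < ?d then k + (?d - 1)
      else if ?d \<le> k \<and> k < 2 * ?d - 1 then k - (?d - 1) else k)" for k
  have inv: "\<pi> (\<pi> k) = k" for k unfolding \<pi>_def by auto
  have "\<pi> permutes {..<length (L @ N)}"
    unfolding permutes_def
  proof (intro conjI allI impI)
    fix k assume "k \<notin> {..<length (L @ N)}"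
    then show "\<pi> k = k" using lenL d by (auto simp: \<pi>_def)
  next
    fix y show "\<exists>!x. \<pi> x = y" using inv by metis
  qed
  then obtain W where W: "reversible T (A \<diamondop> A) (A \<diamondop> A) W"
    "\<And>i. i < length (L @ N) \<Longrightarrow> W \<odot> (L @ N) ! i = (L @ N) ! \<pi> i"
    using assms N unfolding permutability_def by blast
  have "W \<odot> (\<phi>s ! i \<otimes> \<psi>s ! 0) = \<phi>s ! 0 \<otimes> \<psi>s ! i" if i: "i < ?d" for i
  proof -
    have 1: "(L @ N) ! i = \<phi>s ! i \<otimes> \<psi>s ! 0" using i lenL by (simp add: L_def ps_def nth_append)
    have 2: "(L @ N) ! \<pi> i = \<phi>s ! 0 \<otimes> \<psi>s ! i"
    proof (cases "i = 0")
      case True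
      then show ?thesis using 1 d by (simp add: \<pi>_def)
    next
      case False
      then obtain j where j: "i = Suc j" by (cases i) auto
      have \<pi>i: "\<pi> i = ?d + j" using i j by (simp add: \<pi>_def)
      have jl: "j < ?d - 1" using i j by simp
      have "(L @ N) ! (?d + j) = L ! (?d + j)" using lenL jl by (intro nth_append_left) linarith
      also have "L ! (?d + j) = \<phi>s ! 0 \<otimes> \<psi>s ! i" using jl by (simp add: j L_def ps_def nth_append)
      finally show ?thesis by (simp only: \<pi>i)
    qed
    show ?thesis using W(2)[of i] i lenL by (simp add: 1 2)
  qed
  then show "\<exists>W. reversible T (A \<diamondop> A) (A \<diamondop> A) W \<and> (\<forall>i < length \<phi>s. W \<odot> (\<phi>s ! i \<otimes> \<psi>s ! 0) = \<phi>s ! 0 \<otimes> \<psi>s ! i)"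
    using W(1) by blast
qed

text \<open>A permuted maximal list is again maximal: the inverse permutation fixes the index of an
  added state and so turns an extension of the permuted list into one of the original.\<close>

lemma strong_symmetry_imp_permutability:
  assumes "strong_symmetry T"
  shows "permutability T"
  unfolding permutability_def
proof (intro allI impI)
  fix A \<phi>s \<pi> assume a: "pure_maximal T A \<phi>s \<and> \<pi> permutes {..<length \<phi>s}"
  then have \<phi>: "pure_maximal T A \<phi>s" and \<pi>: "\<pi> permutes {..<length \<phi>s}" by auto
  note \<phi>D = pure_maximalD[OF \<phi>]
  let ?n = "length \<phi>s"
  have \<pi>lt: "\<pi> i < ?n \<longleftrightarrow> i < ?n" for i using permutes_in_image[OF \<pi>] by simp
  define \<psi>s where "\<psi>s = map (\<lambda>i. \<phi>s ! \<pi> i) [0..<?n]"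
  have "perf_dist T A \<psi>s"
    unfolding \<psi>s_def using permutes_inj_on[OF \<pi>] \<pi>lt \<phi>D(2) by (intro perf_dist_select[OF \<phi>D(1)]) auto
  moreover have "\<forall>\<psi>\<in>set \<psi>s. pure T \<I> A \<psi>" using \<phi>D(4) \<pi>lt by (auto simp: \<psi>s_def)
  moreover have "\<not> perf_dist T A (\<psi>s @ [\<rho>])" for \<rho>
  proof
    assume pd: "perf_dist T A (\<psi>s @ [\<rho>])"
    let ?g = "inv \<pi>"
    have g: "?g permutes {..<?n}" by (rule permutes_inv[OF \<pi>])
    then have gl: "?g i < ?n \<longleftrightarrow> i < ?n" for i using permutes_in_image[OF g] by simp
    have gn: "?g ?n = ?n" using permutes_not_in[OF g] by simp
    have "perf_dist T A (map (\<lambda>i. (\<psi>s @ [\<rho>]) ! ?g i) [0..<Suc ?n])"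
    proof (rule perf_dist_select[OF pd])
      show "inj_on ?g {..<Suc ?n}" using permutes_inj_on[OF g] .
      show "?g i < length (\<psi>s @ [\<rho>])" if "i < Suc ?n" for i
        using that gl[of i] gn by (cases "i = ?n") (auto simp: \<psi>s_def)
    qed simp
    moreover have "map (\<lambda>i. (\<psi>s @ [\<rho>]) ! ?g i) [0..<Suc ?n] = \<phi>s @ [\<rho>]"
    proof (rule nth_equalityI)
      fix i assume "i < length (map (\<lambda>i. (\<psi>s @ [\<rho>]) ! ?g i) [0..<Suc ?n])"
      then have "i < Suc ?n" by simp
      then show "map (\<lambda>i. (\<psi>s @ [\<rho>]) ! ?g i) [0..<Suc ?n] ! i = (\<phi>s @ [\<rho>]) ! i"
        using gl[of i] gn permutes_inverses(1)[OF \<pi>]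
        by (cases "i = ?n") (auto simp: nth_append \<psi>s_def simp del: upt_Suc)
    qed simp
    ultimately show False using \<phi>D(6) by metis
  qed
  ultimately have "pure_maximal T A \<psi>s" by (auto simp: pure_maximal_def)
  then obtain U where U: "reversible T A A U" "map (\<lambda>\<phi>. U \<odot> \<phi>) \<phi>s = \<psi>s"
    using assms \<phi> unfolding strong_symmetry_def by blast
  have "U \<odot> \<phi>s ! i = \<phi>s ! \<pi> i" if "i < ?n" for i
    using arg_cong[OF U(2), of "\<lambda>l. l ! i"] that by (simp add: \<psi>s_def)
  then show "\<exists>U. reversible T A A U \<and> (\<forall>i < length \<phi>s. U \<odot> \<phi>s ! i = \<phi>s ! \<pi> i)" using U(1) by blast
qed

text \<open>Controllability evaluated on one input state per control value; the \<open>i\<close>-th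
  channel may be any that takes \<open>\<sigma> i\<close> to \<open>\<tau> i\<close>.\<close>

lemma controlled_family:
  assumes "reversible_controllability T" "pure_maximal T A \<alpha>s"
    "\<And>i. i < length \<alpha>s \<Longrightarrow> \<exists>U. reversible T B B U \<and> \<tau> i = U \<odot> \<sigma> i" "\<And>i. i < length \<alpha>s \<Longrightarrow> \<sigma> i \<in> states T B"
  obtains W where "reversible T (A \<diamondop> B) (A \<diamondop> B) W"
    "\<And>i. i < length \<alpha>s \<Longrightarrow> W \<odot> (\<alpha>s ! i \<otimes> \<sigma> i) = \<alpha>s ! i \<otimes> \<tau> i"
proof -
  obtain U where U: "\<And>i. i < length \<alpha>s \<Longrightarrow> reversible T B B (U i) \<and> \<tau> i = U i \<odot> \<sigma> i"
    using assms(3) by metis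
  let ?Us = "map U [0..<length \<alpha>s]"
  have "\<forall>V \<in> set ?Us. reversible T B B V" using U by auto
  then obtain W where W: "reversible T (A \<diamondop> B) (A \<diamondop> B) W"
    "\<And>i. i < length \<alpha>s \<Longrightarrow> W \<odot> (\<alpha>s ! i \<otimes> idt T B) = \<alpha>s ! i \<otimes> ?Us ! i"
    using assms(1,2) unfolding reversible_controllability_def
    by (metis diff_zero length_map length_upt)
  show ?thesis
  proof (rule that[OF W(1)])
    fix i assume i: "i < length \<alpha>s"
    note s = assms(4)[OF i] and a = pure_maximalD(5)[OF assms(2) i]
    have Ui: "U i \<in> trafos T B B" using U[OF i] reversible_trafos by blast
    have "W \<odot> (\<alpha>s ! i \<otimes> \<sigma> i) = W \<odot> ((\<alpha>s ! i \<otimes> idt T B) \<odot> \<sigma> i)" by (simp add: prepend_state[OF s a])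
    also have "\<dots> = (\<alpha>s ! i \<otimes> U i) \<odot> \<sigma> i"
      using sq_assoc[OF s state_left_trafos[OF a] reversible_trafos[OF W(1)]] W(2)[OF i] i by simp
    also have "\<dots> = \<alpha>s ! i \<otimes> \<tau> i"
      using interchange[OF idt_trafos a s Ui] U[OF i] by (simp add: par_triv_left[OF s] sq_idt_right[OF a])
    finally show "W \<odot> (\<alpha>s ! i \<otimes> \<sigma> i) = \<alpha>s ! i \<otimes> \<tau> i" .
  qed
qed

text \<open>Two controlled operations with control and target interchanged: the first writes the
  label \<open>i\<close> into the second system, the other uses this record to reset the first
  system.\<close>

lemma reversible_controllability_imp_strong_symmetry:
  assumes "reversible_controllability T"
  shows "strong_symmetry T"
proof (rule strong_symmetryI)
  fix A \<phi>s \<psi>s assume \<phi>: "pure_maximal T A \<phi>s" and \<psi>: "pure_maximal T A \<psi>s" and le: "length \<phi>s \<le> length \<psi>s"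
  note \<phi>D = pure_maximalD[OF \<phi>] and \<psi>D = pure_maximalD[OF \<psi>]
  let ?d = "length \<phi>s"
  have d: "0 < ?d" "0 < length \<psi>s" using \<phi>D(2) \<psi>D(2) by auto
  \<comment> \<open>\<open>\<psi>s\<close> may be longer than \<open>\<phi>s\<close>, but a
    controlled family needs an input state for every control value. Beyond \<open>?d\<close> the
    default is already the desired output.\<close>
  define \<xi> where "\<xi> i = (if i < ?d then \<phi>s ! i else \<phi>s ! 0)" for i
  have \<xi>: "normalised T A (\<xi> i)" "pure T \<I> A (\<xi> i)" for i using \<phi>D(3,4) d by (auto simp: \<xi>_def)
  have tr: "\<exists>U. reversible T A A U \<and> \<beta> = U \<odot> \<alpha>"
    if "normalised T A \<alpha>" "pure T \<I> A \<alpha>" "normalised T A \<beta>" "pure T \<I> A \<beta>" for \<alpha> \<beta>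
    using pure_states_transitive[OF that] by blast
  have X: "\<exists>X. reversible T (A \<diamondop> A) (A \<diamondop> A) X \<and> (\<forall>i < ?d. X \<odot> (\<phi>s ! i \<otimes> \<psi>s ! 0) = \<phi>s ! i \<otimes> \<psi>s ! i)"
  proof (rule controlled_family[OF assms \<phi>, of A "\<lambda>i. \<psi>s ! i" "\<lambda>_. \<psi>s ! 0"])
    show "\<exists>U. reversible T A A U \<and> \<psi>s ! i = U \<odot> \<psi>s ! 0" if "i < ?d" for i
      using that le d by (intro tr \<psi>D(3,4)) auto
  qed (use \<psi>D(5) d in blast)+
  have Y: "\<exists>Y. reversible T (A \<diamondop> A) (A \<diamondop> A) Y \<and> (\<forall>i < length \<psi>s. Y \<odot> (\<psi>s ! i \<otimes> \<xi> i) = \<psi>s ! i \<otimes> \<phi>s ! 0)"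
  proof (rule controlled_family[OF assms \<psi>, of A "\<lambda>_. \<phi>s ! 0" \<xi>])
    show "\<exists>U. reversible T A A U \<and> \<phi>s ! 0 = U \<odot> \<xi> i" for i
      using d by (intro tr \<xi> \<phi>D(3,4)) auto
  qed (use \<xi> normalised_states in blast)+
  obtain X where X: "reversible T (A \<diamondop> A) (A \<diamondop> A) X"
    "\<And>i. i < ?d \<Longrightarrow> X \<odot> (\<phi>s ! i \<otimes> \<psi>s ! 0) = \<phi>s ! i \<otimes> \<psi>s ! i"
    using X by blast
  obtain Y where Y: "reversible T (A \<diamondop> A) (A \<diamondop> A) Y"
    "\<And>i. i < length \<psi>s \<Longrightarrow> Y \<odot> (\<psi>s ! i \<otimes> \<xi> i) = \<psi>s ! i \<otimes> \<phi>s ! 0"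
    using Y by blast
  let ?S = "swp T A A"
  note m = reversible_trafos[OF X(1)] reversible_trafos[OF Y(1)] swp_trafos[of A A]
  define W where "W = ?S \<odot> (Y \<odot> (?S \<odot> X))"
  have "W \<odot> (\<phi>s ! i \<otimes> \<psi>s ! 0) = \<phi>s ! 0 \<otimes> \<psi>s ! i" if i: "i < ?d" for i
  proof -
    have i': "i < length \<psi>s" using i le by simp
    note s = states_par[OF \<phi>D(5)[OF i] \<psi>D(5)[OF d(2)]]
    note m1 = sq_trafos[OF m(1,3)] note m2 = sq_trafos[OF m1 m(2)]
    have "W \<odot> (\<phi>s ! i \<otimes> \<psi>s ! 0) = ?S \<odot> (Y \<odot> (?S \<odot> (X \<odot> (\<phi>s ! i \<otimes> \<psi>s ! 0))))"
      unfolding W_def using sq_assoc[OF s m2 m(3)] sq_assoc[OF s m1 m(2)] sq_assoc[OF s m(1,3)] by simp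
    also have "X \<odot> (\<phi>s ! i \<otimes> \<psi>s ! 0) = \<phi>s ! i \<otimes> \<psi>s ! i" by (rule X(2)[OF i])
    also have "?S \<odot> \<dots> = \<psi>s ! i \<otimes> \<phi>s ! i" by (rule swp_product[OF \<phi>D(5)[OF i] \<psi>D(5)[OF i']])
    also have "Y \<odot> \<dots> = \<psi>s ! i \<otimes> \<phi>s ! 0" using Y(2)[OF i'] i by (simp add: \<xi>_def)
    also have "?S \<odot> \<dots> = \<phi>s ! 0 \<otimes> \<psi>s ! i" by (rule swp_product[OF \<psi>D(5)[OF i'] \<phi>D(5)[OF d(1)]])
    finally show ?thesis .
  qed
  moreover have "reversible T (A \<diamondop> A) (A \<diamondop> A) W"
    unfolding W_def by (rule reversible_sq[OF reversible_sq[OF reversible_sq[OF X(1) reversible_swp] Y(1)] reversible_swp])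
  ultimately show "\<exists>W. reversible T (A \<diamondop> A) (A \<diamondop> A) W \<and> (\<forall>i < length \<phi>s. W \<odot> (\<phi>s ! i \<otimes> \<psi>s ! 0) = \<phi>s ! 0 \<otimes> \<psi>s ! i)"
    by blast
qed

end

subsection \<open>Compactness and orthogonal sharp effects\<close>

context causal_opt
begin

text \<open>On such vectors \<open>val\<close> loses no information, so real functionals can
  separate them.\<close>

lemma pair_span:
  assumes a: "a \<in> effects T A" and w: "w \<in> span (states T A)"
  shows "a \<odot> w = val (a \<odot> w) *\<^sub>R idt T \<I>"
  using w
proof (induction rule: span_induct_alt)
  case base
  then show ?case by (simp add: bilin val_simps)
next
  case (step c v y)
  have "a \<odot> v = val (a \<odot> v) *\<^sub>R idt T \<I>" by (rule val_num[OF a step(1)])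
  then have "a \<odot> (c *\<^sub>R v + y) = c *\<^sub>R (val (a \<odot> v) *\<^sub>R idt T \<I>) + val (a \<odot> y) *\<^sub>R idt T \<I>"
    using step(2) by (metis sq_add_right sq_scale_right)
  then show ?case by (simp add: bilin val_simps scaleR_left_distrib)
qed

text \<open>The separation axioms recast as a separating family of real functionals, the form that
  \<open>coord_tends_extract\<close> requires.\<close>

lemma trafos_separated:
  assumes v: "v \<in> span (trafos T A B)"
    and z: "\<And>S \<rho> a. \<rho> \<in> states T (A \<diamondop> S) \<Longrightarrow> a \<in> effects T (B \<diamondop> S) \<Longrightarrow> val (a \<odot> ((v \<otimes> idt T S) \<odot> \<rho>)) = 0"
  shows "v = 0"
proof (rule trans_eqI[OF v span_zero])
  fix S \<rho> assume \<rho>: "\<rho> \<in> states T (A \<diamondop> S)"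
  have sp: "(v \<otimes> idt T S) \<odot> \<rho> \<in> span (states T (B \<diamondop> S))"
    using v
  proof (induction rule: span_induct_alt)
    case base
    then show ?case by (simp add: bilin span_zero)
  next
    case (step c f y)
    have "(f \<otimes> idt T S) \<odot> \<rho> \<in> states T (B \<diamondop> S)"
      by (rule sq_trafos[OF \<rho> par_trafos[OF step(1) idt_trafos]])
    then show ?case using step(2) by (simp add: bilin span_add span_scale span_base)
  qed
  have "(v \<otimes> idt T S) \<odot> \<rho> = 0"
  proof (rule states_eqI[OF sp span_zero])
    fix a assume a: "a \<in> effects T (B \<diamondop> S)"
    show "a \<odot> ((v \<otimes> idt T S) \<odot> \<rho>) = a \<odot> 0" using pair_span[OF a sp] z[OF \<rho> a] by (simp add: bilin)
  qed
  then show "(v \<otimes> idt T S) \<odot> \<rho> = (0 \<otimes> idt T S) \<odot> \<rho>" by (simp add: bilin)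
qed

lemma linear_compose_val: "linear (\<lambda>v. val (a \<odot> ((v \<otimes> s) \<odot> \<rho>)))"
  by (rule linearI) (simp_all add: bilin val_simps)

text \<open>On transformations the separating functionals are probabilities, hence bounded by one;
  this replaces a norm bound.\<close>

lemma trafos_compact:
  assumes "\<And>n. f n \<in> trafos T A B"
  obtains r l where "strict_mono (r :: nat \<Rightarrow> nat)" "coord_tends (f \<circ> r) l" "l \<in> trafos T A B"
proof -
  obtain E where E: "E \<subseteq> trafos T A B" "independent E" "trafos T A B \<subseteq> span E"
    using maximal_independent_subset by metis
  obtain S where "finite S" "trafos T A B \<subseteq> span S" using finite_dim by blast
  then have fin: "finite E" using independent_span_bound[of S E] E by (meson subset_trans)
  define F where "F = (\<Union>S. {(\<lambda>v. val (a \<odot> ((v \<otimes> idt T S) \<odot> \<rho>))) | a \<rho>.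
      \<rho> \<in> states T (A \<diamondop> S) \<and> a \<in> effects T (B \<diamondop> S)})"
  have "\<exists>r l. strict_mono (r :: nat \<Rightarrow> nat) \<and> coord_tends (f \<circ> r) l"
  proof (rule coord_tends_extract[OF fin, of F])
    show "linear g" if "g \<in> F" for g using that linear_compose_val by (auto simp: F_def)
    show "v = 0" if v: "v \<in> span E" "\<And>g. g \<in> F \<Longrightarrow> g v = 0" for v
    proof (rule trafos_separated)
      show "v \<in> span (trafos T A B)" using v(1) span_mono[OF E(1)] by blast
    qed (use v(2) in \<open>auto simp: F_def\<close>)
    show "f n \<in> span E" for n using assms E(3) by blast
    show "\<exists>M. \<forall>n. \<bar>g (f n)\<bar> \<le> M" if gF: "g \<in> F" for g
    proof -
      obtain S a \<rho> where g: "g = (\<lambda>v. val (a \<odot> ((v \<otimes> idt T S) \<odot> \<rho>)))" "\<rho> \<in> states T (A \<diamondop> S)" "a \<in> effects T (B \<diamondop> S)"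
        using gF unfolding F_def by blast
      have "\<bar>g (f n)\<bar> \<le> 1" for n
        using val_bounds[OF g(3) sq_trafos[OF g(2) par_trafos[OF assms idt_trafos]], of n] by (simp add: g(1))
      then show ?thesis by blast
    qed
  qed
  then obtain r l where r: "strict_mono (r :: nat \<Rightarrow> nat)" "coord_tends (f \<circ> r) l" by blast
  \<comment> \<open>Coordinatewise convergence implies convergence in norm, so
    \<open>closed_trans\<close> catches the limit.\<close>
  have "(\<lambda>n. id ((f \<circ> r) n)) \<longlonglongrightarrow> id l" by (rule coord_tends_linear[OF r(2) linear_id])
  then have "(f \<circ> r) \<longlonglongrightarrow> l" by (simp add: o_def)
  then have "l \<in> trafos T A B" using closed_sequentially[OF closed_trans, of "f \<circ> r" A B l] assms by simp
  with r show ?thesis by (rule that)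
qed

lemma coord_tends_sq_const:
  assumes "coord_tends x l" "coord_tends y m" "\<And>n. x n \<odot> y n = c"
  shows "l \<odot> m = c"
proof -
  have "(\<lambda>n. x n \<odot> y n) \<longlonglongrightarrow> l \<odot> m" by (rule coord_tends_bilinear[OF assms(1,2) bilinear_sq])
  then show ?thesis using assms(3) LIMSEQ_unique tendsto_const by fastforce
qed

text \<open>The inverses are carried along: on a common subsequence both converge, and the equations
  for inverses and for determinism pass to the limit by bilinearity.\<close>

lemma reversible_compact:
  assumes "\<And>n. reversible T A B (U n)"
  obtains r W where "strict_mono (r :: nat \<Rightarrow> nat)" "coord_tends (U \<circ> r) W" "reversible T A B W"
proof -
  have "\<exists>V. \<forall>n. channel T B A (V n) \<and> V n \<odot> U n = idt T A \<and> U n \<odot> V n = idt T B"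
    using assms unfolding reversible_def by metis
  then obtain V where V: "\<And>n. channel T B A (V n)" "\<And>n. V n \<odot> U n = idt T A" "\<And>n. U n \<odot> V n = idt T B" by blast
  obtain r W where r: "strict_mono (r :: nat \<Rightarrow> nat)" "coord_tends (U \<circ> r) W" "W \<in> trafos T A B"
    using trafos_compact[of U A B] reversible_trafos[OF assms] by blast
  obtain q X where q: "strict_mono (q :: nat \<Rightarrow> nat)" "coord_tends ((V \<circ> r) \<circ> q) X" "X \<in> trafos T B A"
    using trafos_compact[of "V \<circ> r" B A] channel_trafos[OF V(1)] by auto
  note Wq = coord_tends_subseq[OF r(2) q(1)]
  have XW: "X \<odot> W = idt T A" by (rule coord_tends_sq_const[OF q(2) Wq]) (simp add: V)
  have WX: "W \<odot> X = idt T B" by (rule coord_tends_sq_const[OF Wq q(2)]) (simp add: V)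
  have const: "coord_tends (\<lambda>_. c) c" for c :: 't using coord_tends_scale[of "\<lambda>_. 1" 1 c] by simp
  have "unit_effect T B \<odot> W = unit_effect T A"
    by (rule coord_tends_sq_const[OF const r(2)]) (simp add: unit_channel[OF reversible_channel[OF assms]])
  moreover have "unit_effect T A \<odot> X = unit_effect T B"
    by (rule coord_tends_sq_const[OF const q(2)]) (simp add: unit_channel[OF V(1)])
  ultimately have "reversible T A B W"
    unfolding reversible_def using XW WX channel_iff r(3) q(3) by blast
  moreover have "strict_mono (r \<circ> q)" by (rule strict_mono_o[OF r(1) q(1)])
  ultimately show ?thesis using that[of "r \<circ> q" W] Wq by (simp add: o_assoc)
qed

lemma pair_par:
  assumes "\<sigma> \<in> states T (A \<diamondop> B)" "a \<in> effects T A" "b \<in> effects T B"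
  shows "(a \<otimes> b) \<odot> \<sigma> = b \<odot> ((a \<otimes> idt T B) \<odot> \<sigma>)" "(a \<otimes> b) \<odot> \<sigma> = a \<odot> ((idt T A \<otimes> b) \<odot> \<sigma>)"
  using par_act_comm[OF assms] assms(2,3) by (simp_all add: par_triv_left par_triv_right)

end

context sharp_theory_with_purification
begin

lemma pure_state_normalise:
  assumes "pure T \<I> A \<rho>" "0 < wt A \<rho>"
  obtains \<sigma> where "normalised T A \<sigma>" "pure T \<I> A \<sigma>" "\<rho> = wt A \<rho> *\<^sub>R \<sigma>"
proof -
  note s = pure_trafos[OF assms(1)]
  have "\<rho> \<noteq> 0" using assms(2) by (auto simp: wt_simps)
  then obtain \<sigma> where \<sigma>: "normalised T A \<sigma>" "\<rho> = wt A \<rho> *\<^sub>R \<sigma>" using state_normalise[OF s] by blast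
  then have "pure T \<I> A (wt A \<rho> *\<^sub>R \<sigma>)" using assms(1) by simp
  then have "pure T \<I> A \<sigma>"
    using pure_scaleD[OF _ normalised_states[OF \<sigma>(1)] assms(2)] wt_bounds[OF s] by blast
  with \<sigma> show ?thesis using that by blast
qed

text \<open>All candidates lie in one orbit \<open>a \<odot> U\<close>, which contains a sharp
  effect for every pure state. By compactness the value on \<open>\<omega>\<close> attains its
  maximum on the orbit.\<close>

lemma optimal_sharp_effect:
  assumes "\<omega> \<in> states T A"
  obtains a where "pure T A \<I> a"
    "\<And>\<alpha>. normalised T A \<alpha> \<Longrightarrow> pure T \<I> A \<alpha> \<Longrightarrow>
       \<exists>e. pure T A \<I> e \<and> val (e \<odot> \<alpha>) = 1 \<and> val (e \<odot> \<omega>) \<le> val (a \<odot> \<omega>)"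
proof -
  obtain a where a: "pure T A \<I> a"
    "\<And>\<alpha>. normalised T A \<alpha> \<Longrightarrow> pure T \<I> A \<alpha> \<Longrightarrow> \<exists>U. reversible T A A U \<and> val ((a \<odot> U) \<odot> \<alpha>) = 1"
    using sharp_orbit[of A] by blast
  note as = pure_trafos[OF a(1)]
  define h where "h U = val (a \<odot> (U \<odot> \<omega>))" for U
  have hv: "val ((a \<odot> U) \<odot> \<omega>) = h U" if "reversible T A A U" for U
    unfolding h_def using sq_assoc[OF assms reversible_trafos[OF that] as] by simp
  have lin: "linear h" unfolding h_def by (rule linearI) (simp_all add: bilin val_simps)
  let ?K = "h ` {U. reversible T A A U}"
  have ne: "?K \<noteq> {}" using reversible_idt by blast
  have "h U \<le> 1" if "reversible T A A U" for U
    unfolding h_def using val_bounds[OF as sq_trafos[OF assms reversible_trafos[OF that]]] by simp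
  then have bdd: "bdd_above ?K" by (intro bdd_aboveI[of _ 1]) auto
  \<comment> \<open>Channels within \<open>1 / Suc n\<close> of the supremum; the limit of a
    subsequence attains it.\<close>
  have "\<exists>U. reversible T A A U \<and> Sup ?K - 1 / Suc n < h U" for n
    using less_cSup_iff[OF ne bdd, of "Sup ?K - 1 / Suc n"] by auto
  then obtain U where U: "\<And>n. reversible T A A (U n)" "\<And>n. Sup ?K - 1 / Suc n < h (U n)" by metis
  obtain r W where W: "strict_mono (r :: nat \<Rightarrow> nat)" "coord_tends (U \<circ> r) W" "reversible T A A W"
    using reversible_compact[of A A U, OF U(1)] by blast
  have "(\<lambda>n. h ((U \<circ> r) n)) \<longlonglongrightarrow> h W" by (rule coord_tends_linear[OF W(2) lin])
  moreover have "(\<lambda>n. Sup ?K - 1 / Suc (r n)) \<longlonglongrightarrow> Sup ?K - 0"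
    using LIMSEQ_subseq_LIMSEQ[OF LIMSEQ_inverse_real_of_nat W(1)]
    by (intro tendsto_diff tendsto_const) (simp add: o_def inverse_eq_divide)
  ultimately have "Sup ?K - 0 \<le> h W" using U(2) by (intro LIMSEQ_le) (auto intro: less_imp_le)
  then have max: "h V \<le> h W" if "reversible T A A V" for V
    using cSup_upper[OF _ bdd, of "h V"] that by auto
  show ?thesis
  proof (rule that)
    show "pure T A \<I> (a \<odot> W)" by (rule pure_sq[OF pure_reversible[OF W(3)] a(1)])
    fix \<alpha> assume "normalised T A \<alpha>" "pure T \<I> A \<alpha>"
    then obtain V where V: "reversible T A A V" "val ((a \<odot> V) \<odot> \<alpha>) = 1" using a(2) by blast
    then show "\<exists>e. pure T A \<I> e \<and> val (e \<odot> \<alpha>) = 1 \<and> val (e \<odot> \<omega>) \<le> val ((a \<odot> W) \<odot> \<omega>)"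
      using pure_sq[OF pure_reversible[OF V(1)] a(1)] hv W(3) max by auto
  qed
qed

text \<open>
  \<open>P\<close> is the largest eigenvalue of \<open>\<omega>\<close>: steering by a sharp effect on the purifying system splits
  off a pure \<open>x\<close> of weight at least \<open>P\<close>, and by maximality the effect of \<open>x\<close> vanishes on the rest.
\<close>

lemma orthogonal_sharp_pair:
  assumes "normalised T A \<omega>" "\<not> pure T \<I> A \<omega>"
  obtains e x y where "pure T A \<I> e" "normalised T A x" "pure T \<I> A x" "normalised T A y" "pure T \<I> A y"
    "val (e \<odot> x) = 1" "val (e \<odot> y) = 0"
proof -
  note \<omega>s = normalised_states[OF assms(1)]
  obtain a where a: "pure T A \<I> a"
    "\<And>\<alpha>. normalised T A \<alpha> \<Longrightarrow> pure T \<I> A \<alpha> \<Longrightarrow>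
       \<exists>e. pure T A \<I> e \<and> val (e \<odot> \<alpha>) = 1 \<and> val (e \<odot> \<omega>) \<le> val (a \<odot> \<omega>)"
    using optimal_sharp_effect[OF \<omega>s] by blast
  note as = pure_trafos[OF a(1)]
  define P where "P = val (a \<odot> \<omega>)"
  \<comment> \<open>The value one would make \<open>\<omega>\<close> pure by
    \<open>sharp_pure\<close>.\<close>
  have P1: "P < 1" using val_bounds[OF as \<omega>s] sharp_pure[OF a(1) \<omega>s] assms(2) by (auto simp: P_def less_le)
  \<comment> \<open>A pure component of weight \<open>p\<close> has a sharp effect of value at least
    \<open>p\<close> on \<open>\<omega>\<close>, and \<open>P\<close> dominates it.\<close>
  have P0: "0 < P"
  proof -
    obtain \<alpha> where \<alpha>: "\<alpha> \<in> face A \<omega>" "pure T \<I> A \<alpha>" using pure_component[OF assms(1)] .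
    obtain p \<tau> where p: "0 < p" "p \<le> 1" "normalised T A \<tau>" "\<omega> = p *\<^sub>R \<alpha> + (1 - p) *\<^sub>R \<tau>"
      using face_decompose[OF assms(1) \<alpha>(1)] .
    obtain e where e: "pure T A \<I> e" "val (e \<odot> \<alpha>) = 1" "val (e \<odot> \<omega>) \<le> P"
      using a(2)[OF face_normalised[OF \<alpha>(1)] \<alpha>(2)] by (auto simp: P_def)
    have "0 \<le> val (e \<odot> \<tau>)" using val_bounds[OF pure_trafos[OF e(1)] normalised_states[OF p(3)]] by simp
    then have "p \<le> val (e \<odot> \<omega>)" using p e(2) by (simp add: bilin val_simps)
    then show ?thesis using e(3) p(1) by simp
  qed
  obtain R \<Gamma> where \<Gamma>: "normalised T (A \<diamondop> R) \<Gamma>" "pure T \<I> (A \<diamondop> R) \<Gamma>" "marginal T A R \<Gamma> = \<omega>"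
    using purification_exists[OF assms(1)] by blast
  note \<Gamma>s = normalised_states[OF \<Gamma>(1)]
  let ?u = "unit_effect T"
  have \<omega>_pair: "val (e \<odot> \<omega>) = val ((e \<otimes> ?u R) \<odot> \<Gamma>)" if "e \<in> effects T A" for e
    using pair_par(2)[OF \<Gamma>s that unit_trafos] \<Gamma>(3) by (simp add: marginal_def)
  define \<beta> where "\<beta> = (a \<otimes> idt T R) \<odot> \<Gamma>"
  have aR: "pure T (A \<diamondop> R) R (a \<otimes> idt T R)" using pure_par[OF a(1) pure_idt[of R]] by (simp add: cmpst_triv_left)
  have \<beta>p: "pure T \<I> R \<beta>" unfolding \<beta>_def by (rule pure_sq[OF \<Gamma>(2) aR])
  have \<beta>w: "wt R \<beta> = P" unfolding \<beta>_def P_def using wt_marginal[OF \<Gamma>s as] \<Gamma>(3) by simp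
  obtain \<beta>1 where \<beta>1: "normalised T R \<beta>1" "pure T \<I> R \<beta>1" "\<beta> = P *\<^sub>R \<beta>1"
    using pure_state_normalise[OF \<beta>p] \<beta>w P0 by auto
  obtain b where b: "pure T R \<I> b" "val (b \<odot> \<beta>1) = 1" using sharp_effect[OF \<beta>1(1,2)] .
  note bs = pure_trafos[OF b(1)]
  define \<gamma> where "\<gamma> = (idt T A \<otimes> b) \<odot> \<Gamma>"
  have bA: "pure T (A \<diamondop> R) A (idt T A \<otimes> b)" using pure_par[OF pure_idt[of A] b(1)] by (simp add: cmpst_triv_right)
  have \<gamma>p: "pure T \<I> A \<gamma>" unfolding \<gamma>_def by (rule pure_sq[OF \<Gamma>(2) bA])
  have \<gamma>w: "wt A \<gamma> = val ((?u A \<otimes> b) \<odot> \<Gamma>)"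
    unfolding \<gamma>_def wt_def using pair_par(2)[OF \<Gamma>s unit_trafos bs] by simp
  \<comment> \<open>\<open>b\<close> is certain on the normalised conditional state, so demanding it
    in addition to \<open>a\<close> costs no probability; discarding \<open>A\<close> instead of
    applying \<open>a\<close> can only gain.\<close>
  have "val ((a \<otimes> b) \<odot> \<Gamma>) = P"
    using pair_par(1)[OF \<Gamma>s as bs] b(2) \<beta>1(3) by (simp add: \<beta>_def bilin val_simps)
  moreover have "0 \<le> val (((?u A - a) \<otimes> b) \<odot> \<Gamma>)"
    using val_bounds[OF effects_par[OF effect_complement_trafos[OF as] bs] \<Gamma>s] by simp
  ultimately have qP: "P \<le> wt A \<gamma>" by (simp add: \<gamma>w bilin val_simps)
  obtain x where x: "normalised T A x" "pure T \<I> A x" "\<gamma> = wt A \<gamma> *\<^sub>R x"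
    using pure_state_normalise[OF \<gamma>p] qP P0 by auto
  obtain e where e: "pure T A \<I> e" "val (e \<odot> x) = 1" "val (e \<odot> \<omega>) \<le> P"
    using a(2)[OF x(1,2)] by (auto simp: P_def)
  note es = pure_trafos[OF e(1)]
  define \<tau> where "\<tau> = (idt T A \<otimes> (?u R - b)) \<odot> \<Gamma>"
  have \<tau>s: "\<tau> \<in> states T A"
    unfolding \<tau>_def by (rule sq_trafos[OF \<Gamma>s effect_right_trafos[OF effect_complement_trafos[OF bs]]])
  have split: "\<omega> = \<gamma> + \<tau>" using \<Gamma>(3) by (simp add: \<gamma>_def \<tau>_def marginal_def bilin)
  have e\<gamma>: "val (e \<odot> \<gamma>) = wt A \<gamma>" using arg_cong[OF x(3), of "\<lambda>z. val (e \<odot> z)"] e(2) unfolding bilin val_simps by simp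
  have e\<tau>: "0 \<le> val (e \<odot> \<tau>)" using val_bounds[OF es \<tau>s] by simp
  \<comment> \<open>The chain
    \<open>P \<le> wt A \<gamma> \<le> val (e \<odot> \<omega>) \<le> P\<close> collapses, so
    \<open>e\<close> has probability zero on the remainder \<open>\<tau>\<close>.\<close>
  have "wt A \<gamma> + val (e \<odot> \<tau>) \<le> P" using e(3) e\<gamma> by (simp add: split bilin val_simps)
  then have \<gamma>P: "wt A \<gamma> = P" and e\<tau>0: "val (e \<odot> \<tau>) = 0" using qP e\<tau> by auto
  have "wt A \<tau> = 1 - P" using assms(1) \<gamma>P by (simp add: split wt_simps normalised_iff)
  then have "\<tau> \<noteq> 0" using P1 by (auto simp: wt_simps)
  then obtain \<tau>1 where \<tau>1: "normalised T A \<tau>1" "\<tau> = wt A \<tau> *\<^sub>R \<tau>1" "0 < wt A \<tau>" using state_normalise[OF \<tau>s] by blast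
  have e\<tau>1: "val (e \<odot> \<tau>1) = 0"
    using arg_cong[OF \<tau>1(2), of "\<lambda>z. val (e \<odot> z)"] e\<tau>0 \<tau>1(3) unfolding bilin val_simps by simp
  \<comment> \<open>The value zero passes to a pure component because both terms of the
    decomposition are nonnegative.\<close>
  obtain y where y: "y \<in> face A \<tau>1" "pure T \<I> A y" using pure_component[OF \<tau>1(1)] .
  note yn = face_normalised[OF y(1)]
  obtain p \<tau>2 where p: "0 < p" "p \<le> 1" "normalised T A \<tau>2" "\<tau>1 = p *\<^sub>R y + (1 - p) *\<^sub>R \<tau>2"
    using face_decompose[OF \<tau>1(1) y(1)] .
  have "p * val (e \<odot> y) + (1 - p) * val (e \<odot> \<tau>2) = 0" using e\<tau>1 by (simp add: p(4) bilin val_simps)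
  moreover have nn: "0 \<le> val (e \<odot> y)" "0 \<le> val (e \<odot> \<tau>2)" using val_bounds[OF es] yn p(3) normalised_states by blast+
  moreover have "0 \<le> p * val (e \<odot> y)" "0 \<le> (1 - p) * val (e \<odot> \<tau>2)" using p(1,2) nn by auto
  ultimately have "p * val (e \<odot> y) = 0" by linarith
  then have "val (e \<odot> y) = 0" using p(1) by simp
  then show ?thesis using that[OF e(1) x(1,2) yn y(2) e(2)] by blast
qed

end

subsection \<open>Controlled channels\<close>

context causal_opt
begin

lemma effect_slide:
  assumes "\<Gamma> \<in> states T (A \<diamondop> R)" "Y \<in> trafos T A E" "g \<in> effects T R"
  shows "(idt T E \<otimes> g) \<odot> ((Y \<otimes> idt T R) \<odot> \<Gamma>) = Y \<odot> ((idt T A \<otimes> g) \<odot> \<Gamma>)"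
  using par_act_comm[OF assms] by (simp add: par_triv_right[OF assms(2)])

lemma channel_par_normalised:
  assumes "channel T A E Y" "normalised T (A \<diamondop> R) \<Gamma>"
  shows "normalised T (E \<diamondop> R) ((Y \<otimes> idt T R) \<odot> \<Gamma>)"
  by (rule channel_normalised[OF channel_par[OF assms(1) channel_idt] assms(2)])

lemma append_state_channel:
  assumes "normalised T B \<sigma>"
  shows "channel T A (A \<diamondop> B) (idt T A \<otimes> \<sigma>)"
  using channel_par[OF channel_idt[of A], of \<I> B \<sigma>] assms
  by (simp add: normalised_channel cmpst_triv_right)

end

context sharp_theory_with_purification
begin

lemma append_state_pure:
  assumes "pure T \<I> B \<sigma>"
  shows "pure T A (A \<diamondop> B) (idt T A \<otimes> \<sigma>)"
  using pure_par[OF pure_idt[of A] assms] by (simp add: cmpst_triv_right)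

text \<open>Strong symmetry speaks of maximal sets, so both lists are extended; equal lengths of the
  given lists align the prefixes.\<close>

lemma strong_symmetry_convert:
  assumes "strong_symmetry T" "perf_dist T A \<rho>s" "perf_dist T A \<sigma>s" "length \<rho>s = length \<sigma>s"
    "\<forall>\<rho>\<in>set \<rho>s. pure T \<I> A \<rho>" "\<forall>\<sigma>\<in>set \<sigma>s. pure T \<I> A \<sigma>"
  obtains U where "reversible T A A U" "\<And>i. i < length \<rho>s \<Longrightarrow> U \<odot> \<rho>s ! i = \<sigma>s ! i"
proof -
  obtain xs where xs: "pure_maximal T A (\<rho>s @ xs)" using perf_dist_extend[OF assms(2,5)] .
  obtain ys where ys: "pure_maximal T A (\<sigma>s @ ys)" using perf_dist_extend[OF assms(3,6)] .
  obtain U where U: "reversible T A A U" "map (\<lambda>\<phi>. U \<odot> \<phi>) (\<rho>s @ xs) = \<sigma>s @ ys"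
    using assms(1) xs ys unfolding strong_symmetry_def by blast
  then have "map (\<lambda>\<phi>. U \<odot> \<phi>) \<rho>s = \<sigma>s" using assms(4) by simp
  then show ?thesis using that[OF U(1)] by (metis nth_map)
qed

text \<open>The tags \<open>\<alpha>\<^sub>i\<close> make the products distinguishable whatever the
  second factors are. This is reversible control for a single input state per tag.\<close>

lemma convert_tags:
  assumes "strong_symmetry T" "perf_dist T A \<alpha>s" "\<forall>\<alpha>\<in>set \<alpha>s. pure T \<I> A \<alpha>"
    "\<And>i. i < length \<alpha>s \<Longrightarrow> normalised T B (x i) \<and> pure T \<I> B (x i)"
    "\<And>i. i < length \<alpha>s \<Longrightarrow> normalised T B (y i) \<and> pure T \<I> B (y i)"
  obtains W where "reversible T (A \<diamondop> B) (A \<diamondop> B) W"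
    "\<And>i. i < length \<alpha>s \<Longrightarrow> W \<odot> (\<alpha>s ! i \<otimes> x i) = \<alpha>s ! i \<otimes> y i"
proof -
  let ?l = "\<lambda>z. map2 (\<lambda>\<rho> \<sigma>. \<rho> \<otimes> \<sigma>) \<alpha>s (map z [0..<length \<alpha>s])"
  have l: "perf_dist T (A \<diamondop> B) (?l z) \<and> (\<forall>\<rho>\<in>set (?l z). pure T \<I> (A \<diamondop> B) \<rho>)"
    if z: "\<And>i. i < length \<alpha>s \<Longrightarrow> normalised T B (z i) \<and> pure T \<I> B (z i)" for z
  proof
    show "perf_dist T (A \<diamondop> B) (?l z)" using z by (intro perf_dist_tag[OF assms(2)]) auto
    show "\<forall>\<rho>\<in>set (?l z). pure T \<I> (A \<diamondop> B) \<rho>"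
      using z assms(3) by (auto simp: set_zip intro!: pure_states_par)
  qed
  obtain W where W: "reversible T (A \<diamondop> B) (A \<diamondop> B) W"
    "\<And>i. i < length (?l x) \<Longrightarrow> W \<odot> ?l x ! i = ?l y ! i"
    using strong_symmetry_convert[OF assms(1), of "A \<diamondop> B" "?l x" "?l y"] l[of x] l[of y] assms(4,5) by auto
  have "W \<odot> (\<alpha>s ! i \<otimes> x i) = \<alpha>s ! i \<otimes> y i" if "i < length \<alpha>s" for i using W(2)[of i] that by simp
  with W(1) show ?thesis by (rule that)
qed

text \<open>A sharp effect for \<open>\<alpha>s ! k\<close> is not known here to vanish on the other
  states. Whether \<open>i = k\<close> is therefore recorded in an ancilla as \<open>x\<close> or
  \<open>y\<close>, and read there by an effect that tells these two apart without error.\<close>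

lemma discriminating_pure_effect:
  assumes "strong_symmetry T" "perf_dist T A \<alpha>s" "\<forall>\<alpha>\<in>set \<alpha>s. pure T \<I> A \<alpha>" "k < length \<alpha>s"
  shows "\<exists>f. pure T A \<I> f \<and> (\<forall>i < length \<alpha>s. val (f \<odot> \<alpha>s ! i) = (if i = k then 1 else 0))"
proof -
  have \<alpha>: "normalised T A (\<alpha>s ! i)" "pure T \<I> A (\<alpha>s ! i)" if "i < length \<alpha>s" for i
    using that perf_dist_normalised[OF assms(2)] assms(3) by auto
  obtain a where a: "pure T A \<I> a" "val (a \<odot> \<alpha>s ! k) = 1" using sharp_effect[OF \<alpha>[OF assms(4)]] .
  show ?thesis
  proof (cases "length \<alpha>s = 1")
    \<comment> \<open>With a single state there is nothing to exclude, and no second state to mix it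
      with.\<close>
    case True
    then show ?thesis using a assms(4) by auto
  next
    case False
    then have l: "0 < length \<alpha>s" "1 < length \<alpha>s" using assms(4) by auto
    \<comment> \<open>Two distinct states mix to one that is not pure, which is what
      \<open>orthogonal_sharp_pair\<close> asks for.\<close>
    let ?\<omega> = "(1/2) *\<^sub>R \<alpha>s ! 0 + (1 - 1/2) *\<^sub>R \<alpha>s ! 1"
    have \<omega>: "normalised T A ?\<omega>" by (rule convex2(2)[OF \<alpha>(1)[OF l(1)] \<alpha>(1)[OF l(2)]]) auto
    have f0: "\<alpha>s ! 0 \<in> face A ?\<omega>" by (rule faceI[OF _ _ \<alpha>(1)[OF l(1)] \<alpha>(1)[OF l(2)]]) auto
    have "\<alpha>s ! 1 \<in> face A ((1/2) *\<^sub>R \<alpha>s ! 1 + (1 - 1/2) *\<^sub>R \<alpha>s ! 0)"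
      by (rule faceI[OF _ _ \<alpha>(1)[OF l(2)] \<alpha>(1)[OF l(1)]]) auto
    moreover have "(1/2) *\<^sub>R \<alpha>s ! 1 + (1 - 1/2) *\<^sub>R \<alpha>s ! 0 = ?\<omega>" by (simp add: add.commute)
    ultimately have f1: "\<alpha>s ! 1 \<in> face A ?\<omega>" by (simp only:)
    have "\<alpha>s ! 0 \<noteq> \<alpha>s ! 1"
      using perf_dist_independent(1)[OF assms(2)] l by (simp add: nth_eq_iff_index_eq)
    then have "face A ?\<omega> \<noteq> {?\<omega>}" using f0 f1 by (metis singletonD)
    then have np: "\<not> pure T \<I> A ?\<omega>" using pure_state_iff[OF \<omega>] by blast
    obtain e x y where e: "pure T A \<I> e" and x: "normalised T A x" "pure T \<I> A x"
      and y: "normalised T A y" "pure T \<I> A y" and exy: "val (e \<odot> x) = 1" "val (e \<odot> y) = 0"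
      using orthogonal_sharp_pair[OF \<omega> np] .
    define t where "t i = (if i = k then x else y)" for i
    have t: "normalised T A (t i)" "pure T \<I> A (t i)" for i using x y by (auto simp: t_def)
    obtain W where W: "reversible T (A \<diamondop> A) (A \<diamondop> A) W"
      "\<And>i. i < length \<alpha>s \<Longrightarrow> W \<odot> (\<alpha>s ! i \<otimes> x) = \<alpha>s ! i \<otimes> t i"
      using convert_tags[OF assms(1-3), of A "\<lambda>_. x" t] x t by blast
    note as = pure_trafos[OF a(1)] and es = pure_trafos[OF e] and xs = normalised_states[OF x(1)]
    have ae: "pure T (A \<diamondop> A) \<I> (a \<otimes> e)" using pure_par[OF a(1) e] by (simp add: cmpst_triv_left)
    have Wx: "pure T A (A \<diamondop> A) (W \<odot> (idt T A \<otimes> x))"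
      by (rule pure_sq[OF append_state_pure[OF x(2)] pure_reversible[OF W(1)]])
    define f where "f = (a \<otimes> e) \<odot> (W \<odot> (idt T A \<otimes> x))"
    have "pure T A \<I> f" unfolding f_def by (rule pure_sq[OF Wx ae])
    moreover have "val (f \<odot> \<alpha>s ! i) = (if i = k then 1 else 0)" if i: "i < length \<alpha>s" for i
    proof -
      note \<alpha>i = normalised_states[OF \<alpha>(1)[OF i]]
      have "f \<odot> \<alpha>s ! i = (a \<otimes> e) \<odot> (W \<odot> ((idt T A \<otimes> x) \<odot> \<alpha>s ! i))"
        unfolding f_def using sq_assoc[OF \<alpha>i pure_trafos[OF Wx] pure_trafos[OF ae]]
          sq_assoc[OF \<alpha>i state_right_trafos[OF xs] reversible_trafos[OF W(1)]] by simp
      also have "\<dots> = (a \<otimes> e) \<odot> (\<alpha>s ! i \<otimes> t i)" by (simp add: append_state[OF \<alpha>i xs] W(2)[OF i])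
      finally have "val (f \<odot> \<alpha>s ! i) = val (a \<odot> \<alpha>s ! i) * val (e \<odot> t i)"
        using pairing_par[OF as es \<alpha>i normalised_states[OF t(1)]] by simp
      then show ?thesis using a(2) exy by (simp add: t_def)
    qed
    ultimately show ?thesis by blast
  qed
qed

text \<open>
  Copying \<open>\<alpha>\<^sub>i \<mapsto> \<alpha>\<^sub>i \<otimes> \<alpha>\<^sub>i\<close> one half of a purification of the uniform mixture gives a pure state
  in which pure effects on the far side, each reaching probability one on a single state, steer
  to the \<open>\<alpha>\<^sub>i\<close>.
\<close>

lemma sharply_steered_purification:
  assumes "strong_symmetry T" "perf_dist T A \<alpha>s" "\<forall>\<alpha>\<in>set \<alpha>s. pure T \<I> A \<alpha>"
  obtains R \<Gamma> g \<eta> where "normalised T (A \<diamondop> R) \<Gamma>" "pure T \<I> (A \<diamondop> R) \<Gamma>"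
    "marginal T A R \<Gamma> = (\<Sum>i<length \<alpha>s. (1 / length \<alpha>s) *\<^sub>R \<alpha>s ! i)"
    "\<And>i. i < length \<alpha>s \<Longrightarrow> pure T R \<I> (g i)" "\<And>i. i < length \<alpha>s \<Longrightarrow> normalised T R (\<eta> i)"
    "\<And>i. i < length \<alpha>s \<Longrightarrow> val (g i \<odot> \<eta> i) = 1"
    "\<And>i. i < length \<alpha>s \<Longrightarrow> (idt T A \<otimes> g i) \<odot> \<Gamma> = (1 / length \<alpha>s) *\<^sub>R \<alpha>s ! i"
proof -
  let ?d = "length \<alpha>s"
  let ?u = "unit_effect T"
  have d: "0 < ?d" using perf_dist_nonempty[OF assms(2)] by simp
  have \<alpha>: "normalised T A (\<alpha>s ! i)" "pure T \<I> A (\<alpha>s ! i)" if "i < ?d" for i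
    using that perf_dist_normalised[OF assms(2)] assms(3) by auto
  note \<alpha>s = normalised_states[OF \<alpha>(1)]
  have "\<exists>f. \<forall>k<?d. pure T A \<I> (f k) \<and> (\<forall>i < ?d. val (f k \<odot> \<alpha>s ! i) = (if i = k then 1 else 0))"
    using discriminating_pure_effect[OF assms] by metis
  then obtain f where f: "\<And>k. k < ?d \<Longrightarrow> pure T A \<I> (f k)"
    "\<And>k i. k < ?d \<Longrightarrow> i < ?d \<Longrightarrow> val (f k \<odot> \<alpha>s ! i) = (if i = k then 1 else 0)" by blast
  note fs = pure_trafos[OF f(1)]
  obtain V where V: "reversible T (A \<diamondop> A) (A \<diamondop> A) V"
    "\<And>i. i < ?d \<Longrightarrow> V \<odot> (\<alpha>s ! i \<otimes> \<alpha>s ! 0) = \<alpha>s ! i \<otimes> \<alpha>s ! i"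
    using convert_tags[OF assms, of A "\<lambda>_. \<alpha>s ! 0" "\<lambda>i. \<alpha>s ! i"] \<alpha> d by blast
  \<comment> \<open>Copying: attach the fixed state \<open>\<alpha>s ! 0\<close> and overwrite it
    reversibly.\<close>
  define K where "K = V \<odot> (idt T A \<otimes> \<alpha>s ! 0)"
  have Kc: "channel T A (A \<diamondop> A) K"
    unfolding K_def by (rule channel_sq[OF append_state_channel[OF \<alpha>(1)[OF d]] reversible_channel[OF V(1)]])
  have Kp: "pure T A (A \<diamondop> A) K"
    unfolding K_def by (rule pure_sq[OF append_state_pure[OF \<alpha>(2)[OF d]] pure_reversible[OF V(1)]])
  note Km = channel_trafos[OF Kc]
  have K: "K \<odot> \<alpha>s ! i = \<alpha>s ! i \<otimes> \<alpha>s ! i" if i: "i < ?d" for i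
    unfolding K_def using sq_assoc[OF \<alpha>s[OF i] state_right_trafos[OF \<alpha>s[OF d]] reversible_trafos[OF V(1)]]
    by (simp add: append_state[OF \<alpha>s[OF i] \<alpha>s[OF d]] V(2)[OF i])
  define \<omega> where "\<omega> = (\<Sum>i<?d. (1 / ?d) *\<^sub>R \<alpha>s ! i)"
  have \<omega>: "normalised T A \<omega>" unfolding \<omega>_def using \<alpha>(1) d by (intro convex_normalised) auto
  note \<omega>s = normalised_states[OF \<omega>]
  obtain R \<Gamma>0 where \<Gamma>0: "normalised T (A \<diamondop> R) \<Gamma>0" "pure T \<I> (A \<diamondop> R) \<Gamma>0" "marginal T A R \<Gamma>0 = \<omega>"
    using purification_exists[OF \<omega>] by blast
  note \<Gamma>0s = normalised_states[OF \<Gamma>0(1)]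
  define \<Gamma> where "\<Gamma> = (K \<otimes> idt T R) \<odot> \<Gamma>0"
  have \<Gamma>: "normalised T (A \<diamondop> (A \<diamondop> R)) \<Gamma>" "pure T \<I> (A \<diamondop> (A \<diamondop> R)) \<Gamma>"
    unfolding \<Gamma>_def using channel_par_normalised[OF Kc \<Gamma>0(1)] pure_sq[OF \<Gamma>0(2) pure_par[OF Kp pure_idt]]
    by (simp_all add: cmpst_assoc)
  have on_copy: "((idt T A \<otimes> h) \<odot> K) \<odot> \<alpha>s ! i = val (h \<odot> \<alpha>s ! i) *\<^sub>R \<alpha>s ! i"
    if h: "h \<in> effects T A" and i: "i < ?d" for h i
    using sq_assoc[OF \<alpha>s[OF i] Km effect_right_trafos[OF h]] K[OF i]
      effect_right_product[OF h \<alpha>s[OF i] idt_trafos \<alpha>s[OF i]] sq_idt_left[OF \<alpha>s[OF i]] by simp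
  have copy_apply: "(idt T A \<otimes> (h \<otimes> k)) \<odot> \<Gamma> = (((idt T A \<otimes> h) \<odot> K) \<otimes> k) \<odot> \<Gamma>0"
    if h: "h \<in> effects T A" and k: "k \<in> trafos T R E" for h k E
    unfolding \<Gamma>_def using par_act[OF \<Gamma>0s Km idt_trafos effect_right_trafos[OF h] k]
      par_assoc[OF idt_trafos h k] sq_idt_right[OF k] by simp
  have "marginal T A (A \<diamondop> R) \<Gamma> = ((((idt T A \<otimes> ?u A) \<odot> K) \<otimes> ?u R) \<odot> \<Gamma>0)"
    using copy_apply[OF unit_trafos unit_trafos] by (simp add: marginal_def unit_par)
  also have "\<dots> = ((idt T A \<otimes> ?u A) \<odot> K) \<odot> \<omega>"
    using par_act_comm(1)[OF \<Gamma>0s sq_trafos[OF Km effect_right_trafos[OF unit_trafos]] unit_trafos] \<Gamma>0(3)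
      par_triv_right[OF sq_trafos[OF Km effect_right_trafos[OF unit_trafos]]] by (simp add: marginal_def)
  also have "\<dots> = \<omega>"
    unfolding \<omega>_def using on_copy[OF unit_trafos] unit_normalised[OF \<alpha>(1)] by (simp add: bilin_sum bilin)
  finally have mg: "marginal T A (A \<diamondop> R) \<Gamma> = \<omega>" .
  have "\<exists>\<rho>. normalised T R \<rho> \<and> pure T \<I> R \<rho> \<and>
      (idt T A \<otimes> (f i \<otimes> idt T R)) \<odot> \<Gamma> = (1 / ?d) *\<^sub>R (\<alpha>s ! i \<otimes> \<rho>)" if i: "i < ?d" for i
  proof -
    \<comment> \<open>What copying followed by \<open>f i\<close> on the copy does to
      \<open>A\<close>; on the uniform mixture it selects the \<open>i\<close>-th term.\<close>
    define E where "E = (idt T A \<otimes> f i) \<odot> K"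
    have Em: "E \<in> trafos T A A" unfolding E_def by (rule sq_trafos[OF Km effect_right_trafos[OF fs[OF i]]])
    define \<gamma> where "\<gamma> = (idt T A \<otimes> (f i \<otimes> idt T R)) \<odot> \<Gamma>"
    have fR: "pure T (A \<diamondop> R) R (f i \<otimes> idt T R)" using pure_par[OF f(1)[OF i] pure_idt[of R]] by (simp add: cmpst_triv_left)
    have \<gamma>p: "pure T \<I> (A \<diamondop> R) \<gamma>" unfolding \<gamma>_def by (rule pure_sq[OF \<Gamma>(2) pure_par[OF pure_idt fR]])
    have \<gamma>E: "\<gamma> = (E \<otimes> idt T R) \<odot> \<Gamma>0" unfolding \<gamma>_def E_def by (rule copy_apply[OF fs[OF i] idt_trafos])
    have "E \<odot> \<omega> = (\<Sum>j<?d. (1 / ?d) *\<^sub>R (val (f i \<odot> \<alpha>s ! j) *\<^sub>R \<alpha>s ! j))"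
      unfolding \<omega>_def E_def using on_copy[OF fs[OF i]] by (simp add: bilin_sum bilin)
    also have "\<dots> = (\<Sum>j<?d. if j = i then (1 / ?d) *\<^sub>R \<alpha>s ! i else 0)"
      using f(2)[OF i] by (intro sum.cong) auto
    also have "\<dots> = (1 / ?d) *\<^sub>R \<alpha>s ! i" using i by simp
    finally have E\<omega>: "E \<odot> \<omega> = (1 / ?d) *\<^sub>R \<alpha>s ! i" .
    have m\<gamma>: "marginal T A R \<gamma> = (1 / ?d) *\<^sub>R \<alpha>s ! i"
      unfolding \<gamma>E marginal_def using effect_slide[OF \<Gamma>0s Em unit_trafos] \<Gamma>0(3) E\<omega> by (simp add: marginal_def)
    have w: "wt (A \<diamondop> R) \<gamma> = 1 / ?d"
    proof -
      have "wt (A \<diamondop> R) \<gamma> = wt A (marginal T A R \<gamma>)"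
        using pair_par(2)[OF pure_trafos[OF \<gamma>p] unit_trafos unit_trafos] by (simp add: wt_def marginal_def unit_par)
      then show ?thesis using \<alpha>(1)[OF i] by (simp add: m\<gamma> wt_simps normalised_iff)
    qed
    obtain \<delta> where \<delta>: "normalised T (A \<diamondop> R) \<delta>" "pure T \<I> (A \<diamondop> R) \<delta>" "\<gamma> = (1 / ?d) *\<^sub>R \<delta>"
      using pure_state_normalise[OF \<gamma>p] w d by auto
    have "(1 / ?d) *\<^sub>R marginal T A R \<delta> = (1 / ?d) *\<^sub>R \<alpha>s ! i"
      unfolding m\<gamma>[symmetric] \<delta>(3) by (simp add: marginal_def bilin)
    then have m\<delta>: "marginal T A R \<delta> = \<alpha>s ! i" using d by simp
    \<comment> \<open>The conditional state is pure and has the pure marginal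
      \<open>\<alpha>s ! i\<close>, so \<open>R\<close> is left uncorrelated with
      \<open>A\<close>.\<close>
    obtain \<rho> where "normalised T R \<rho>" "pure T \<I> R \<rho>" "\<delta> = \<alpha>s ! i \<otimes> \<rho>"
      using pure_state_product[OF \<delta>(1,2)] \<alpha>(2)[OF i] unfolding m\<delta> by blast
    then show ?thesis using \<delta>(3) unfolding \<gamma>_def by blast
  qed
  then have "\<exists>\<rho>. \<forall>i<?d. normalised T R (\<rho> i) \<and> pure T \<I> R (\<rho> i) \<and>
      (idt T A \<otimes> (f i \<otimes> idt T R)) \<odot> \<Gamma> = (1 / ?d) *\<^sub>R (\<alpha>s ! i \<otimes> \<rho> i)" by metis
  then obtain \<rho> where \<rho>: "\<And>i. i < ?d \<Longrightarrow> normalised T R (\<rho> i)" "\<And>i. i < ?d \<Longrightarrow> pure T \<I> R (\<rho> i)"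
    "\<And>i. i < ?d \<Longrightarrow> (idt T A \<otimes> (f i \<otimes> idt T R)) \<odot> \<Gamma> = (1 / ?d) *\<^sub>R (\<alpha>s ! i \<otimes> \<rho> i)" by blast
  \<comment> \<open>The steering effect will be \<open>f i\<close> on the copy together with a sharp
    effect \<open>b i\<close> for the state left on \<open>R\<close>; the pair is certain on
    \<open>\<alpha>s ! i \<otimes> \<rho> i\<close>.\<close>
  have "\<exists>b. pure T R \<I> b \<and> val (b \<odot> \<rho> i) = 1" if "i < ?d" for i
    using sharp_effect[OF \<rho>(1,2)[OF that]] by blast
  then obtain b where b: "\<And>i. i < ?d \<Longrightarrow> pure T R \<I> (b i)" "\<And>i. i < ?d \<Longrightarrow> val (b i \<odot> \<rho> i) = 1" by metis
  note bs = pure_trafos[OF b(1)] and \<rho>s = normalised_states[OF \<rho>(1)]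
  show ?thesis
  proof (rule that[OF \<Gamma>, of "\<lambda>i. f i \<otimes> b i" "\<lambda>i. \<alpha>s ! i \<otimes> \<rho> i"])
    show "marginal T A (A \<diamondop> R) \<Gamma> = (\<Sum>i<?d. (1 / ?d) *\<^sub>R \<alpha>s ! i)" using mg by (simp add: \<omega>_def)
    fix i assume i: "i < ?d"
    show "pure T (A \<diamondop> R) \<I> (f i \<otimes> b i)" using pure_par[OF f(1)[OF i] b(1)[OF i]] by (simp add: cmpst_triv_left)
    show "normalised T (A \<diamondop> R) (\<alpha>s ! i \<otimes> \<rho> i)" by (rule normalised_par[OF \<alpha>(1)[OF i] \<rho>(1)[OF i]])
    show "val ((f i \<otimes> b i) \<odot> (\<alpha>s ! i \<otimes> \<rho> i)) = 1"
      using pairing_par[OF fs[OF i] bs[OF i] \<alpha>s[OF i] \<rho>s[OF i]] f(2)[OF i i] b(2)[OF i] by simp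
    have fR: "f i \<otimes> idt T R \<in> trafos T (A \<diamondop> R) R" by (rule effect_left_trafos[OF fs[OF i]])
    have fb: "b i \<odot> (f i \<otimes> idt T R) = f i \<otimes> b i"
      using interchange[OF fs[OF i] idt_trafos idt_trafos bs[OF i]] sq_idt_left[OF fs[OF i]] sq_idt_right[OF bs[OF i]]
      by (simp add: par_triv_left[OF bs[OF i]])
    have "(idt T A \<otimes> (f i \<otimes> b i)) \<odot> \<Gamma> = (idt T A \<otimes> b i) \<odot> ((idt T A \<otimes> (f i \<otimes> idt T R)) \<odot> \<Gamma>)"
      using par_act[OF normalised_states[OF \<Gamma>(1)] idt_trafos fR idt_trafos bs[OF i]] fb by (simp add: sq_idt_left[OF idt_trafos])
    also have "\<dots> = (1 / ?d) *\<^sub>R ((idt T A \<otimes> b i) \<odot> (\<alpha>s ! i \<otimes> \<rho> i))" by (simp only: \<rho>(3)[OF i] sq_scale_right)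
    also have "(idt T A \<otimes> b i) \<odot> (\<alpha>s ! i \<otimes> \<rho> i) = \<alpha>s ! i"
      using effect_right_product[OF bs[OF i] \<rho>s[OF i] idt_trafos \<alpha>s[OF i]] b(2)[OF i] sq_idt_left[OF \<alpha>s[OF i]] by simp
    finally show "(idt T A \<otimes> (f i \<otimes> b i)) \<odot> \<Gamma> = (1 / ?d) *\<^sub>R \<alpha>s ! i" .
  qed
qed

text \<open>Conditioning on \<open>g\<close> loses no probability, so the marginal on
  \<open>R\<close> is the only state on which \<open>g\<close> is certain. That state is pure, hence
  \<open>z\<close> factorises.\<close>

lemma sharp_conditional_product:
  assumes z: "normalised T (D \<diamondop> R) z" and g: "pure T R \<I> g" "normalised T R \<eta>" "val (g \<odot> \<eta>) = 1"
    and \<Phi>: "(idt T D \<otimes> g) \<odot> z = \<Phi>" "normalised T D \<Phi>"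
  shows "z = \<Phi> \<otimes> \<eta>"
proof -
  note zs = normalised_states[OF z] and gs = pure_trafos[OF g(1)] and \<eta>s = normalised_states[OF g(2)]
  let ?z = "swp T D R \<odot> z"
  have zn: "normalised T (R \<diamondop> D) ?z" by (rule channel_normalised[OF channel_swp z])
  have m: "marginal T R D ?z = (unit_effect T D \<otimes> idt T R) \<odot> z" by (rule marginal_swp[OF zs])
  have "val (g \<odot> marginal T R D ?z) = 1"
    unfolding m using pair_par[OF zs unit_trafos gs] \<Phi>(1) unit_normalised[OF \<Phi>(2)] by simp
  then have mg: "marginal T R D ?z = \<eta>"
    by (rule sharp_unique[OF g(1) normalised_states[OF marginal_normalised[OF zn]] _ \<eta>s g(3)])
  have "pure T \<I> R \<eta>" by (rule sharp_pure[OF g(1) \<eta>s g(3)])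
  then obtain \<kappa> where \<kappa>: "normalised T D \<kappa>" "?z = \<eta> \<otimes> \<kappa>"
    using state_product[OF zn] unfolding mg by blast
  note \<kappa>s = normalised_states[OF \<kappa>(1)]
  have "z = swp T R D \<odot> ?z" by (rule sq_inverse_cancel[OF reversible_swp swp_swp swp_trafos zs, symmetric])
  also have "\<dots> = \<kappa> \<otimes> \<eta>" unfolding \<kappa>(2) by (rule swp_product[OF \<eta>s \<kappa>s])
  finally have zk: "z = \<kappa> \<otimes> \<eta>" .
  have "\<Phi> = \<kappa>"
    using \<Phi>(1) effect_right_product[OF gs \<eta>s idt_trafos \<kappa>s] g(3) sq_idt_left[OF \<kappa>s] by (simp add: zk)
  then show ?thesis using zk by simp
qed

text \<open>
  The first factor of the state keeps a record of \<open>i\<close>, so tracing it out leaves no coherence.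
\<close>

lemma dephased_marginal:
  assumes pd: "perf_dist T A \<alpha>s" and \<Gamma>: "normalised T (A \<diamondop> R) \<Gamma>"
    "marginal T A R \<Gamma> = (\<Sum>i<length \<alpha>s. (1 / length \<alpha>s) *\<^sub>R \<alpha>s ! i)"
    and g: "\<And>i. i < length \<alpha>s \<Longrightarrow> pure T R \<I> (g i)" "\<And>i. i < length \<alpha>s \<Longrightarrow> normalised T R (\<eta> i)"
    "\<And>i. i < length \<alpha>s \<Longrightarrow> val (g i \<odot> \<eta> i) = 1"
    "\<And>i. i < length \<alpha>s \<Longrightarrow> (idt T A \<otimes> g i) \<odot> \<Gamma> = (1 / length \<alpha>s) *\<^sub>R \<alpha>s ! i"
    and Y: "channel T A (A \<diamondop> D) Y" "\<And>i. i < length \<alpha>s \<Longrightarrow> Y \<odot> \<alpha>s ! i = \<alpha>s ! i \<otimes> \<Phi> i"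
    and \<Phi>: "\<And>i. i < length \<alpha>s \<Longrightarrow> normalised T D (\<Phi> i)"
  shows "(unit_effect T A \<otimes> idt T (D \<diamondop> R)) \<odot> ((Y \<otimes> idt T R) \<odot> \<Gamma>) =
    (\<Sum>i<length \<alpha>s. (1 / length \<alpha>s) *\<^sub>R (\<Phi> i \<otimes> \<eta> i))"
proof -
  let ?d = "length \<alpha>s"
  let ?u = "unit_effect T"
  have d: "0 < ?d" using perf_dist_nonempty[OF pd] by simp
  have \<alpha>s: "\<alpha>s ! i \<in> states T A" if "i < ?d" for i using that perf_dist_normalised[OF pd] normalised_states by simp
  note \<Gamma>s = normalised_states[OF \<Gamma>(1)] and Ym = channel_trafos[OF Y(1)] and gs = pure_trafos[OF g(1)]
    and \<Phi>s = normalised_states[OF \<Phi>]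
  obtain as where as: "as \<in> tests T A \<I>" "length as = ?d"
    "\<And>i j. i < ?d \<Longrightarrow> j < ?d \<Longrightarrow> val (as ! i \<odot> \<alpha>s ! j) = (if i = j then 1 else 0)"
    using perf_distE[OF pd] by blast
  have ase: "as ! i \<in> effects T A" if "i < ?d" for i using nth_trafos[OF as(1)] as(2) that by simp
  define y where "y = (Y \<otimes> idt T R) \<odot> \<Gamma>"
  have ys: "y \<in> states T (A \<diamondop> (D \<diamondop> R))"
    using normalised_states[OF channel_par_normalised[OF Y(1) \<Gamma>(1)]] by (simp add: y_def cmpst_assoc)
  have y_apply: "(a \<otimes> (h \<otimes> k)) \<odot> y = (((a \<otimes> h) \<odot> Y) \<otimes> k) \<odot> \<Gamma>"
    if a: "a \<in> effects T A" and h: "h \<in> trafos T D D'" and k: "k \<in> effects T R" for a h k D'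
  proof -
    have ah: "a \<otimes> h \<in> trafos T (A \<diamondop> D) D'" using par_trafos[OF a h] by (simp add: cmpst_triv_left)
    show ?thesis unfolding y_def using par_act[OF \<Gamma>s Ym idt_trafos ah k] par_assoc[OF a h k] sq_idt_right[OF k] by simp
  qed
  have Y_apply: "((a \<otimes> h) \<odot> Y) \<odot> \<alpha>s ! j = val (a \<odot> \<alpha>s ! j) *\<^sub>R (h \<odot> \<Phi> j)"
    if a: "a \<in> effects T A" and h: "h \<in> trafos T D D'" and j: "j < ?d" for a h j D'
  proof -
    have ah: "a \<otimes> h \<in> trafos T (A \<diamondop> D) D'" using par_trafos[OF a h] by (simp add: cmpst_triv_left)
    show ?thesis using sq_assoc[OF \<alpha>s[OF j] Ym ah] Y(2)[OF j] effect_left_product[OF a \<alpha>s[OF j] h \<Phi>s[OF j]] by simp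
  qed
  \<comment> \<open>The effects that distinguish the \<open>\<alpha>\<^sub>i\<close> sum to the unit
    effect, so it suffices to condition on each of them.\<close>
  have cond: "(as ! i \<otimes> idt T (D \<diamondop> R)) \<odot> y = (1 / ?d) *\<^sub>R (\<Phi> i \<otimes> \<eta> i)" if i: "i < ?d" for i
  proof -
    define yi where "yi = (as ! i \<otimes> idt T (D \<diamondop> R)) \<odot> y"
    have yis: "yi \<in> states T (D \<diamondop> R)" unfolding yi_def by (rule sq_trafos[OF ys effect_left_trafos[OF ase[OF i]]])
    have au: "as ! i \<otimes> ?u D \<in> effects T (A \<diamondop> D)" by (rule effects_par[OF ase[OF i] unit_trafos])
    have yi_apply: "(h \<otimes> k) \<odot> yi = (as ! i \<otimes> (h \<otimes> k)) \<odot> y"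
      if h: "h \<in> trafos T D D'" and k: "k \<in> effects T R" for h k D'
    proof -
      have hk: "h \<otimes> k \<in> trafos T (D \<diamondop> R) D'" using par_trafos[OF h k] by (simp add: cmpst_triv_right)
      show ?thesis unfolding yi_def using par_act_comm(2)[OF ys ase[OF i] hk] by (simp add: par_triv_left[OF hk])
    qed
    have "(?u D \<otimes> ?u R) \<odot> yi = (((as ! i \<otimes> ?u D) \<odot> Y) \<otimes> ?u R) \<odot> \<Gamma>"
      using yi_apply[OF unit_trafos unit_trafos] y_apply[OF ase[OF i] unit_trafos unit_trafos] by simp
    also have "\<dots> = ((as ! i \<otimes> ?u D) \<odot> Y) \<odot> (\<Sum>j<?d. (1 / ?d) *\<^sub>R \<alpha>s ! j)"
      using pair_par(2)[OF \<Gamma>s sq_trafos[OF Ym au] unit_trafos] \<Gamma>(2) by (simp add: marginal_def)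
    also have "\<dots> = (\<Sum>j<?d. (1 / ?d) *\<^sub>R (val (as ! i \<odot> \<alpha>s ! j) *\<^sub>R (?u D \<odot> \<Phi> j)))"
      using Y_apply[OF ase[OF i] unit_trafos] by (simp add: bilin_sum bilin)
    finally have "wt (D \<diamondop> R) yi = (\<Sum>j<?d. (1 / ?d) * (val (as ! i \<odot> \<alpha>s ! j) * val (?u D \<odot> \<Phi> j)))"
      by (simp add: wt_def unit_par val_sum val_simps)
    also have "\<dots> = (\<Sum>j<?d. if j = i then 1 / ?d else 0)"
      using as(3)[OF i] unit_normalised[OF \<Phi>] by (intro sum.cong) auto
    also have "\<dots> = 1 / ?d" using i by simp
    finally have w: "wt (D \<diamondop> R) yi = 1 / ?d" .
    then have "yi \<noteq> 0" using d by (auto simp: wt_simps)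
    then obtain z where z: "normalised T (D \<diamondop> R) z" "yi = (1 / ?d) *\<^sub>R z"
      using state_normalise[OF yis] w by metis
    have aI: "as ! i \<otimes> idt T D \<in> trafos T (A \<diamondop> D) D" by (rule effect_left_trafos[OF ase[OF i]])
    have "(idt T D \<otimes> g i) \<odot> yi = (((as ! i \<otimes> idt T D) \<odot> Y) \<otimes> g i) \<odot> \<Gamma>"
      using yi_apply[OF idt_trafos gs[OF i]] y_apply[OF ase[OF i] idt_trafos gs[OF i]] by simp
    also have "\<dots> = ((as ! i \<otimes> idt T D) \<odot> Y) \<odot> ((1 / ?d) *\<^sub>R \<alpha>s ! i)"
      using par_act_comm(1)[OF \<Gamma>s sq_trafos[OF Ym aI] gs[OF i]] g(4)[OF i] by (simp add: par_triv_right[OF sq_trafos[OF Ym aI]])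
    also have "\<dots> = (1 / ?d) *\<^sub>R \<Phi> i"
      using Y_apply[OF ase[OF i] idt_trafos i] as(3)[OF i i] sq_idt_left[OF \<Phi>s[OF i]] by (simp add: bilin)
    finally have "(1 / ?d) *\<^sub>R ((idt T D \<otimes> g i) \<odot> z) = (1 / ?d) *\<^sub>R \<Phi> i" by (simp only: z(2) sq_scale_right)
    \<comment> \<open>A normalised result: \<open>g i\<close> takes up the whole conditional weight,
      which forces \<open>\<eta> i\<close> on \<open>R\<close>.\<close>
    then have "(idt T D \<otimes> g i) \<odot> z = \<Phi> i" using d by simp
    then have "z = \<Phi> i \<otimes> \<eta> i" by (rule sharp_conditional_product[OF z(1) g(1-3)[OF i] _ \<Phi>[OF i]])
    then show ?thesis using z(2) by (simp add: yi_def)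
  qed
  have "?u A = (\<Sum>i<?d. as ! i)" using unit_unique[OF test_total[OF as(1)]] as(2) by simp
  then have "(?u A \<otimes> idt T (D \<diamondop> R)) \<odot> y = (\<Sum>i<?d. (as ! i \<otimes> idt T (D \<diamondop> R)) \<odot> y)" by (simp add: bilin_sum)
  also have "\<dots> = (\<Sum>i<?d. (1 / ?d) *\<^sub>R (\<Phi> i \<otimes> \<eta> i))" using cond by simp
  finally show ?thesis by (simp add: y_def)
qed

text \<open>Strong symmetry acts on states, while controllability asks for an identity of
  transformations from \<open>B\<close>; the faithful state encodes the latter in the former. The
  price is a channel that also acts on \<open>C\<close>, and uniqueness of purification removes that
  dependence.\<close>

lemma strong_symmetry_imp_reversible_controllability:
  assumes "strong_symmetry T"
  shows "reversible_controllability T"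
  unfolding reversible_controllability_def
proof (intro allI impI)
  fix A B \<alpha>s Us
  assume "pure_maximal T A \<alpha>s \<and> length Us = length \<alpha>s \<and> (\<forall>V \<in> set Us. reversible T B B V)"
  then have mx: "pure_maximal T A \<alpha>s" and len: "length Us = length \<alpha>s"
    and Us: "\<And>i. i < length \<alpha>s \<Longrightarrow> reversible T B B (Us ! i)" by auto
  note \<alpha>D = pure_maximalD[OF mx] and Um = reversible_trafos[OF Us]
  have \<alpha>p: "\<forall>\<alpha>\<in>set \<alpha>s. pure T \<I> A \<alpha>" using mx by (simp add: pure_maximal_def)
  let ?d = "length \<alpha>s"
  let ?u = "unit_effect T"
  have d: "0 < ?d" using \<alpha>D(2) by simp
  obtain C \<Phi> where \<Phi>: "normalised T (B \<diamondop> C) \<Phi>" "pure T \<I> (B \<diamondop> C) \<Phi>"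
    and faithful: "\<And>D f g. f \<in> trafos T B D \<Longrightarrow> g \<in> trafos T B D \<Longrightarrow>
       (f \<otimes> idt T C) \<odot> \<Phi> = (g \<otimes> idt T C) \<odot> \<Phi> \<Longrightarrow> f = g"
    using faithful_state[of B] by blast
  note \<Phi>s = normalised_states[OF \<Phi>(1)]
  define \<Psi> where "\<Psi> i = (Us ! i \<otimes> idt T C) \<odot> \<Phi>" for i
  have UC: "reversible T (B \<diamondop> C) (B \<diamondop> C) (Us ! i \<otimes> idt T C)" if "i < ?d" for i
    by (rule reversible_par[OF Us[OF that] reversible_idt])
  have \<Psi>: "normalised T (B \<diamondop> C) (\<Psi> i)" "pure T \<I> (B \<diamondop> C) (\<Psi> i)" if "i < ?d" for i
    unfolding \<Psi>_def using channel_normalised[OF reversible_channel[OF UC[OF that]] \<Phi>(1)]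
      reversible_preserves_pure[OF UC[OF that] \<Phi>(2)] by auto
  obtain W where W: "reversible T (A \<diamondop> (B \<diamondop> C)) (A \<diamondop> (B \<diamondop> C)) W"
    "\<And>i. i < ?d \<Longrightarrow> W \<odot> (\<alpha>s ! i \<otimes> \<Phi>) = \<alpha>s ! i \<otimes> \<Psi> i"
    using convert_tags[OF assms \<alpha>D(1) \<alpha>p, of "B \<diamondop> C" "\<lambda>_. \<Phi>" \<Psi>] \<Phi> \<Psi> by blast
  obtain R \<Gamma> g \<eta> where \<Gamma>: "normalised T (A \<diamondop> R) \<Gamma>" "pure T \<I> (A \<diamondop> R) \<Gamma>"
    "marginal T A R \<Gamma> = (\<Sum>i<?d. (1 / ?d) *\<^sub>R \<alpha>s ! i)"
    and g: "\<And>i. i < ?d \<Longrightarrow> pure T R \<I> (g i)" "\<And>i. i < ?d \<Longrightarrow> normalised T R (\<eta> i)"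
    "\<And>i. i < ?d \<Longrightarrow> val (g i \<odot> \<eta> i) = 1"
    "\<And>i. i < ?d \<Longrightarrow> (idt T A \<otimes> g i) \<odot> \<Gamma> = (1 / ?d) *\<^sub>R \<alpha>s ! i"
    using sharply_steered_purification[OF assms \<alpha>D(1) \<alpha>p] by blast
  note \<Gamma>s = normalised_states[OF \<Gamma>(1)] and gs = pure_trafos[OF g(1)]
  let ?E = "A \<diamondop> (B \<diamondop> C)"
  define Y where "Y = idt T A \<otimes> \<Phi>"
  have Y: "channel T A ?E Y" "pure T A ?E Y"
    unfolding Y_def by (rule append_state_channel[OF \<Phi>(1)], rule append_state_pure[OF \<Phi>(2)])
  have WY: "channel T A ?E (W \<odot> Y)" "pure T A ?E (W \<odot> Y)"
    using channel_sq[OF Y(1) reversible_channel[OF W(1)]] pure_sq[OF Y(2) pure_reversible[OF W(1)]] by auto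
  note Ym = channel_trafos[OF Y(1)] and WYm = channel_trafos[OF WY(1)]
  have Y\<alpha>: "Y \<odot> \<alpha>s ! i = \<alpha>s ! i \<otimes> \<Phi>" if "i < ?d" for i
    unfolding Y_def by (rule append_state[OF \<alpha>D(5)[OF that] \<Phi>s])
  have WY\<alpha>: "(W \<odot> Y) \<odot> \<alpha>s ! i = \<alpha>s ! i \<otimes> \<Psi> i" if "i < ?d" for i
    using sq_assoc[OF \<alpha>D(5)[OF that] Ym reversible_trafos[OF W(1)]] Y\<alpha>[OF that] W(2)[OF that] by simp
  define y where "y X = (X \<otimes> idt T R) \<odot> \<Gamma>" for X
  have assoc: "?E \<diamondop> R = (A \<diamondop> B) \<diamondop> (C \<diamondop> R)" "?E \<diamondop> R = A \<diamondop> ((B \<diamondop> C) \<diamondop> R)" by (simp_all add: cmpst_assoc)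
  have y: "normalised T ((A \<diamondop> B) \<diamondop> (C \<diamondop> R)) (y X)" "pure T \<I> ((A \<diamondop> B) \<diamondop> (C \<diamondop> R)) (y X)"
    if "channel T A ?E X" "pure T A ?E X" for X
    unfolding y_def assoc(1)[symmetric]
    using channel_par_normalised[OF that(1) \<Gamma>(1)] pure_sq[OF \<Gamma>(2) pure_par[OF that(2) pure_idt]] by auto
  \<comment> \<open>The marginal of \<open>\<Phi>\<close> on \<open>C\<close>. A channel on
    \<open>B\<close> does not change it, so it is the same for every
    \<open>\<Psi> i\<close>.\<close>
  let ?\<kappa> = "(?u B \<otimes> idt T C) \<odot> \<Phi>"
  have marg: "(?u (A \<diamondop> B) \<otimes> idt T (C \<diamondop> R)) \<odot> y X = (\<Sum>i<?d. (1 / ?d) *\<^sub>R (?\<kappa> \<otimes> \<eta> i))"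
    if X: "channel T A ?E X" "pure T A ?E X" "\<And>i. i < ?d \<Longrightarrow> X \<odot> \<alpha>s ! i = \<alpha>s ! i \<otimes> \<Theta> i"
      and \<Theta>: "\<And>i. i < ?d \<Longrightarrow> normalised T (B \<diamondop> C) (\<Theta> i)" "\<And>i. i < ?d \<Longrightarrow> (?u B \<otimes> idt T C) \<odot> \<Theta> i = ?\<kappa>" for X \<Theta>
  proof -
    have ys: "y X \<in> states T (A \<diamondop> (B \<diamondop> (C \<diamondop> R)))" using normalised_states[OF y(1)[OF X(1,2)]] by (simp add: cmpst_assoc)
    have uI: "?u B \<otimes> idt T (C \<diamondop> R) \<in> trafos T (B \<diamondop> (C \<diamondop> R)) (C \<diamondop> R)" by (rule effect_left_trafos[OF unit_trafos])
    have "(?u (A \<diamondop> B) \<otimes> idt T (C \<diamondop> R)) \<odot> y X = (?u A \<otimes> (?u B \<otimes> idt T (C \<diamondop> R))) \<odot> y X"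
      using par_assoc[OF unit_trafos unit_trafos idt_trafos] by (simp add: unit_par)
    also have "\<dots> = (?u B \<otimes> idt T (C \<diamondop> R)) \<odot> ((?u A \<otimes> idt T (B \<diamondop> (C \<diamondop> R))) \<odot> y X)"
      using par_act_comm(2)[OF ys unit_trafos uI] by (simp add: par_triv_left[OF uI])
    also have "(?u A \<otimes> idt T (B \<diamondop> (C \<diamondop> R))) \<odot> y X = (\<Sum>i<?d. (1 / ?d) *\<^sub>R (\<Theta> i \<otimes> \<eta> i))"
      using dephased_marginal[OF \<alpha>D(1) \<Gamma>(1,3) g X(1,3) \<Theta>(1)] by (simp add: y_def cmpst_assoc)
    also have "(?u B \<otimes> idt T (C \<diamondop> R)) \<odot> \<dots> = (\<Sum>i<?d. (1 / ?d) *\<^sub>R ((?u B \<otimes> idt T (C \<diamondop> R)) \<odot> (\<Theta> i \<otimes> \<eta> i)))"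
      by (simp add: bilin_sum bilin)
    also have "\<dots> = (\<Sum>i<?d. (1 / ?d) *\<^sub>R (?\<kappa> \<otimes> \<eta> i))"
    proof (intro sum.cong refl arg_cong[where f = "scaleR (1 / ?d)"])
      fix i assume "i \<in> {..<?d}"
      then have i: "i < ?d" by simp
      note \<eta>s = normalised_states[OF g(2)[OF i]]
      have "(?u B \<otimes> idt T (C \<diamondop> R)) \<odot> (\<Theta> i \<otimes> \<eta> i) = ((?u B \<otimes> idt T C) \<otimes> idt T R) \<odot> (\<Theta> i \<otimes> \<eta> i)"
        using par_assoc[OF unit_trafos idt_trafos idt_trafos] by (simp add: par_idt)
      also have "\<dots> = ((?u B \<otimes> idt T C) \<odot> \<Theta> i) \<otimes> (idt T R \<odot> \<eta> i)"
        by (rule interchange[OF normalised_states[OF \<Theta>(1)[OF i]] effect_left_trafos[OF unit_trafos] \<eta>s idt_trafos])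
      finally show "(?u B \<otimes> idt T (C \<diamondop> R)) \<odot> (\<Theta> i \<otimes> \<eta> i) = ?\<kappa> \<otimes> \<eta> i"
        by (simp add: \<Theta>(2)[OF i] sq_idt_left[OF \<eta>s])
    qed
    finally show ?thesis .
  qed
  have "(?u B \<otimes> idt T C) \<odot> \<Psi> i = ?\<kappa>" if i: "i < ?d" for i
    unfolding \<Psi>_def using par_act[OF \<Phi>s Um[OF i] idt_trafos unit_trafos idt_trafos]
      unit_channel[OF reversible_channel[OF Us[OF i]]] by (simp add: sq_idt_left[OF idt_trafos])
  then have meq: "(?u (A \<diamondop> B) \<otimes> idt T (C \<diamondop> R)) \<odot> y Y = (?u (A \<diamondop> B) \<otimes> idt T (C \<diamondop> R)) \<odot> y (W \<odot> Y)"
    using marg[OF Y Y\<alpha> \<Phi>(1)] marg[OF WY WY\<alpha> \<Psi>(1)] by simp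
  \<comment> \<open>Both states purify the same state of \<open>C \<diamondop> R\<close>, with
    \<open>A \<diamondop> B\<close> as the purifying system.\<close>
  obtain U where U: "reversible T (A \<diamondop> B) (A \<diamondop> B) U" "y (W \<odot> Y) = (U \<otimes> idt T (C \<diamondop> R)) \<odot> y Y"
    using purification_unique_left[OF y[OF Y] y[OF WY] meq] .
  note Utr = reversible_trafos[OF U(1)]
  have UCm: "U \<otimes> idt T C \<in> trafos T ?E ?E" using par_trafos[OF Utr idt_trafos[of C]] by (simp add: cmpst_assoc)
  have "U \<odot> (\<alpha>s ! i \<otimes> idt T B) = \<alpha>s ! i \<otimes> Us ! i" if i: "i < ?d" for i
  proof -
    note \<alpha>i = \<alpha>D(5)[OF i]
    have yE: "y Y \<in> states T (?E \<diamondop> R)" using normalised_states[OF y(1)[OF Y]] by (simp only: assoc(1))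
    \<comment> \<open>The effect on \<open>R\<close> singles out \<open>\<alpha>s ! i\<close>, so
      one equality of joint states yields an equality for each \<open>i\<close>.\<close>
    have steer: "(idt T ?E \<otimes> g i) \<odot> y X = (1 / ?d) *\<^sub>R (X \<odot> \<alpha>s ! i)" if "X \<in> trafos T A ?E" for X
      unfolding y_def using effect_slide[OF \<Gamma>s that gs[OF i]] g(4)[OF i] by (simp add: bilin)
    have "(1 / ?d) *\<^sub>R (\<alpha>s ! i \<otimes> \<Psi> i) = (idt T ?E \<otimes> g i) \<odot> y (W \<odot> Y)"
      using steer[OF WYm] WY\<alpha>[OF i] by simp
    also have "y (W \<odot> Y) = ((U \<otimes> idt T C) \<otimes> idt T R) \<odot> y Y"
      unfolding U(2) using par_assoc[OF Utr idt_trafos idt_trafos] by (simp add: par_idt)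
    also have "(idt T ?E \<otimes> g i) \<odot> \<dots> = (U \<otimes> idt T C) \<odot> ((idt T ?E \<otimes> g i) \<odot> y Y)"
      by (rule effect_slide[OF yE UCm gs[OF i]])
    also have "\<dots> = (1 / ?d) *\<^sub>R ((U \<otimes> idt T C) \<odot> (\<alpha>s ! i \<otimes> \<Phi>))"
      using steer[OF Ym] Y\<alpha>[OF i] by (simp add: bilin)
    finally have eq: "\<alpha>s ! i \<otimes> \<Psi> i = (U \<otimes> idt T C) \<odot> (\<alpha>s ! i \<otimes> \<Phi>)" using d by simp
    have ext: "(\<alpha>s ! i \<otimes> h) \<in> trafos T B (A \<diamondop> B)"
      "((\<alpha>s ! i \<otimes> h) \<otimes> idt T C) \<odot> \<Phi> = \<alpha>s ! i \<otimes> ((h \<otimes> idt T C) \<odot> \<Phi>)" if h: "h \<in> trafos T B B" for h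
    proof -
      show "(\<alpha>s ! i \<otimes> h) \<in> trafos T B (A \<diamondop> B)" using par_trafos[OF \<alpha>i h] by (simp add: cmpst_triv_left)
      have "((\<alpha>s ! i \<otimes> h) \<otimes> idt T C) \<odot> \<Phi> = (\<alpha>s ! i \<otimes> (h \<otimes> idt T C)) \<odot> (idt T \<I> \<otimes> \<Phi>)"
        using par_assoc[OF \<alpha>i h idt_trafos] by (simp add: par_triv_left[OF \<Phi>s])
      also have "\<dots> = (\<alpha>s ! i \<odot> idt T \<I>) \<otimes> ((h \<otimes> idt T C) \<odot> \<Phi>)"
        by (rule interchange[OF idt_trafos \<alpha>i \<Phi>s par_trafos[OF h idt_trafos]])
      finally show "((\<alpha>s ! i \<otimes> h) \<otimes> idt T C) \<odot> \<Phi> = \<alpha>s ! i \<otimes> ((h \<otimes> idt T C) \<odot> \<Phi>)"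
        by (simp add: sq_idt_right[OF \<alpha>i])
    qed
    have id\<Phi>: "(idt T B \<otimes> idt T C) \<odot> \<Phi> = \<Phi>" using sq_idt_left[OF \<Phi>s] by (simp add: par_idt)
    note m1 = ext(1)[OF idt_trafos]
    have "((U \<odot> (\<alpha>s ! i \<otimes> idt T B)) \<otimes> idt T C) \<odot> \<Phi> = (U \<otimes> idt T C) \<odot> (((\<alpha>s ! i \<otimes> idt T B) \<otimes> idt T C) \<odot> \<Phi>)"
      using par_act[OF \<Phi>s m1 idt_trafos Utr idt_trafos] by (simp add: sq_idt_left[OF idt_trafos])
    also have "\<dots> = \<alpha>s ! i \<otimes> \<Psi> i" using ext(2)[OF idt_trafos] id\<Phi> eq by simp
    also have "\<dots> = ((\<alpha>s ! i \<otimes> Us ! i) \<otimes> idt T C) \<odot> \<Phi>" using ext(2)[OF Um[OF i]] by (simp add: \<Psi>_def)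
    finally show ?thesis by (rule faithful[OF sq_trafos[OF m1 Utr] ext(1)[OF Um[OF i]]])
  qed
  then show "\<exists>U. reversible T (A \<diamondop> B) (A \<diamondop> B) U \<and> (\<forall>i < length \<alpha>s. U \<odot> (\<alpha>s ! i \<otimes> idt T B) = \<alpha>s ! i \<otimes> Us ! i)"
    using U(1) by blast
qed

end

theorem proposition5p8p7:
  fixes T :: "('s, 't::real_normed_vector) op_structure"
  assumes "sharp_theory_with_purification T"
  shows "(permutability T \<longleftrightarrow> strong_symmetry T) \<and>
         (strong_symmetry T \<longleftrightarrow> reversible_controllability T)"
proof -
  interpret sharp_theory_with_purification T by (rule assms)
  show ?thesis
    using permutability_imp_strong_symmetry strong_symmetry_imp_permutability
      reversible_controllability_imp_strong_symmetry strong_symmetry_imp_reversible_controllability by blast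
qed

end
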